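(* For any finite set $X\subset \mathbb{P}^1(\overline{\mathbb{Q}})$ with $|X|\ge 2$, there exists a rigid, postcritically finite rational map $f:\mathbb{P}^1\to\mathbb{P}^1$ such that $P(f)=X$.
   Context: Here $\mathbb{P}^1=\mathbb{P}^1(\mathbb{C})=\mathbb{C}\cup\{\infty\}$ is the Riemann sphere, $\overline{\mathbb{Q}}\subset\mathbb{C}$ is the field of algebraic numbers, and $\mathbb{P}^1(\overline{\mathbb{Q}})=\overline{\mathbb{Q}}\cup\{\infty\}\subset \mathbb{P}^1$. Rational maps $f:\mathbb{P}^1\to\mathbb{P}^1$ have complex coefficients and degree $d\ge 2$. $C(f)\subset\mathbb{P}^1$ is the set of critical points of $f$ and $V(f)=f(C(f))$ is the set of critical values. The postcritical set of $f$ is $P(f)=\bigcup_{n\ge 0} f^n(V(f))$, where $f^n$ is the $n$-th iterate. The map $f$ is postcritically finite if $|P(f)|<\infty$. A postcritically finite rational map $f$ is rigid if any postcritically finite rational map $g$ that is uniformly close enough to $f$ (as maps of the sphere) and satisfies $|P(g)|=|P(f)|$ is conformally conjugate to $f$, i.e. $g=\alpha\circ f\circ\alpha^{-1}$ for some Möbius transformation $\alpha\in\operatorname{Aut}(\mathbb{P}^1)$. *)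

theory Defs
  imports
    "HOL-Complex_Analysis.Complex_Analysis"
    "HOL-Computational_Algebra.Computational_Algebra"
begin

text \<open>The Riemann sphere is \<open>\<complex> \<union> {\<infinity>}\<close> with \<open>None\<close> playing the role of \<open>\<infinity>\<close>, the same
  encoding of the added point as in the library's Alexandroff compactification.\<close>

type_synonym sphere = "complex option"

definition P1_Qbar :: "sphere set" where
  "P1_Qbar = insert None (Some ` {z. algebraic z})"

text \<open>The map \<open>p / q\<close>. In homogeneous coordinates it is \<open>[P : Q]\<close>, with \<open>P\<close> and \<open>Q\<close> the
  homogenisations of \<open>p\<close> and \<open>q\<close> to degree \<open>d = max (deg p) (deg q)\<close>, so its value at
  \<open>\<infinity> = [1 : 0]\<close> is the quotient of the coefficients of index \<open>d\<close>. Used only for coprime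
  \<open>p\<close>, \<open>q\<close>.\<close>

definition rat_map :: "complex poly \<Rightarrow> complex poly \<Rightarrow> sphere \<Rightarrow> sphere" where
  "rat_map p q x =
     (case x of
        Some z \<Rightarrow> if poly q z = 0 then None else Some (poly p z / poly q z)
      | None \<Rightarrow>
          let d = max (degree p) (degree q)
          in if coeff q d = 0 then None else Some (coeff p d / coeff q d))"

definition rational_map :: "(sphere \<Rightarrow> sphere) \<Rightarrow> bool" where
  "rational_map f \<longleftrightarrow>
     (\<exists>p q. coprime p q \<and> max (degree p) (degree q) \<ge> 2 \<and> f = rat_map p q)"

definition mobius :: "(sphere \<Rightarrow> sphere) \<Rightarrow> bool" where
  "mobius \<alpha> \<longleftrightarrow>
     (\<exists>a b c d. a * d - b * c \<noteq> 0 \<and> \<alpha> = rat_map [:b, a:] [:d, c:])"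

text \<open>Local coordinates about \<open>x\<close>: the coordinate \<open>z\<close> if \<open>x\<close> is finite, and \<open>1 / z\<close> if
  \<open>x = \<infinity>\<close>. In either case \<open>chart x\<close> is meant on the domain of that coordinate (\<open>\<complex>\<close>,
  respectively the sphere without \<open>0\<close>), and its value \<open>0\<close> at the remaining point of the
  sphere is irrelevant.\<close>

definition chart :: "sphere \<Rightarrow> sphere \<Rightarrow> complex" where
  "chart x y =
     (case y of
        None \<Rightarrow> 0
      | Some z \<Rightarrow> if x = None then inverse z else z)"

definition chart_inv :: "sphere \<Rightarrow> complex \<Rightarrow> sphere" where
  "chart_inv x u =
     (if x = None then (if u = 0 then None else Some (inverse u)) else Some u)"

definition critical_points :: "(sphere \<Rightarrow> sphere) \<Rightarrow> sphere set" where
  "critical_points f =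
     {x. ((\<lambda>u. chart (f x) (f (chart_inv x u))) has_field_derivative 0) (at (chart x x))}"

definition critical_values :: "(sphere \<Rightarrow> sphere) \<Rightarrow> sphere set" where
  "critical_values f = f ` critical_points f"

definition postcritical_set :: "(sphere \<Rightarrow> sphere) \<Rightarrow> sphere set" where
  "postcritical_set f = (\<Union>n. (f ^^ n) ` critical_values f)"

definition postcritically_finite :: "(sphere \<Rightarrow> sphere) \<Rightarrow> bool" where
  "postcritically_finite f \<longleftrightarrow> finite (postcritical_set f)"

text \<open>The chordal distance: the Euclidean distance in \<open>\<real>\<^sup>3\<close> after stereographic projection to
  the unit sphere.\<close>

definition chordal_dist :: "sphere \<Rightarrow> sphere \<Rightarrow> real" where
  "chordal_dist x y =
     (case (x, y) of
        (Some z, Some w) \<Rightarrow>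
          2 * cmod (z - w) / (sqrt (1 + (cmod z)\<^sup>2) * sqrt (1 + (cmod w)\<^sup>2))
      | (Some z, None) \<Rightarrow> 2 / sqrt (1 + (cmod z)\<^sup>2)
      | (None, Some w) \<Rightarrow> 2 / sqrt (1 + (cmod w)\<^sup>2)
      | (None, None) \<Rightarrow> 0)"

definition conformally_conjugate :: "(sphere \<Rightarrow> sphere) \<Rightarrow> (sphere \<Rightarrow> sphere) \<Rightarrow> bool" where
  "conformally_conjugate f g \<longleftrightarrow> (\<exists>\<alpha>. mobius \<alpha> \<and> g = \<alpha> \<circ> f \<circ> inv \<alpha>)"

definition rigid :: "(sphere \<Rightarrow> sphere) \<Rightarrow> bool" where
  "rigid f \<longleftrightarrow>
     (\<exists>\<epsilon>>0. \<forall>g.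
        rational_map g \<and> postcritically_finite g
        \<and> (\<forall>x. chordal_dist (f x) (g x) < \<epsilon>)
        \<and> card (postcritical_set g) = card (postcritical_set f)
        \<longrightarrow> conformally_conjugate f g)"

end

theory Submission
  imports Defs
begin

text \<open>The map is \<open>f = h \<circ> T \<circ> b\<close>. Here \<open>b\<close> is a Belyi polynomial, which carries \<open>X\<close> and its own critical values into
\<open>{0, 1, \<infinity>}\<close> (\<open>belyi_map\<close>); this is where algebraicity is used. The outer map \<open>h\<close> has \<open>X\<close> as its set of critical
values (\<open>prescribed_critical_values\<close>), and \<open>T\<close> is the Moebius map that takes \<open>0, 1, \<infinity>\<close> to preimages under \<open>h\<close> of
three points of \<open>X\<close>. Then \<open>f\<close> maps \<open>X\<close> into \<open>X\<close> and has critical values \<open>X\<close>, so \<open>P(f) = X\<close>.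

Rigidity. Let \<open>g\<^sub>n \<rightarrow> f\<close> be postcritically finite with \<open>|P(g\<^sub>n)| = |X|\<close>. Critical values persist, and there is no
room for further postcritical points, so \<open>P(g\<^sub>n) = V(g\<^sub>n) = \<phi>\<^sub>n(X)\<close> with \<open>\<phi>\<^sub>n \<rightarrow> id\<close> on \<open>X\<close> and \<open>g\<^sub>n \<phi>\<^sub>n = \<phi>\<^sub>n f\<close>
(\<open>perturbed_postcritical_set\<close>). The map \<open>h\<close> is explicit enough to be deformed to \<open>H\<^sub>n\<close> with critical values
\<open>\<phi>\<^sub>n(X)\<close>. Since \<open>f\<close> on \<open>X\<close> factors through the three points \<open>0, 1, \<infinity>\<close>, which Moebius maps \<open>K\<^sub>n\<close> move at will, the maps
\<open>F\<^sub>n = H\<^sub>n \<circ> K\<^sub>n \<circ> T \<circ> b\<close> satisfy \<open>F\<^sub>n x = \<phi>\<^sub>n (f x)\<close> on \<open>X\<close>: the points of \<open>X\<close> themselves need not be moved. In the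
language of Thurston, the pull-back map of \<open>f\<close> factors through the moduli space of three points and is therefore
constant.

The rest is uniqueness. By \<open>local_uniqueness\<close>, a map near \<open>f\<close> is determined by positions of its critical values near
those of \<open>f\<close> together with the preimages of three points. If \<open>M\<^sub>n\<close> is the Moebius map that agrees with \<open>\<phi>\<^sub>n\<close> at three
points of \<open>X\<close>, this gives \<open>g\<^sub>n = F\<^sub>n \<circ> M\<^sub>n\<^sup>-\<^sup>1\<close>. Preimages near a given point are unique
(\<open>preimage_unique\<close>), so \<open>M\<^sub>n = \<phi>\<^sub>n\<close> on all of \<open>X\<close>. A second use of \<open>local_uniqueness\<close> gives \<open>F\<^sub>n = M\<^sub>n \<circ> f\<close>, and hence
\<open>g\<^sub>n = M\<^sub>n \<circ> f \<circ> M\<^sub>n\<^sup>-\<^sup>1\<close>. For two points there are not three to fix; there \<open>f\<close> is conjugate to \<open>z\<^sup>2\<close>, and the remaining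
scaling is absorbed by hand (\<open>exists_rigid_two_points\<close>).

The proof of \<open>local_uniqueness\<close> is algebraic. In coordinates with \<open>f(\<infinity>) = \<infinity> \<notin> X\<close>, the coefficients of nearby maps
converge (\<open>cconv_imp_coeff_conv\<close>). The Riemann-Hurwitz count forces the fibres over \<open>\<phi>\<^sub>n(X)\<close> to have the same
multiplicities as those of \<open>f\<close> over \<open>X\<close> (\<open>fibre_structure\<close>). For two such sequences \<open>p\<^sub>n/q\<^sub>n\<close> and \<open>r\<^sub>n/s\<^sub>n\<close>, a limit
of the normalised polynomials \<open>p\<^sub>n s\<^sub>n - r\<^sub>n q\<^sub>n\<close> would be a nonzero polynomial of degree at most \<open>2d\<close> that vanishes to
order \<open>e - 1\<close> at every preimage of multiplicity \<open>e\<close> of a point of \<open>X\<close>, and to order \<open>e\<close> at three of them. That makes \<open>2d - 2 + 3\<close>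
zeros, a contradiction (\<open>same_branching_imp_equal\<close>).\<close>

section \<open>The sphere and its convergence\<close>

text \<open>The point \<open>[u : v]\<close>. Both charts of the sphere are covered by one formula, so that statements about rational maps need
no case distinction at \<open>\<infinity>\<close>.\<close>

definition proj :: "complex \<Rightarrow> complex \<Rightarrow> sphere" where
  "proj u v = (if v = 0 then None else Some (u / v))"

text \<open>Stereographic projection to the unit sphere of \<open>\<complex> \<times> \<real>\<close>. Limits of points of the sphere are taken in this model, where
the chordal distance is the Euclidean one.\<close>

definition stereo :: "sphere \<Rightarrow> complex \<times> real" where
  "stereo x = (case x of None \<Rightarrow> (0, 1)
     | Some z \<Rightarrow> (2 * z / of_real ((cmod z)\<^sup>2 + 1), ((cmod z)\<^sup>2 - 1) / ((cmod z)\<^sup>2 + 1)))"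

lemma chordal_dist_eq_dist_stereo: "chordal_dist x y = dist (stereo x) (stereo y)"
proof -
  have pos: "1 + (cmod z)\<^sup>2 > 0" for z by (simp add: add_pos_nonneg)
  have fin: "chordal_dist (Some z) (Some w) = dist (stereo (Some z)) (stereo (Some w))" for z w
  proof -
    define a b where "a = (cmod z)\<^sup>2" and "b = (cmod w)\<^sup>2"
    have ab: "a = (Re z)\<^sup>2 + (Im z)\<^sup>2" "b = (Re w)\<^sup>2 + (Im w)\<^sup>2"
      unfolding a_def b_def by (simp_all add: cmod_power2)
    have nz: "a + 1 \<noteq> 0" "b + 1 \<noteq> 0" "a + 1 > 0" "b + 1 > 0"
      using pos[of z] pos[of w] by (auto simp: a_def b_def)
    define t where "t = Re z * Re w + Im z * Im w"
    have 1: "(cmod (2 * z / of_real (a + 1) - 2 * w / of_real (b + 1)))\<^sup>2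
       = 4 * (a / (a + 1)\<^sup>2 + b / (b + 1)\<^sup>2 - 2 * t / ((a + 1) * (b + 1)))"
    proof -
      define p q where "p = 1 / (a + 1)" and "q = 1 / (b + 1)"
      have re: "Re (2 * z / of_real (a + 1) - 2 * w / of_real (b + 1)) = 2 * Re z * p - 2 * Re w * q"
        by (simp add: p_def q_def del: of_real_add)
      have im: "Im (2 * z / of_real (a + 1) - 2 * w / of_real (b + 1)) = 2 * Im z * p - 2 * Im w * q"
        by (simp add: p_def q_def del: of_real_add)
      have "(cmod (2 * z / of_real (a + 1) - 2 * w / of_real (b + 1)))\<^sup>2
        = 4 * (a * p\<^sup>2 + b * q\<^sup>2 - 2 * t * (p * q))"
        unfolding cmod_power2 re im by (simp add: ab t_def power2_eq_square algebra_simps)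
      then show ?thesis by (simp add: p_def q_def power_divide)
    qed
    have 2: "(cmod (z - w))\<^sup>2 = a + b - 2 * t"
      unfolding cmod_power2 by (simp add: ab t_def power2_eq_square algebra_simps)
    have 3: "4 * (a / (a + 1)\<^sup>2 + b / (b + 1)\<^sup>2 - 2 * t / ((a + 1) * (b + 1)))
       + ((a - 1) / (a + 1) - (b - 1) / (b + 1))\<^sup>2 = 4 * (a + b - 2 * t) / ((a + 1) * (b + 1))"
      using nz by (simp add: divide_simps) (simp add: power2_eq_square algebra_simps)
    have "dist (stereo (Some z)) (stereo (Some w)) = sqrt (4 * (a + b - 2 * t) / ((a + 1) * (b + 1)))"
      unfolding 3[symmetric] 1[symmetric]
      by (simp add: stereo_def dist_norm norm_Pair a_def[symmetric] b_def[symmetric])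
    also have "\<dots> = chordal_dist (Some z) (Some w)"
      unfolding 2[symmetric]
      by (simp add: chordal_dist_def real_sqrt_divide real_sqrt_mult a_def b_def add.commute)
    finally show ?thesis ..
  qed
  have inf: "dist (stereo (Some z)) (stereo None) = 2 / sqrt (1 + (cmod z)\<^sup>2)" for z
  proof -
    define a where "a = (cmod z)\<^sup>2"
    have nz: "a + 1 \<noteq> 0" "a + 1 > 0" using pos[of z] by (auto simp: a_def)
    have "(cmod (2 * z / of_real (a + 1)))\<^sup>2 = 4 * a / (a + 1)\<^sup>2"
      using nz by (simp add: norm_divide norm_mult power_divide power_mult_distrib a_def del: of_real_add)
    moreover have "4 * a / (a + 1)\<^sup>2 + ((a - 1) / (a + 1) - 1)\<^sup>2 = 4 / (1 + a)"
      using nz by (simp add: divide_simps) (simp add: power2_eq_square algebra_simps)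
    ultimately show ?thesis
      by (simp add: stereo_def dist_norm norm_Pair a_def[symmetric] real_sqrt_divide del: of_real_add)
  qed
  show ?thesis
    using fin inf by (cases x; cases y) (auto simp: chordal_dist_def dist_commute)
qed

lemma stereo_eq_iff: "stereo x = stereo y \<longleftrightarrow> x = y"
proof
  assume "stereo x = stereo y"
  then have "chordal_dist x y = 0" by (simp add: chordal_dist_eq_dist_stereo)
  moreover have "1 + (cmod z)\<^sup>2 \<noteq> 0" for z
    by (smt (verit) zero_le_power2)
  ultimately show "x = y"
    by (auto simp: chordal_dist_def split: option.splits prod.splits)
qed simp

text \<open>A formula that is continuous in \<open>(u, v)\<close> away from the origin: this is what makes limits of quotients tractable,
also when the denominator tends to \<open>0\<close>.\<close>

lemma stereo_proj:
  assumes "u \<noteq> 0 \<or> v \<noteq> 0"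
  shows "stereo (proj u v) = (2 * u * cnj v / of_real ((cmod u)\<^sup>2 + (cmod v)\<^sup>2),
     ((cmod u)\<^sup>2 - (cmod v)\<^sup>2) / ((cmod u)\<^sup>2 + (cmod v)\<^sup>2))"
proof (cases "v = 0")
  case True
  then show ?thesis using assms by (simp add: proj_def stereo_def)
next
  case False
  have "2 * (u / v) / of_real ((cmod (u / v))\<^sup>2 + 1)
     = 2 * u * cnj v / of_real ((cmod u)\<^sup>2 + (cmod v)\<^sup>2)"
  proof -
    have p: "(cmod u)\<^sup>2 + (cmod v)\<^sup>2 > 0" using False by (simp add: add_nonneg_pos)
    have "(cmod (u / v))\<^sup>2 + 1 = ((cmod u)\<^sup>2 + (cmod v)\<^sup>2) / (cmod v)\<^sup>2"
      using False by (simp add: norm_divide field_simps)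
    then have "2 * (u / v) / of_real ((cmod (u / v))\<^sup>2 + 1)
       = 2 * (u / v) * of_real ((cmod v)\<^sup>2) / of_real ((cmod u)\<^sup>2 + (cmod v)\<^sup>2)"
      by (simp only: of_real_divide) simp
    also have "of_real ((cmod v)\<^sup>2) = v * cnj v" by (metis complex_norm_square)
    finally show ?thesis using False by simp
  qed
  moreover have "((cmod (u / v))\<^sup>2 - 1) / ((cmod (u / v))\<^sup>2 + 1)
     = ((cmod u)\<^sup>2 - (cmod v)\<^sup>2) / ((cmod u)\<^sup>2 + (cmod v)\<^sup>2)"
  proof -
    define b where "b = (cmod v)\<^sup>2"
    have "b > 0" "(cmod u)\<^sup>2 + b > 0" using False by (auto simp: b_def add_nonneg_pos)
    then show ?thesis unfolding norm_divide power_divide b_def[symmetric]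
      by (simp add: divide_simps)
  qed
  ultimately show ?thesis using False by (simp add: proj_def stereo_def)
qed

lemma proj_eq_iff:
  assumes "u \<noteq> 0 \<or> v \<noteq> 0" "u' \<noteq> 0 \<or> v' \<noteq> 0"
  shows "proj u v = proj u' v' \<longleftrightarrow> u * v' = u' * v"
  using assms by (auto simp: proj_def field_simps)

lemma proj_scale: "c \<noteq> 0 \<Longrightarrow> proj (c * u) (c * v) = proj u v"
  by (auto simp: proj_def)

lemma proj_1: "proj z 1 = Some z" "proj 1 z = (if z = 0 then None else Some (inverse z))"
  by (simp_all add: proj_def field_simps)

text \<open>Convergence of points of the sphere along an arbitrary filter. Filters other than \<open>sequentially\<close> are needed for
derivatives and for \<open>cconv\<close> below.\<close>

definition sconv :: "('b \<Rightarrow> sphere) \<Rightarrow> sphere \<Rightarrow> 'b filter \<Rightarrow> bool" where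
  "sconv x a F \<longleftrightarrow> ((\<lambda>n. stereo (x n)) \<longlongrightarrow> stereo a) F"

lemma sconv_proj:
  assumes "(u \<longlongrightarrow> u0) F" "(v \<longlongrightarrow> v0) F" "u0 \<noteq> 0 \<or> v0 \<noteq> 0"
  shows "sconv (\<lambda>n. proj (u n) (v n)) (proj u0 v0) F"
proof -
  have ev: "\<forall>\<^sub>F n in F. u n \<noteq> 0 \<or> v n \<noteq> 0"
    using assms(3)
  proof
    assume "u0 \<noteq> 0"
    from tendsto_imp_eventually_ne[OF assms(1) this] show ?thesis by eventually_elim simp
  next
    assume "v0 \<noteq> 0"
    from tendsto_imp_eventually_ne[OF assms(2) this] show ?thesis by eventually_elim simp
  qed
  have nz: "(cmod u0)\<^sup>2 + (cmod v0)\<^sup>2 \<noteq> 0"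
    using assms(3) by (auto simp: add_nonneg_eq_0_iff)
  have "((\<lambda>n. (2 * u n * cnj (v n) / of_real ((cmod (u n))\<^sup>2 + (cmod (v n))\<^sup>2),
     ((cmod (u n))\<^sup>2 - (cmod (v n))\<^sup>2) / ((cmod (u n))\<^sup>2 + (cmod (v n))\<^sup>2))) \<longlongrightarrow> stereo (proj u0 v0)) F"
    unfolding stereo_proj[OF assms(3)]
    using nz by (intro tendsto_intros assms) (simp_all flip: of_real_power of_real_add add: of_real_eq_0_iff)
  then show ?thesis
    unfolding sconv_def
    by (rule Lim_transform_eventually) (use ev in eventually_elim, simp add: stereo_proj)
qed

lemma sconv_Some: "(z \<longlongrightarrow> a) F \<Longrightarrow> sconv (\<lambda>n. Some (z n)) (Some a) F"
  using sconv_proj[of z a F "\<lambda>_. 1" 1] by (simp add: proj_1)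

text \<open>In the stereographic model the two charts are quotients of coordinates, hence continuous where they should be.\<close>

lemma chart_eq_stereo:
  "chart (Some c) x = fst (stereo x) / of_real (1 - snd (stereo x))"
  "chart None x = cnj (fst (stereo x)) / of_real (1 + snd (stereo x))"
proof -
  have pos: "(cmod z)\<^sup>2 + 1 > 0" for z by (simp add: add_nonneg_pos)
  have cx: "1 - (b - 1) / (b + 1) = 2 / (b + 1)" "1 + (b - 1) / (b + 1) = 2 * b / (b + 1)"
    if "b + 1 > 0" for b :: real
    using that by (simp_all add: field_simps)
  show "chart (Some c) x = fst (stereo x) / of_real (1 - snd (stereo x))"
  proof (cases x)
    case (Some z)
    define r where "r = complex_of_real ((cmod z)\<^sup>2 + 1)"
    have "r \<noteq> 0" using pos[of z] unfolding r_def by (metis less_irrefl of_real_eq_0_iff)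
    moreover have "of_real (1 - snd (stereo x)) = 2 / r"
      unfolding Some stereo_def r_def option.case snd_conv cx(1)[OF pos] by (simp only: of_real_divide of_real_numeral)
    moreover have "fst (stereo x) = 2 * z / r" by (simp add: Some stereo_def r_def)
    ultimately show ?thesis by (simp add: Some chart_def)
  qed (simp add: chart_def stereo_def)
  show "chart None x = cnj (fst (stereo x)) / of_real (1 + snd (stereo x))"
  proof (cases x)
    case (Some z)
    define r where "r = complex_of_real ((cmod z)\<^sup>2 + 1)"
    have "r \<noteq> 0" using pos[of z] unfolding r_def by (metis less_irrefl of_real_eq_0_iff)
    moreover have "of_real (1 + snd (stereo x)) = 2 * (z * cnj z) / r"
      unfolding Some stereo_def r_def option.case snd_conv cx(2)[OF pos] complex_norm_square[symmetric]
      by (simp only: of_real_divide of_real_numeral of_real_mult)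
    moreover have "cnj (fst (stereo x)) = 2 * cnj z / r" by (simp add: Some stereo_def r_def)
    ultimately have "cnj (fst (stereo x)) / of_real (1 + snd (stereo x)) = cnj z / (z * cnj z)" by simp
    then show ?thesis by (cases "z = 0") (simp_all add: Some chart_def inverse_eq_divide)
  qed (simp add: chart_def stereo_def)
qed

lemma sconv_const: "sconv (\<lambda>_. a) a F"
  by (simp add: sconv_def)

lemma sconv_eventually_neq:
  assumes "sconv x a F" "sconv y b F" "a \<noteq> b"
  shows "\<forall>\<^sub>F n in F. x n \<noteq> y n"
proof -
  have "((\<lambda>n. stereo (x n) - stereo (y n)) \<longlongrightarrow> stereo a - stereo b) F"
    using assms unfolding sconv_def by (intro tendsto_intros)
  moreover have "stereo a - stereo b \<noteq> 0" using assms(3) by (simp add: stereo_eq_iff)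
  ultimately have "\<forall>\<^sub>F n in F. stereo (x n) - stereo (y n) \<noteq> 0" by (rule tendsto_imp_eventually_ne)
  then show ?thesis by eventually_elim auto
qed

lemma sconv_unique:
  assumes "sconv x a F" "sconv x b F" "F \<noteq> bot"
  shows "a = b"
  using tendsto_unique[OF assms(3) assms(1,2)[unfolded sconv_def]] by (simp add: stereo_eq_iff)

lemma chart_None_None: "chart a None = 0" by (simp add: chart_def)

lemma chart_inv_chart: "x \<noteq> (if a = None then Some 0 else None) \<Longrightarrow> chart_inv a (chart a x) = x"
  by (cases x; cases a) (auto simp: chart_def chart_inv_def split: if_splits)

lemma chart_inv_chart_self [simp]: "chart_inv a (chart a a) = a"
  by (rule chart_inv_chart) auto

lemma sconv_chart:
  assumes "sconv x a F"
  shows "((\<lambda>n. chart a (x n)) \<longlongrightarrow> chart a a) F" "\<forall>\<^sub>F n in F. chart_inv a (chart a (x n)) = x n"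
proof -
  show "((\<lambda>n. chart a (x n)) \<longlongrightarrow> chart a a) F"
  proof (cases a)
    case None
    show ?thesis using assms unfolding sconv_def None chart_eq_stereo
      by (intro tendsto_intros) (simp_all add: stereo_def)
  next
    case (Some c)
    have "(cmod c)\<^sup>2 + 1 \<noteq> 0" by (smt (verit) zero_le_power2)
    then have "1 - snd (stereo (Some c)) \<noteq> 0" by (simp add: stereo_def)
    then have "complex_of_real (1 - snd (stereo (Some c))) \<noteq> 0" by (simp only: of_real_eq_0_iff) simp
    then show ?thesis using assms unfolding sconv_def Some chart_eq_stereo
      by (intro tendsto_intros)
  qed
  have "\<forall>\<^sub>F n in F. x n \<noteq> (if a = None then Some 0 else None)"
    by (rule sconv_eventually_neq[OF assms sconv_const]) auto
  then show "\<forall>\<^sub>F n in F. chart_inv a (chart a (x n)) = x n"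
    by eventually_elim (rule chart_inv_chart)
qed

lemma chart_inv_proj: "chart_inv a u = (if a = None then proj 1 u else proj u 1)"
  by (auto simp: chart_inv_def proj_1)

lemma sconv_chart_inv: "(u \<longlongrightarrow> u0) F \<Longrightarrow> sconv (\<lambda>n. chart_inv a (u n)) (chart_inv a u0) F"
  using sconv_proj[of "\<lambda>_. 1" 1 F u u0] sconv_proj[of u u0 F "\<lambda>_. 1" 1]
  by (cases a) (simp_all add: chart_inv_proj)

lemma sconv_SomeD:
  assumes "sconv x (Some a) F"
  shows "\<forall>\<^sub>F n in F. x n = Some (the (x n))" "((\<lambda>n. the (x n)) \<longlongrightarrow> a) F"
proof -
  show e: "\<forall>\<^sub>F n in F. x n = Some (the (x n))"
    using sconv_eventually_neq[OF assms sconv_const, of None] by (auto elim: eventually_mono)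
  have "((\<lambda>n. chart (Some a) (x n)) \<longlongrightarrow> a) F"
    using sconv_chart(1)[OF assms] by (simp add: chart_def)
  then show "((\<lambda>n. the (x n)) \<longlongrightarrow> a) F"
  proof (rule Lim_transform_eventually)
    show "\<forall>\<^sub>F n in F. chart (Some a) (x n) = the (x n)"
      using e by eventually_elim (auto simp: chart_def split: option.splits)
  qed
qed

lemma finite_family_subseq:
  fixes c :: "nat \<Rightarrow> 'i \<Rightarrow> 'a::heine_borel"
  assumes "finite I" "\<And>i. i \<in> I \<Longrightarrow> bounded (range (\<lambda>n. c n i))"
  shows "\<exists>r l. strict_mono (r :: nat \<Rightarrow> nat) \<and> (\<forall>i\<in>I. (\<lambda>n. c (r n) i) \<longlonglongrightarrow> l i)"
  using assms
proof (induction I rule: finite_induct)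
  case empty
  show ?case by (intro exI[of _ id]) (auto simp: strict_mono_def)
next
  case (insert j I)
  then obtain r l where r: "strict_mono (r :: nat \<Rightarrow> nat)" "\<forall>i\<in>I. (\<lambda>n. c (r n) i) \<longlonglongrightarrow> l i" by auto
  have "bounded (range (\<lambda>n. c (r n) j))"
    using insert.prems[of j] by (auto intro: bounded_subset)
  from bounded_imp_convergent_subsequence[OF this] obtain m s
    where s: "strict_mono (s :: nat \<Rightarrow> nat)" "((\<lambda>n. c (r n) j) \<circ> s) \<longlonglongrightarrow> m" by auto
  show ?case
  proof (intro exI conjI ballI)
    show "strict_mono (r \<circ> s)" using r(1) s(1) by (rule strict_mono_o)
    fix i assume i: "i \<in> insert j I"
    show "(\<lambda>n. c ((r \<circ> s) n) i) \<longlonglongrightarrow> (if i = j then m else l i)"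
    proof (cases "i = j")
      case True then show ?thesis using s(2) by (simp add: o_def)
    next
      case False
      with i r(2) have "(\<lambda>n. c (r n) i) \<longlonglongrightarrow> l i" by auto
      from LIMSEQ_subseq_LIMSEQ[OF this s(1)] False show ?thesis by (simp add: o_def)
    qed
  qed
qed

text \<open>Compactness of the sphere: every point is \<open>[u : v]\<close> with \<open>(u, v)\<close> in the closed unit bidisc and one of the two
coordinates equal to \<open>1\<close>, a condition that survives in the limit.\<close>

lemma sphere_family_subseq:
  fixes x :: "nat \<Rightarrow> 'i \<Rightarrow> sphere"
  assumes "finite I"
  shows "\<exists>r a. strict_mono (r :: nat \<Rightarrow> nat) \<and> (\<forall>i\<in>I. sconv (\<lambda>n. x (r n) i) (a i) sequentially)"
proof -
  have "\<exists>u v. x n i = proj u v \<and> (u \<noteq> 0 \<or> v \<noteq> 0) \<and> (cmod u \<le> 1 \<and> cmod v \<le> 1) \<and> (u = 1 \<or> v = 1)" for n i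
  proof (cases "x n i")
    case None then show ?thesis by (intro exI[of _ 1] exI[of _ 0]) (simp add: proj_def)
  next
    case (Some z)
    show ?thesis
    proof (cases "cmod z \<le> 1")
      case True then show ?thesis using Some by (intro exI[of _ z] exI[of _ 1]) (simp add: proj_def)
    next
      case False
      then have "z \<noteq> 0" "cmod (inverse z) \<le> 1" by (auto simp: norm_inverse inverse_le_1_iff)
      then show ?thesis using Some by (intro exI[of _ 1] exI[of _ "inverse z"]) (auto simp: proj_def inverse_eq_divide)
    qed
  qed
  then obtain u v where uv: "\<And>n i. x n i = proj (u n i) (v n i)" "\<And>n i. cmod (u n i) \<le> 1"
    "\<And>n i. cmod (v n i) \<le> 1" "\<And>n i. u n i = 1 \<or> v n i = 1" by metis
  have "\<exists>r l. strict_mono (r :: nat \<Rightarrow> nat) \<and> (\<forall>i\<in>I. (\<lambda>n. (u (r n) i, v (r n) i)) \<longlonglongrightarrow> l i)"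
  proof (rule finite_family_subseq[OF assms])
    fix i
    have "norm (u n i, v n i) \<le> 2" for n
      using norm_Pair_le[of "u n i" "v n i"] uv(2,3)[of n i] by linarith
    then show "bounded (range (\<lambda>n. (u n i, v n i)))" by (auto simp: bounded_iff intro!: exI[of _ 2])
  qed
  then obtain r l where r: "strict_mono (r :: nat \<Rightarrow> nat)"
    and l: "\<And>i. i \<in> I \<Longrightarrow> (\<lambda>n. (u (r n) i, v (r n) i)) \<longlonglongrightarrow> l i" by blast
  have "sconv (\<lambda>n. x (r n) i) (proj (fst (l i)) (snd (l i))) sequentially" if i: "i \<in> I" for i
    unfolding uv(1)
  proof (rule sconv_proj)
    show 1: "(\<lambda>n. u (r n) i) \<longlonglongrightarrow> fst (l i)" using tendsto_fst[OF l[OF i]] by simp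
    show 2: "(\<lambda>n. v (r n) i) \<longlonglongrightarrow> snd (l i)" using tendsto_snd[OF l[OF i]] by simp
    \<comment> \<open>The disjunction \<open>u = 1 \<or> v = 1\<close> as an equation, which passes to the limit.\<close>
    have "(\<lambda>n. (u (r n) i - 1) * (v (r n) i - 1)) \<longlonglongrightarrow> (fst (l i) - 1) * (snd (l i) - 1)"
      by (intro tendsto_intros 1 2)
    moreover have "(\<lambda>n. (u (r n) i - 1) * (v (r n) i - 1)) = (\<lambda>_. 0)" using uv(4) by auto
    ultimately have "(fst (l i) - 1) * (snd (l i) - 1) = 0" by (metis LIMSEQ_unique tendsto_const)
    then show "fst (l i) \<noteq> 0 \<or> snd (l i) \<noteq> 0" by auto
  qed
  then show ?thesis using r by (intro exI conjI) auto
qed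

lemma sconv_compose:
  assumes "sconv x a F" "filterlim r F G"
  shows "sconv (\<lambda>n. x (r n)) a G"
  using assms unfolding sconv_def by (rule filterlim_compose)

lemma sconv_cong:
  assumes "sconv x a F" "\<forall>\<^sub>F n in F. x n = y n"
  shows "sconv y a F"
  using assms unfolding sconv_def by (auto elim!: Lim_transform_eventually elim: eventually_mono)

text \<open>The neighbourhood filter pulled back from the stereographic model; \<open>sconv\<close> is then an instance of \<open>filterlim\<close>.\<close>

definition sphere_nhds :: "sphere \<Rightarrow> sphere filter" where
  "sphere_nhds a = filtercomap stereo (nhds (stereo a))"

lemma sconv_iff_filterlim: "sconv x a F \<longleftrightarrow> filterlim x (sphere_nhds a) F"
  unfolding sconv_def sphere_nhds_def by (simp add: filterlim_filtercomap_iff o_def)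

text \<open>Continuous convergence: \<open>F n y \<rightarrow> f a\<close> as \<open>n \<rightarrow> \<infinity>\<close> and \<open>y \<rightarrow> a\<close> jointly. On the compact sphere this is uniform
convergence to a continuous limit, but in this form it is stable under composition by a plain substitution of
limits.\<close>

definition cconv :: "(nat \<Rightarrow> sphere \<Rightarrow> sphere) \<Rightarrow> (sphere \<Rightarrow> sphere) \<Rightarrow> bool" where
  "cconv F f \<longleftrightarrow> (\<forall>a. sconv (\<lambda>(n, y). F n y) (f a) (sequentially \<times>\<^sub>F sphere_nhds a))"

lemma cconvD:
  assumes "cconv F f" "filterlim m sequentially G" "sconv x a G"
  shows "sconv (\<lambda>k. F (m k) (x k)) (f a) G"
proof -
  have "filterlim (\<lambda>k. (m k, x k)) (sequentially \<times>\<^sub>F sphere_nhds a) G"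
    using assms(2,3) by (intro filterlim_Pair) (simp_all add: sconv_iff_filterlim)
  from filterlim_compose[OF _ this, of "\<lambda>(n, y). F n y" "sphere_nhds (f a)"]
  show ?thesis using assms(1) by (simp add: cconv_def sconv_iff_filterlim)
qed

lemma cconv_seq: "cconv F f \<Longrightarrow> sconv x a sequentially \<Longrightarrow> sconv (\<lambda>n. F n (x n)) (f a) sequentially"
  by (rule cconvD[OF _ filterlim_ident])

lemma cconv_subseq:
  assumes "cconv F f" "strict_mono r"
  shows "cconv (\<lambda>n. F (r n)) f"
  unfolding cconv_def
proof
  fix a
  have "filterlim (\<lambda>k. r (fst k)) sequentially (sequentially \<times>\<^sub>F sphere_nhds a)"
    by (rule filterlim_compose[OF filterlim_subseq[OF assms(2)] filterlim_fst])
  moreover have "sconv snd a (sequentially \<times>\<^sub>F sphere_nhds a)"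
    unfolding sconv_iff_filterlim by (rule filterlim_snd)
  ultimately have "sconv (\<lambda>k. F (r (fst k)) (snd k)) (f a) (sequentially \<times>\<^sub>F sphere_nhds a)"
    by (rule cconvD[OF assms(1)])
  then show "sconv (\<lambda>(n, y). F (r n) y) (f a) (sequentially \<times>\<^sub>F sphere_nhds a)"
    by (simp add: case_prod_unfold)
qed

lemma cconv_comp:
  assumes "cconv F f" "cconv G g"
  shows "cconv (\<lambda>n. F n \<circ> G n) (f \<circ> g)"
  unfolding cconv_def
proof
  fix a
  have "sconv (\<lambda>k. G (fst k) (snd k)) (g a) (sequentially \<times>\<^sub>F sphere_nhds a)"
    using assms(2) by (simp add: cconv_def case_prod_unfold)
  from cconvD[OF assms(1) filterlim_fst this]
  show "sconv (\<lambda>(n, y). (F n \<circ> G n) y) ((f \<circ> g) a) (sequentially \<times>\<^sub>F sphere_nhds a)"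
    by (simp add: case_prod_unfold)
qed

definition sphere_cont :: "(sphere \<Rightarrow> sphere) \<Rightarrow> bool" where
  "sphere_cont f \<longleftrightarrow> (\<forall>a. sconv f (f a) (sphere_nhds a))"

lemma sphere_contD:
  assumes "sphere_cont f" "sconv x a G"
  shows "sconv (\<lambda>k. f (x k)) (f a) G"
  by (rule sconv_compose[OF spec[OF assms(1)[unfolded sphere_cont_def]] assms(2)[unfolded sconv_iff_filterlim]])

lemma cconv_const: "sphere_cont f \<Longrightarrow> cconv (\<lambda>_. f) f"
  unfolding cconv_def case_prod_unfold
  by (intro allI sphere_contD[of f]) (simp_all add: sconv_iff_filterlim filterlim_snd)

text \<open>The link with the uniform closeness in the definition of rigidity.\<close>

lemma cconv_of_chordal:
  assumes "sphere_cont f" "\<And>n x. chordal_dist (f x) (F n x) < 1 / real (Suc n)"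
  shows "cconv F f"
  unfolding cconv_def
proof
  fix a
  let ?G = "sequentially \<times>\<^sub>F sphere_nhds a"
  have 1: "sconv (\<lambda>k. f (snd k)) (f a) ?G"
    by (rule sphere_contD[OF assms(1)]) (simp add: sconv_iff_filterlim filterlim_snd)
  have 2: "((\<lambda>k. stereo (F (fst k) (snd k)) - stereo (f (snd k))) \<longlongrightarrow> 0) ?G"
  proof (rule Lim_null_comparison)
    have "(\<lambda>n. 1 / real (Suc n)) \<longlonglongrightarrow> 0" by (rule LIMSEQ_Suc) (rule lim_1_over_n)
    then show "((\<lambda>k. 1 / real (Suc (fst k))) \<longlongrightarrow> 0) ?G"
      by (rule filterlim_compose) (rule filterlim_fst)
    show "\<forall>\<^sub>F k in ?G. norm (stereo (F (fst k) (snd k)) - stereo (f (snd k))) \<le> 1 / real (Suc (fst k))"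
      using assms(2) by (intro always_eventually allI)
        (simp add: chordal_dist_eq_dist_stereo dist_norm norm_minus_commute less_imp_le)
  qed
  from tendsto_add[OF 1[unfolded sconv_def] 2]
  show "sconv (\<lambda>(n, y). F n y) (f a) ?G" by (simp add: sconv_def case_prod_unfold)
qed

section \<open>Rational maps in homogeneous coordinates\<close>

text \<open>The value at \<open>(u, v)\<close> of the homogenisation of \<open>p\<close> to degree \<open>d\<close>.\<close>

definition hom :: "nat \<Rightarrow> complex poly \<Rightarrow> complex \<Rightarrow> complex \<Rightarrow> complex" where
  "hom d p u v = (\<Sum>i\<le>d. coeff p i * u ^ i * v ^ (d - i))"

lemma hom_eq_poly:
  assumes "degree p \<le> d" "v \<noteq> 0"
  shows "hom d p u v = v ^ d * poly p (u / v)"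
proof -
  have "poly p (u / v) = (\<Sum>i\<le>d. coeff p i * (u / v) ^ i)"
    unfolding poly_altdef using assms(1)
    by (intro sum.mono_neutral_left) (auto simp: coeff_eq_0)
  then show ?thesis unfolding hom_def sum_distrib_left
    using assms(2) by (simp add: sum_distrib_left) (intro sum.cong refl, simp add: power_divide power_diff field_simps)
qed

lemma hom_at_infinity: "hom d p u 0 = coeff p d * u ^ d"
proof -
  have "hom d p u 0 = (\<Sum>i\<in>{d}. coeff p i * u ^ i * 0 ^ (d - i))"
    unfolding hom_def by (intro sum.mono_neutral_right) (auto simp: power_0_left)
  then show ?thesis by simp
qed

lemma hom_sum: "hom d (\<Sum>i\<in>A. f i) u v = (\<Sum>i\<in>A. hom d (f i) u v)"
  unfolding hom_def coeff_sum sum_distrib_right by (rule sum.swap)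

lemma hom_smult: "hom d (smult c p) u v = c * hom d p u v"
  unfolding hom_def by (simp add: sum_distrib_left mult.assoc)

lemma hom_mult:
  assumes "degree p \<le> m" "degree q \<le> n"
  shows "hom (m + n) (p * q) u v = hom m p u v * hom n q u v"
proof (cases "v = 0")
  case False
  have "degree (p * q) \<le> m + n" using degree_mult_le[of p q] assms by linarith
  with False assms show ?thesis by (simp add: hom_eq_poly power_add)
next
  case True
  have "coeff (p * q) (m + n) = (\<Sum>i\<in>{m}. coeff p i * coeff q (m + n - i))"
    unfolding coeff_mult
  proof (intro sum.mono_neutral_right ballI)
    fix i assume i: "i \<in> {..m + n} - {m}"
    show "coeff p i * coeff q (m + n - i) = 0"
    proof (cases "i > m")
      case True then show ?thesis using assms(1) by (simp add: coeff_eq_0)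
    next
      case False
      then have "m + n - i > degree q" using i assms(2) by auto
      then show ?thesis by (simp add: coeff_eq_0)
    qed
  qed auto
  then show ?thesis using True by (simp add: hom_at_infinity power_add)
qed

lemma hom_0_1: "hom 0 1 u v = 1" by (simp add: hom_def)

lemma hom_power: "degree p \<le> m \<Longrightarrow> hom (k * m) (p ^ k) u v = hom m p u v ^ k"
proof (induction k)
  case (Suc k)
  have "degree (p ^ k) \<le> k * m"
    using degree_power_le[of p k] Suc.prems by (metis le_trans mult.commute mult_le_mono1)
  from hom_mult[OF Suc.prems this, of u v] Suc show ?case by simp
qed (simp add: hom_0_1)

text \<open>The pair defines a rational map of degree exactly \<open>d\<close>. The condition on common zeros of the homogenisations
includes the one at \<open>[1 : 0]\<close>; see \<open>nondeg_iff\<close> for the form by coprimality.\<close>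

definition nondeg :: "nat \<Rightarrow> complex poly \<Rightarrow> complex poly \<Rightarrow> bool" where
  "nondeg d p q \<longleftrightarrow> degree p \<le> d \<and> degree q \<le> d
     \<and> (\<forall>u v. hom d p u v = 0 \<and> hom d q u v = 0 \<longrightarrow> u = 0 \<and> v = 0)"

lemma nondeg_degree: "nondeg d p q \<Longrightarrow> degree p \<le> d" "nondeg d p q \<Longrightarrow> degree q \<le> d"
  by (simp_all only: nondeg_def)

lemma nondegD: "nondeg d p q \<Longrightarrow> hom d p u v = 0 \<Longrightarrow> hom d q u v = 0 \<Longrightarrow> u = 0 \<and> v = 0"
  unfolding nondeg_def by blast

lemma nondegI:
  assumes "degree p \<le> d" "degree q \<le> d"
    and "\<And>u v. hom d p u v = 0 \<Longrightarrow> hom d q u v = 0 \<Longrightarrow> u = 0 \<and> v = 0"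
  shows "nondeg d p q"
  unfolding nondeg_def using assms by blast

lemma nondeg_hom: "nondeg d p q \<Longrightarrow> u \<noteq> 0 \<or> v \<noteq> 0 \<Longrightarrow> hom d p u v \<noteq> 0 \<or> hom d q u v \<noteq> 0"
  using nondegD by blast

lemma complex_coprimeI:
  assumes "\<And>z :: complex. poly p z = 0 \<Longrightarrow> poly q z = 0 \<Longrightarrow> False"
  shows "coprime p q"
proof (rule coprimeI)
  fix c assume c: "c dvd p" "c dvd q"
  have no_root: "poly c z \<noteq> 0" for z
    using assms[of z] c by (auto simp: dvd_def)
  have "degree c = 0"
  proof (rule ccontr)
    assume "degree c \<noteq> 0"
    then have "\<not> constant (poly c)" by (simp add: constant_degree)
    then show False using fundamental_theorem_of_algebra no_root by blast
  qed
  moreover have "c \<noteq> 0" using no_root[of 0] by auto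
  ultimately show "is_unit c" by (simp add: is_unit_iff_degree)
qed

lemma coprime_no_common_root: 
  fixes p q :: "complex poly"
  assumes "coprime p q" "poly p z = 0" shows "poly q z \<noteq> 0"
proof
  assume "poly q z = 0"
  with assms(2) have "[:- z, 1:] dvd p" "[:- z, 1:] dvd q" by (auto simp: poly_eq_0_iff_dvd)
  with assms(1) have "is_unit [:- z, 1:]" by (rule coprime_common_divisor)
  then show False by (simp add: is_unit_iff_degree)
qed

lemma nondeg_iff: "nondeg d p q \<longleftrightarrow> coprime p q \<and> max (degree p) (degree q) = d"
proof
  assume n: "nondeg d p q"
  note deg = nondeg_degree[OF n]
  have "coprime p q"
  proof (rule complex_coprimeI)
    fix z assume "poly p z = 0" "poly q z = 0"
    then have "hom d p z 1 = 0" "hom d q z 1 = 0" using deg by (auto simp: hom_eq_poly)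
    then show False using nondegD[OF n, of z 1] by simp
  qed
  moreover have "coeff p d \<noteq> 0 \<or> coeff q d \<noteq> 0"
    using nondeg_hom[OF n, of 1 0] by (simp add: hom_at_infinity)
  then have "d \<le> max (degree p) (degree q)" by (auto simp: max_def dest: le_degree)
  then have "max (degree p) (degree q) = d" using deg by (intro antisym) auto
  ultimately show "coprime p q \<and> max (degree p) (degree q) = d" ..
next
  assume a: "coprime p q \<and> max (degree p) (degree q) = d"
  then have deg: "degree p \<le> d" "degree q \<le> d" by auto
  show "nondeg d p q"
  proof (rule nondegI[OF deg])
    fix u v assume h: "hom d p u v = 0" "hom d q u v = 0"
    have v: "v = 0"
    proof (rule ccontr)
      assume "v \<noteq> 0"
      with h deg have "poly p (u / v) = 0" "poly q (u / v) = 0" by (auto simp: hom_eq_poly)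
      with a coprime_no_common_root show False by blast
    qed
    moreover have "u = 0"
    proof (rule ccontr)
      assume u: "u \<noteq> 0"
      have c: "coeff p d = 0" "coeff q d = 0" using h u v by (auto simp: hom_at_infinity)
      have "d = degree p \<or> d = degree q" using a by (auto simp: max_def)
      then have "d = 0" using c by (metis degree_0 leading_coeff_0_iff)
      then have "p = 0" "q = 0" using c deg by (metis le_zero_eq leading_coeff_0_iff)+
      with a show False by simp
    qed
    ultimately show "u = 0 \<and> v = 0" by simp
  qed
qed

lemma rat_map_proj:
  assumes n: "nondeg d p q" and uv: "u \<noteq> 0 \<or> v \<noteq> 0"
  shows "rat_map p q (proj u v) = proj (hom d p u v) (hom d q u v)"
proof -
  have d: "max (degree p) (degree q) = d" using n by (simp add: nondeg_iff)
  then have deg: "degree p \<le> d" "degree q \<le> d" by auto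
  show ?thesis
  proof (cases "v = 0")
    case True
    then have u: "u \<noteq> 0" using uv by simp
    show ?thesis
      unfolding True hom_at_infinity
      using u by (simp add: proj_def rat_map_def Let_def d)
  next
    case False
    show ?thesis
      unfolding hom_eq_poly[OF deg(1) False] hom_eq_poly[OF deg(2) False]
      using proj_scale[of "v ^ d" "poly p (u / v)" "poly q (u / v)"] False
      by (simp add: proj_def rat_map_def)
  qed
qed

lemma proj_surj: obtains u v where "x = proj u v" "u \<noteq> 0 \<or> v \<noteq> 0"
proof (cases x)
  case None then show ?thesis using that[of 1 0] by (simp add: proj_def)
next
  case (Some z) then show ?thesis using that[of z 1] by (simp add: proj_def)
qed

text \<open>The numerator of \<open>(p / q) \<circ> (r / s)\<close> after clearing the denominator \<open>s ^ d\<close>.\<close>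

definition hom_subst :: "nat \<Rightarrow> complex poly \<Rightarrow> complex poly \<Rightarrow> complex poly \<Rightarrow> complex poly" where
  "hom_subst d p r s = (\<Sum>i\<le>d. smult (coeff p i) (r ^ i * s ^ (d - i)))"

lemma hom_subst_degree_hom:
  assumes "degree r \<le> e" "degree s \<le> e"
  shows "degree (hom_subst d p r s) \<le> d * e"
    and "hom (d * e) (hom_subst d p r s) u v = hom d p (hom e r u v) (hom e s u v)"
proof -
  have dp: "degree (r ^ k) \<le> k * e" "degree (s ^ k) \<le> k * e" for k
    using degree_power_le[of r k] degree_power_le[of s k] assms
    by (metis le_trans mult.commute mult_le_mono1)+
  show "degree (hom_subst d p r s) \<le> d * e"
    unfolding hom_subst_def
  proof (rule degree_sum_le)
    fix i assume i: "i \<in> {..d}"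
    have "degree (r ^ i * s ^ (d - i)) \<le> i * e + (d - i) * e"
      using degree_mult_le dp by (meson add_mono le_trans)
    also have "\<dots> = d * e" using i by (simp flip: distrib_right)
    finally show "degree (smult (coeff p i) (r ^ i * s ^ (d - i))) \<le> d * e"
      using degree_smult_le le_trans by blast
  qed simp
  have "hom (d * e) (hom_subst d p r s) u v = (\<Sum>i\<le>d. coeff p i * hom (d * e) (r ^ i * s ^ (d - i)) u v)"
    by (simp add: hom_subst_def hom_sum hom_smult)
  also have "\<dots> = (\<Sum>i\<le>d. coeff p i * hom e r u v ^ i * hom e s u v ^ (d - i))"
  proof (rule sum.cong[OF refl])
    fix i assume i: "i \<in> {..d}"
    have e: "i * e + (d - i) * e = d * e" using i by (simp flip: distrib_right)
    have "hom (d * e) (r ^ i * s ^ (d - i)) u v = hom e r u v ^ i * hom e s u v ^ (d - i)"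
      using hom_mult[OF dp(1)[of i] dp(2)[of "d - i"], of u v] assms unfolding e by (simp add: hom_power)
    then show "coeff p i * hom (d * e) (r ^ i * s ^ (d - i)) u v = coeff p i * hom e r u v ^ i * hom e s u v ^ (d - i)"
      by simp
  qed
  finally show "hom (d * e) (hom_subst d p r s) u v = hom d p (hom e r u v) (hom e s u v)"
    by (simp add: hom_def)
qed

definition rat_deg :: "nat \<Rightarrow> (sphere \<Rightarrow> sphere) \<Rightarrow> bool" where
  "rat_deg d f \<longleftrightarrow> (\<exists>p q. nondeg d p q \<and> f = rat_map p q)"

text \<open>In homogeneous coordinates composition is substitution, and nondegeneracy of the two pairs passes to the composite,
whence degrees multiply.\<close>

lemma rat_deg_comp:
  assumes "rat_deg d f" "rat_deg e g"
  shows "rat_deg (d * e) (f \<circ> g)"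
proof -
  obtain p q r s where pq: "nondeg d p q" "f = rat_map p q" and rs: "nondeg e r s" "g = rat_map r s"
    using assms by (auto simp: rat_deg_def)
  note deg = nondeg_degree[OF rs(1)]
  note h = hom_subst_degree_hom[OF deg]
  have n: "nondeg (d * e) (hom_subst d p r s) (hom_subst d q r s)"
    by (rule nondegI) (use h nondegD[OF pq(1)] nondegD[OF rs(1)] in \<open>metis+\<close>)
  have "(f \<circ> g) x = rat_map (hom_subst d p r s) (hom_subst d q r s) x" for x
  proof -
    obtain u v where x: "x = proj u v" "u \<noteq> 0 \<or> v \<noteq> 0" by (rule proj_surj)
    show ?thesis
      using x(2) rat_map_proj[OF rs(1) x(2)] rat_map_proj[OF n x(2)] rat_map_proj[OF pq(1) nondeg_hom[OF rs(1) x(2)]]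
      by (simp add: x(1) pq rs h)
  qed
  then have "f \<circ> g = rat_map (hom_subst d p r s) (hom_subst d q r s)" by (rule ext)
  then show ?thesis using n unfolding rat_deg_def by blast
qed

lemma rational_map_iff: "rational_map f \<longleftrightarrow> (\<exists>d\<ge>2. rat_deg d f)"
  unfolding rational_map_def rat_deg_def nondeg_iff by blast

lemma hom_1_linear: "hom 1 [:b, a:] u v = a * u + b * v"
  by (simp add: hom_def)

lemma nondeg_linear: "nondeg 1 [:b, a:] [:d, c:] \<longleftrightarrow> a * d - b * c \<noteq> 0"
proof
  assume n: "nondeg 1 [:b, a:] [:d, c:]"
  show "a * d - b * c \<noteq> 0"
  proof
    assume z: "a * d - b * c = 0"
    have e: "a * d = b * c" using z by simp
    have "hom 1 [:b, a:] d (- c) = 0" "hom 1 [:d, c:] d (- c) = 0"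
      "hom 1 [:b, a:] b (- a) = 0" "hom 1 [:d, c:] b (- a) = 0"
      unfolding hom_1_linear by (simp_all add: e mult.commute)
    from nondegD[OF n this(1,2)] nondegD[OF n this(3,4)]
    have "hom 1 [:b, a:] 1 0 = 0" "hom 1 [:d, c:] 1 0 = 0" unfolding hom_1_linear by simp_all
    from nondegD[OF n this] show False by simp
  qed
next
  assume z: "a * d - b * c \<noteq> 0"
  have *: "u = 0 \<and> v = 0" if "a * u + b * v = 0" "c * u + d * v = 0" for u v
  proof -
    have "(a * d - b * c) * u = d * (a * u + b * v) - b * (c * u + d * v)"
      "(a * d - b * c) * v = a * (c * u + d * v) - c * (a * u + b * v)" by (simp_all add: algebra_simps)
    then show ?thesis using that z by auto
  qed
  show "nondeg 1 [:b, a:] [:d, c:]"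
  proof (rule nondegI)
    fix u v assume "hom 1 [:b, a:] u v = 0" "hom 1 [:d, c:] u v = 0"
    then show "u = 0 \<and> v = 0" unfolding hom_1_linear by (rule *)
  qed (simp_all add: degree_pCons_eq_if)
qed

lemma degree_le_1_cases:
  assumes "degree (p :: complex poly) \<le> 1"
  shows "p = [:coeff p 0, coeff p 1:]"
proof (rule poly_eqI)
  fix n :: nat
  consider "n = 0" | "n = 1" | "n > 1" by linarith
  then show "coeff p n = coeff [:coeff p 0, coeff p 1:] n"
  proof cases
    case 3
    then have "degree p < n" using assms by linarith
    then have "coeff p n = 0" by (rule coeff_eq_0)
    moreover have "coeff [:coeff p 0, coeff p 1:] n = 0"
      using 3 by (intro coeff_eq_0) (simp add: degree_pCons_eq_if)
    ultimately show ?thesis by simp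
  qed simp_all
qed

lemma nondeg_1_linear:
  assumes "nondeg 1 p q"
  obtains a b c d where "p = [:b, a:]" "q = [:d, c:]" "a * d - b * c \<noteq> 0"
proof -
  define a b c d where abcd: "a = coeff p 1" "b = coeff p 0" "c = coeff q 1" "d = coeff q 0"
  have p: "p = [:b, a:]" and q: "q = [:d, c:]"
    unfolding abcd
    by (rule degree_le_1_cases[OF nondeg_degree(1)[OF assms]], rule degree_le_1_cases[OF nondeg_degree(2)[OF assms]])
  have "nondeg 1 [:b, a:] [:d, c:]" using assms unfolding p q .
  then have "a * d - b * c \<noteq> 0" unfolding nondeg_linear .
  with p q show ?thesis by (rule that)
qed

lemma mobius_iff: "mobius f \<longleftrightarrow> rat_deg 1 f"
proof
  assume "mobius f"
  then obtain a b c d where n: "a * d - b * c \<noteq> 0" and f: "f = rat_map [:b, a:] [:d, c:]"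
    unfolding mobius_def by (elim exE conjE)
  from n have "nondeg 1 [:b, a:] [:d, c:]" unfolding nondeg_linear .
  with f show "rat_deg 1 f" unfolding rat_deg_def by (intro exI conjI)
next
  assume "rat_deg 1 f"
  then obtain p q where n: "nondeg 1 p q" and f: "f = rat_map p q" unfolding rat_deg_def by (elim exE conjE)
  obtain a b c d where "p = [:b, a:]" "q = [:d, c:]" and n: "a * d - b * c \<noteq> 0"
    using nondeg_1_linear[OF n] .
  with f have "f = rat_map [:b, a:] [:d, c:]" by (simp only:)
  with n show "mobius f" unfolding mobius_def by (intro exI conjI)
qed

definition lin :: "complex \<Rightarrow> complex \<Rightarrow> complex \<Rightarrow> complex \<Rightarrow> sphere \<Rightarrow> sphere" where
  "lin a b c d = rat_map [:b, a:] [:d, c:]"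

lemma lin_proj:
  assumes "a * d - b * c \<noteq> 0" "u \<noteq> 0 \<or> v \<noteq> 0"
  shows "lin a b c d (proj u v) = proj (a * u + b * v) (c * u + d * v)"
    "a * u + b * v \<noteq> 0 \<or> c * u + d * v \<noteq> 0"
proof -
  have n: "nondeg 1 [:b, a:] [:d, c:]" using assms(1) unfolding nondeg_linear .
  show "lin a b c d (proj u v) = proj (a * u + b * v) (c * u + d * v)"
    using rat_map_proj[OF n assms(2)] unfolding lin_def hom_1_linear .
  show "a * u + b * v \<noteq> 0 \<or> c * u + d * v \<noteq> 0"
    using nondeg_hom[OF n assms(2)] unfolding hom_1_linear .
qed

lemma mobius_lin: "mobius f \<longleftrightarrow> (\<exists>a b c d. a * d - b * c \<noteq> 0 \<and> f = lin a b c d)"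
  unfolding mobius_def lin_def by (rule refl)

lemma lin_inverse:
  assumes "a * d - b * c \<noteq> 0"
  shows "lin d (- b) (- c) a \<circ> lin a b c d = id" "lin a b c d \<circ> lin d (- b) (- c) a = id"
proof -
  have ad: "d * a - (- b) * (- c) \<noteq> 0" using assms by (simp add: mult.commute)
  have *: "lin d (- b) (- c) a (lin a b c d x) = x" "lin a b c d (lin d (- b) (- c) a x) = x" for x
  proof -
    obtain u v where x: "x = proj u v" "u \<noteq> 0 \<or> v \<noteq> 0" by (rule proj_surj)
    have e: "d * (a * u + b * v) + - b * (c * u + d * v) = (a * d - b * c) * u"
      "- c * (a * u + b * v) + a * (c * u + d * v) = (a * d - b * c) * v"
      "a * (d * u + - b * v) + b * (- c * u + a * v) = (a * d - b * c) * u"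
      "c * (d * u + - b * v) + d * (- c * u + a * v) = (a * d - b * c) * v"
      by (simp_all add: algebra_simps)
    show "lin d (- b) (- c) a (lin a b c d x) = x"
      unfolding x(1) lin_proj(1)[OF assms x(2)] lin_proj(1)[OF ad lin_proj(2)[OF assms x(2)]] e
      by (rule proj_scale[OF assms])
    show "lin a b c d (lin d (- b) (- c) a x) = x"
      unfolding x(1) lin_proj(1)[OF ad x(2)] lin_proj(1)[OF assms lin_proj(2)[OF ad x(2)]] e
      by (rule proj_scale[OF assms])
  qed
  show "lin d (- b) (- c) a \<circ> lin a b c d = id" "lin a b c d \<circ> lin d (- b) (- c) a = id"
    by (rule ext, simp add: *)+
qed

lemma mobius_id: "mobius id"
proof -
  have "lin 1 0 0 1 x = x" for x
  proof -
    obtain u v where x: "x = proj u v" "u \<noteq> 0 \<or> v \<noteq> 0" by (rule proj_surj)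
    have "(1::complex) * 1 - 0 * 0 \<noteq> 0" by simp
    from lin_proj(1)[OF this x(2)] show ?thesis unfolding x(1) by simp
  qed
  then have "id = lin 1 0 0 1" by (intro ext) simp
  moreover have "(1::complex) * 1 - 0 * 0 \<noteq> 0" by simp
  ultimately show ?thesis unfolding mobius_lin by (intro exI conjI)
qed

lemma mobius_comp: "mobius f \<Longrightarrow> mobius g \<Longrightarrow> mobius (f \<circ> g)"
  using rat_deg_comp[of 1 f 1 g] by (simp add: mobius_iff)

lemma mobius_inverse:
  assumes "mobius f"
  shows "bij f" "mobius (inv f)" "inv f \<circ> f = id" "f \<circ> inv f = id"
proof -
  obtain a b c d where f: "a * d - b * c \<noteq> 0" "f = lin a b c d" using assms unfolding mobius_lin by (elim exE conjE)
  show b: "bij f" using o_bij[OF lin_inverse[OF f(1)]] unfolding f(2) .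
  show "inv f \<circ> f = id" "f \<circ> inv f = id"
    by (rule inv_o_cancel[OF bij_is_inj[OF b]], rule surj_iff[THEN iffD1, OF bij_is_surj[OF b]])
  have "inv f = lin d (- b) (- c) a"
    unfolding f(2) by (rule inv_unique_comp[OF lin_inverse(2,1)[OF f(1)]])
  moreover have "d * a - (- b) * (- c) \<noteq> 0" using f(1) by (simp add: mult.commute)
  ultimately show "mobius (inv f)" unfolding mobius_lin by (intro exI conjI)
qed

lemma rat_deg_surj:
  assumes "rat_deg d f" "d \<ge> 1"
  obtains x where "f x = y"
proof -
  obtain p q where n: "nondeg d p q" and f: "f = rat_map p q" using assms by (auto simp: rat_deg_def)
  note deg = nondeg_degree[OF n]
  obtain s t where y: "y = proj s t" "s \<noteq> 0 \<or> t \<noteq> 0" by (rule proj_surj)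
  have "\<exists>u v. (u \<noteq> 0 \<or> v \<noteq> 0) \<and> hom d p u v * t = s * hom d q u v"
  proof -
    define R where "R = smult t p - smult s q"
    show ?thesis
    proof (cases "coeff R d = 0")
      case True
      then have "hom d p 1 0 * t = s * hom d q 1 0" by (simp add: R_def hom_at_infinity mult.commute)
      then show ?thesis by (intro exI[of _ 1] exI[of _ 0]) simp
    next
      case False
      then have "degree R \<noteq> 0" using assms(2) le_degree[of R d] by auto
      then have "\<not> constant (poly R)" by (simp add: constant_degree)
      then obtain z where "poly R z = 0" using fundamental_theorem_of_algebra by blast
      then have "hom d p z 1 * t = s * hom d q z 1"
        using deg by (simp add: R_def hom_eq_poly mult.commute)
      then show ?thesis by (intro exI[of _ z] exI[of _ 1]) simp
    qed
  qed
  then obtain u v where uv: "u \<noteq> 0 \<or> v \<noteq> 0" "hom d p u v * t = s * hom d q u v" by blast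
  have "f (proj u v) = y"
    unfolding f rat_map_proj[OF n uv(1)] y(1) using uv(2) by (subst proj_eq_iff[OF nondeg_hom[OF n uv(1)] y(2)])
  then show ?thesis by (rule that)
qed

text \<open>The polynomial \<open>z ^ d p(1 / z)\<close>, the local form of \<open>p\<close> in the chart at \<open>\<infinity>\<close>.\<close>

definition rev_poly :: "nat \<Rightarrow> complex poly \<Rightarrow> complex poly" where
  "rev_poly d p = (\<Sum>i\<le>d. monom (coeff p i) (d - i))"

lemma poly_rev_poly: "poly (rev_poly d p) z = hom d p 1 z"
  by (simp add: rev_poly_def hom_def poly_sum poly_monom)

lemma coeff_rev_poly: "k \<le> d \<Longrightarrow> coeff (rev_poly d p) k = coeff p (d - k)"
proof -
  assume k: "k \<le> d"
  have "coeff (rev_poly d p) k = (\<Sum>i\<le>d. if d - i = k then coeff p i else 0)"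
    by (simp add: rev_poly_def coeff_sum)
  also have "\<dots> = (\<Sum>i\<le>d. if i = d - k then coeff p i else 0)"
    using k by (intro sum.cong refl) auto
  also have "\<dots> = coeff p (d - k)" by simp
  finally show ?thesis .
qed

definition chart_poly :: "sphere \<Rightarrow> nat \<Rightarrow> complex poly \<Rightarrow> complex poly" where
  "chart_poly a d p = (if a = None then rev_poly d p else p)"

lemma rat_map_chart_inv:
  assumes "nondeg d p q"
  shows "rat_map p q (chart_inv a u) = proj (poly (chart_poly a d p) u) (poly (chart_poly a d q) u)"
    "poly (chart_poly a d p) u \<noteq> 0 \<or> poly (chart_poly a d q) u \<noteq> 0"
proof -
  note deg = nondeg_degree[OF assms]
  show "rat_map p q (chart_inv a u) = proj (poly (chart_poly a d p) u) (poly (chart_poly a d q) u)"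
    using deg by (auto simp: chart_inv_proj chart_poly_def poly_rev_poly rat_map_proj[OF assms] hom_eq_poly)
  show "poly (chart_poly a d p) u \<noteq> 0 \<or> poly (chart_poly a d q) u \<noteq> 0"
    using nondeg_hom[OF assms, of 1 u] nondeg_hom[OF assms, of u 1] deg
    by (auto simp: chart_poly_def poly_rev_poly hom_eq_poly)
qed

text \<open>Joint continuity of evaluation in the coefficients and the point. The degree is the same along the filter and
in the limit, so that no zero or pole gets lost.\<close>

lemma sconv_rat_map:
  assumes n: "nondeg d p q" and nF: "\<forall>\<^sub>F b in F. nondeg d (P b) (Q b)"
    and P: "\<And>i. ((\<lambda>b. coeff (P b) i) \<longlongrightarrow> coeff p i) F"
    and Q: "\<And>i. ((\<lambda>b. coeff (Q b) i) \<longlongrightarrow> coeff q i) F"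
    and x: "sconv x a F"
  shows "sconv (\<lambda>b. rat_map (P b) (Q b) (x b)) (rat_map p q a) F"
proof -
  obtain u v where uv: "\<And>z. chart_inv a z = proj (u z) (v z)" "\<And>z. u z \<noteq> 0 \<or> v z \<noteq> 0"
    "(u = (\<lambda>_. 1) \<and> v = (\<lambda>z. z)) \<or> (u = (\<lambda>z. z) \<and> v = (\<lambda>_. 1))"
    using that[of "\<lambda>_. 1" "\<lambda>z. z"] that[of "\<lambda>z. z" "\<lambda>_. 1"] by (cases a) (auto simp: chart_inv_proj)
  define z where "z b = chart a (x b)" for b
  have z: "(z \<longlongrightarrow> chart a a) F" using sconv_chart(1)[OF x] by (simp add: z_def[abs_def])
  have U: "((\<lambda>b. u (z b)) \<longlongrightarrow> u (chart a a)) F" "((\<lambda>b. v (z b)) \<longlongrightarrow> v (chart a a)) F"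
    using uv(3) z by auto
  let ?u = "u (chart a a)" and ?v = "v (chart a a)"
  have "((\<lambda>b. hom d (P b) (u (z b)) (v (z b))) \<longlongrightarrow> hom d p ?u ?v) F"
    "((\<lambda>b. hom d (Q b) (u (z b)) (v (z b))) \<longlongrightarrow> hom d q ?u ?v) F"
    unfolding hom_def by (intro tendsto_intros P Q U)+
  from sconv_proj[OF this nondeg_hom[OF n uv(2)]]
  have "sconv (\<lambda>b. proj (hom d (P b) (u (z b)) (v (z b))) (hom d (Q b) (u (z b)) (v (z b)))) (rat_map p q a) F"
    using rat_map_proj[OF n uv(2), of "chart a a"] uv(1)[of "chart a a"] by simp
  then show ?thesis
  proof (rule sconv_cong)
    show "\<forall>\<^sub>F b in F. proj (hom d (P b) (u (z b)) (v (z b))) (hom d (Q b) (u (z b)) (v (z b))) = rat_map (P b) (Q b) (x b)"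
      using nF sconv_chart(2)[OF x]
      by eventually_elim (metis rat_map_proj uv(1,2) z_def)
  qed
qed

lemma sphere_cont_rat:
  assumes "rat_deg d f"
  shows "sphere_cont f"
proof -
  obtain p q where n: "nondeg d p q" and f: "f = rat_map p q" using assms by (auto simp: rat_deg_def)
  show ?thesis unfolding sphere_cont_def f
    by (intro allI sconv_rat_map[OF n]) (auto simp: n sconv_iff_filterlim filterlim_ident)
qed

lemma cconv_lin:
  assumes "a * d - b * c \<noteq> 0" "A \<longlonglongrightarrow> a" "B \<longlonglongrightarrow> b" "C \<longlonglongrightarrow> c" "D \<longlonglongrightarrow> d"
  shows "cconv (\<lambda>n. lin (A n) (B n) (C n) (D n)) (lin a b c d)"
    "\<forall>\<^sub>F n in sequentially. A n * D n - B n * C n \<noteq> 0"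
proof -
  have "(\<lambda>n. A n * D n - B n * C n) \<longlonglongrightarrow> a * d - b * c" by (intro tendsto_intros assms)
  from tendsto_imp_eventually_ne[OF this assms(1)]
  show ev: "\<forall>\<^sub>F n in sequentially. A n * D n - B n * C n \<noteq> 0" .
  have n: "nondeg 1 [:b, a:] [:d, c:]" using assms(1) unfolding nondeg_linear .
  show "cconv (\<lambda>n. lin (A n) (B n) (C n) (D n)) (lin a b c d)"
    unfolding cconv_def case_prod_unfold lin_def
  proof
    fix x
    let ?F = "sequentially \<times>\<^sub>F sphere_nhds x"
    have f: "filterlim fst sequentially ?F" by (rule filterlim_fst)
    note l = assms(2-)[THEN filterlim_compose, OF f]
    have e: "\<forall>\<^sub>F k in ?F. A (fst k) * D (fst k) - B (fst k) * C (fst k) \<noteq> 0"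
      using f ev by (auto simp: filterlim_iff)
    show "sconv (\<lambda>k. rat_map [:B (fst k), A (fst k):] [:D (fst k), C (fst k):] (snd k)) (rat_map [:b, a:] [:d, c:] x) ?F"
    proof (rule sconv_rat_map[OF n])
      show "\<forall>\<^sub>F k in ?F. nondeg 1 [:B (fst k), A (fst k):] [:D (fst k), C (fst k):]"
        using e unfolding nondeg_linear .
      show "((\<lambda>k. coeff [:B (fst k), A (fst k):] i) \<longlongrightarrow> coeff [:b, a:] i) ?F" for i
        by (cases i; cases "i - 1") (auto simp: coeff_pCons l split: nat.splits)
      show "((\<lambda>k. coeff [:D (fst k), C (fst k):] i) \<longlongrightarrow> coeff [:d, c:] i) ?F" for i
        by (cases i; cases "i - 1") (auto simp: coeff_pCons l split: nat.splits)
      show "sconv snd x ?F" by (simp add: sconv_iff_filterlim filterlim_snd)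
    qed
  qed
qed

section \<open>Critical points in charts\<close>

text \<open>The numerator of the derivative of \<open>p / q\<close>, and up to sign also of that of \<open>q / p\<close>, so that it detects critical points
over finite values and over \<open>\<infinity>\<close> alike.\<close>

definition wronskian :: "complex poly \<Rightarrow> complex poly \<Rightarrow> complex poly" where
  "wronskian p q = pderiv p * q - p * pderiv q"

definition chart_deriv :: "(sphere \<Rightarrow> sphere) \<Rightarrow> sphere \<Rightarrow> complex \<Rightarrow> bool" where
  "chart_deriv f x D \<longleftrightarrow> ((\<lambda>u. chart (f x) (f (chart_inv x u))) has_field_derivative D) (at (chart x x))"

lemma chart_proj: 
  "u \<noteq> 0 \<or> v \<noteq> 0 \<Longrightarrow> chart (Some c) (proj u v) = u / v"
  "u \<noteq> 0 \<or> v \<noteq> 0 \<Longrightarrow> chart None (proj u v) = v / u"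
  by (auto simp: chart_def proj_def)

lemma chart_deriv_rat_map:
  assumes n: "nondeg d p q"
  defines "f \<equiv> rat_map p q"
  shows "\<exists>c. c \<noteq> 0 \<and> chart_deriv f x (c * poly (wronskian (chart_poly x d p) (chart_poly x d q)) (chart x x))"
proof -
  define P Q u where "P = chart_poly x d p" and "Q = chart_poly x d q" and "u = chart x x"
  have fx: "f (chart_inv x z) = proj (poly P z) (poly Q z)" "poly P z \<noteq> 0 \<or> poly Q z \<noteq> 0" for z
    using rat_map_chart_inv[OF n] by (auto simp: P_def Q_def f_def)
  have fx0: "f x = proj (poly P u) (poly Q u)" using fx(1)[of u] by (simp add: u_def)
  show ?thesis
  proof (cases "f x")
    case None
    then have u0: "poly P u \<noteq> 0" using fx(2)[of u] by (auto simp: fx0 proj_def split: if_splits)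
    have "((\<lambda>z. poly Q z / poly P z) has_field_derivative
       (poly (pderiv Q) u * poly P u - poly Q u * poly (pderiv P) u) / (poly P u * poly P u)) (at u)"
      by (rule DERIV_divide[OF poly_DERIV poly_DERIV u0])
    moreover have "(poly (pderiv Q) u * poly P u - poly Q u * poly (pderiv P) u) / (poly P u * poly P u)
      = - 1 / (poly P u)\<^sup>2 * poly (wronskian P Q) u"
      by (simp only: wronskian_def poly_diff poly_mult power2_eq_square divide_inverse) (simp add: algebra_simps)
    ultimately have sd: "chart_deriv f x (- 1 / (poly P u)\<^sup>2 * poly (wronskian P Q) u)"
      unfolding chart_deriv_def None fx(1) u_def[symmetric] chart_proj(2)[OF fx(2)] by simp
    have "- 1 / (poly P u)\<^sup>2 \<noteq> 0" using u0 by simp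
    with sd show ?thesis unfolding P_def Q_def u_def by (intro exI conjI)
  next
    case (Some y)
    then have u0: "poly Q u \<noteq> 0" by (auto simp: fx0 proj_def split: if_splits)
    have "((\<lambda>z. poly P z / poly Q z) has_field_derivative
       (poly (pderiv P) u * poly Q u - poly P u * poly (pderiv Q) u) / (poly Q u * poly Q u)) (at u)"
      by (rule DERIV_divide[OF poly_DERIV poly_DERIV u0])
    moreover have "(poly (pderiv P) u * poly Q u - poly P u * poly (pderiv Q) u) / (poly Q u * poly Q u)
      = 1 / (poly Q u)\<^sup>2 * poly (wronskian P Q) u"
      by (simp only: wronskian_def poly_diff poly_mult power2_eq_square divide_inverse) (simp add: algebra_simps)
    ultimately have sd: "chart_deriv f x (1 / (poly Q u)\<^sup>2 * poly (wronskian P Q) u)"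
      unfolding chart_deriv_def Some fx(1) u_def[symmetric] chart_proj(1)[OF fx(2)] by simp
    have "1 / (poly Q u)\<^sup>2 \<noteq> 0" using u0 by simp
    with sd show ?thesis unfolding P_def Q_def u_def by (intro exI conjI)
  qed
qed

lemma critical_iff_chart_deriv: "x \<in> critical_points f \<longleftrightarrow> chart_deriv f x 0"
  by (simp add: critical_points_def chart_deriv_def)

lemma chart_deriv_unique: "chart_deriv f x D \<Longrightarrow> chart_deriv f x E \<Longrightarrow> D = E"
  unfolding chart_deriv_def by (rule DERIV_unique)

lemma critical_rat_map_iff:
  assumes "nondeg d p q"
  shows "x \<in> critical_points (rat_map p q) \<longleftrightarrow> poly (wronskian (chart_poly x d p) (chart_poly x d q)) (chart x x) = 0"
proof -
  obtain c where c: "c \<noteq> 0" "chart_deriv (rat_map p q) x (c * poly (wronskian (chart_poly x d p) (chart_poly x d q)) (chart x x))"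
    using chart_deriv_rat_map[OF assms] by blast
  show ?thesis unfolding critical_iff_chart_deriv
  proof
    assume "chart_deriv (rat_map p q) x 0"
    from chart_deriv_unique[OF c(2) this] c(1)
    show "poly (wronskian (chart_poly x d p) (chart_poly x d q)) (chart x x) = 0" by simp
  next
    assume "poly (wronskian (chart_poly x d p) (chart_poly x d q)) (chart x x) = 0"
    with c(2) show "chart_deriv (rat_map p q) x 0" by simp
  qed
qed

lemma chart_deriv_comp:
  assumes "sphere_cont g" "chart_deriv g x D" "chart_deriv f (g x) E"
  shows "chart_deriv (f \<circ> g) x (E * D)"
proof -
  let ?G = "\<lambda>u. chart (g x) (g (chart_inv x u))" and ?F = "\<lambda>u. chart (f (g x)) (f (chart_inv (g x) u))"
  have "(?F \<circ> ?G has_field_derivative E * D) (at (chart x x))"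
    by (rule DERIV_chain) (use assms(2,3) in \<open>simp_all add: chart_deriv_def\<close>)
  moreover have "\<forall>\<^sub>F u in nhds (chart x x). (?F \<circ> ?G) u = chart ((f \<circ> g) x) ((f \<circ> g) (chart_inv x u))"
  proof -
    have "sconv (chart_inv x) x (nhds (chart x x))"
      using sconv_chart_inv[of "\<lambda>u. u" "chart x x" "nhds (chart x x)" x] by (simp add: filterlim_ident)
    from sconv_chart(2)[OF sphere_contD[OF assms(1) this]]
    show ?thesis by eventually_elim simp
  qed
  ultimately show ?thesis unfolding chart_deriv_def by (subst (asm) DERIV_cong_ev[OF refl _ refl])
qed

lemma critical_points_comp:
  assumes "rat_deg d f" "rat_deg e g"
  shows "x \<in> critical_points (f \<circ> g) \<longleftrightarrow> x \<in> critical_points g \<or> g x \<in> critical_points f"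
proof -
  have "\<exists>D. chart_deriv h y D" if "rat_deg k h" for h y k
    using that chart_deriv_rat_map unfolding rat_deg_def by metis
  then obtain D E where DE: "chart_deriv g x D" "chart_deriv f (g x) E" using assms by metis
  from chart_deriv_comp[OF sphere_cont_rat[OF assms(2)] this] have "chart_deriv (f \<circ> g) x (E * D)" .
  then have "chart_deriv (f \<circ> g) x 0 \<longleftrightarrow> E * D = 0" using chart_deriv_unique by metis
  moreover have "chart_deriv g x 0 \<longleftrightarrow> D = 0" "chart_deriv f (g x) 0 \<longleftrightarrow> E = 0"
    using DE chart_deriv_unique by metis+
  ultimately show ?thesis unfolding critical_iff_chart_deriv by auto
qed

text \<open>The chain rule. Surjectivity of \<open>g\<close> is what makes every critical value of \<open>f\<close> one of the composite.\<close>

lemma critical_values_comp: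
  assumes "rat_deg d f" "rat_deg e g" "e \<ge> 1"
  shows "critical_values (f \<circ> g) = critical_values f \<union> f ` critical_values g"
proof -
  have surj: "\<exists>x. g x = y" for y using rat_deg_surj[OF assms(2,3)] by metis
  have *: "x \<in> critical_points (f \<circ> g) \<longleftrightarrow> x \<in> critical_points g \<or> g x \<in> critical_points f" for x
    by (rule critical_points_comp[OF assms(1,2)])
  show ?thesis
  proof (rule set_eqI)
    fix y
    have "y \<in> critical_values (f \<circ> g) \<longleftrightarrow> (\<exists>x. y = f (g x) \<and> (x \<in> critical_points g \<or> g x \<in> critical_points f))"
      unfolding critical_values_def image_iff Bex_def * o_apply by blast
    also have "\<dots> \<longleftrightarrow> (\<exists>x. y = f x \<and> x \<in> critical_points f) \<or> (\<exists>x. y = f (g x) \<and> x \<in> critical_points g)"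
      using surj by metis
    finally show "y \<in> critical_values (f \<circ> g) \<longleftrightarrow> y \<in> critical_values f \<union> f ` critical_values g"
      unfolding critical_values_def by blast
  qed
qed

lemma critical_points_mobius:
  assumes "mobius f" shows "critical_points f = {}"
proof -
  obtain p q where n: "nondeg 1 p q" and f: "f = rat_map p q"
    using assms unfolding rat_deg_def mobius_iff by blast
  obtain a b c d where ab: "p = [:b, a:]" "q = [:d, c:]" and z: "a * d - b * c \<noteq> 0"
    using nondeg_1_linear[OF n] .
  note n' = n[unfolded ab]
  have r: "rev_poly 1 [:s, t:] = [:t, s:]" for s t by (simp add: rev_poly_def monom_0 monom_Suc)
  have "x \<notin> critical_points f" for x
  proof (cases x)
    case None
    show ?thesis using z unfolding f ab critical_rat_map_iff[OF n'] None chart_poly_def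
      by (simp add: r[simplified] wronskian_def pderiv_pCons chart_def algebra_simps)
  next
    case (Some y)
    show ?thesis using z unfolding f ab critical_rat_map_iff[OF n'] Some chart_poly_def
      by (simp add: wronskian_def pderiv_pCons chart_def algebra_simps)
  qed
  then show ?thesis by auto
qed

section \<open>Convergence of polynomials\<close>

text \<open>Coefficientwise convergence with bounded degree. The bound cannot be dropped: the degrees of \<open>z ^ n\<close> escape while all
coefficients tend to \<open>0\<close>.\<close>

definition pconv :: "(nat \<Rightarrow> complex poly) \<Rightarrow> complex poly \<Rightarrow> bool" where
  "pconv p P \<longleftrightarrow> (\<exists>D. \<forall>\<^sub>F n in sequentially. degree (p n) \<le> D)
     \<and> (\<forall>i. (\<lambda>n. coeff (p n) i) \<longlonglongrightarrow> coeff P i)"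

lemma pconvI:
  assumes "\<forall>\<^sub>F n in sequentially. degree (p n) \<le> D" "\<And>i. (\<lambda>n. coeff (p n) i) \<longlonglongrightarrow> coeff P i"
  shows "pconv p P"
  unfolding pconv_def using assms by (intro conjI exI allI)

lemma pconvD:
  assumes "pconv p P"
  shows "(\<lambda>n. coeff (p n) i) \<longlonglongrightarrow> coeff P i"
  using assms unfolding pconv_def by (elim conjE allE)

lemma pconv_degree:
  assumes "pconv p P"
  obtains D where "\<forall>\<^sub>F n in sequentially. degree (p n) \<le> D" "degree P \<le> D"
proof -
  obtain D where D: "\<forall>\<^sub>F n in sequentially. degree (p n) \<le> D" using assms unfolding pconv_def by (elim conjE exE)
  have "degree P \<le> D"
  proof (rule degree_le, intro allI impI)
    fix i assume i: "D < i"
    have "\<forall>\<^sub>F n in sequentially. coeff (p n) i = 0"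
      using D by eventually_elim (use i in \<open>simp add: coeff_eq_0\<close>)
    then have "(\<lambda>n. coeff (p n) i) \<longlonglongrightarrow> 0" by (rule tendsto_eventually)
    then show "coeff P i = 0" using pconvD[OF assms, of i] by (rule LIMSEQ_unique[symmetric])
  qed
  with D show ?thesis by (rule that)
qed

lemma pconv_const: "pconv (\<lambda>_. P) P"
  by (rule pconvI[of _ "degree P"]) simp_all

lemma pconv_subseq:
  assumes "pconv p P" "strict_mono r"
  shows "pconv (\<lambda>n. p (r n)) P"
proof -
  obtain D where D: "\<forall>\<^sub>F n in sequentially. degree (p n) \<le> D" using pconv_degree[OF assms(1)] .
  show ?thesis
  proof (rule pconvI)
    show "\<forall>\<^sub>F n in sequentially. degree (p (r n)) \<le> D" by (rule eventually_subseq[OF assms(2) D])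
    show "(\<lambda>n. coeff (p (r n)) i) \<longlonglongrightarrow> coeff P i" for i
      using LIMSEQ_subseq_LIMSEQ[OF pconvD[OF assms(1)] assms(2)] by (simp add: o_def)
  qed
qed

lemma pconv_add:
  assumes "pconv p P" "pconv q Q"
  shows "pconv (\<lambda>n. p n + q n) (P + Q)"
proof -
  obtain D E where D: "\<forall>\<^sub>F n in sequentially. degree (p n) \<le> D" and E: "\<forall>\<^sub>F n in sequentially. degree (q n) \<le> E"
    using pconv_degree assms by metis
  show ?thesis
  proof (rule pconvI)
    show "\<forall>\<^sub>F n in sequentially. degree (p n + q n) \<le> max D E"
      using D E by eventually_elim (rule degree_add_le, simp_all)
    show "(\<lambda>n. coeff (p n + q n) i) \<longlonglongrightarrow> coeff (P + Q) i" for i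
      by (simp add: tendsto_add pconvD assms)
  qed
qed

lemma pconv_mult:
  assumes "pconv p P" "pconv q Q"
  shows "pconv (\<lambda>n. p n * q n) (P * Q)"
proof -
  obtain D E where D: "\<forall>\<^sub>F n in sequentially. degree (p n) \<le> D" and E: "\<forall>\<^sub>F n in sequentially. degree (q n) \<le> E"
    using pconv_degree assms by metis
  show ?thesis
  proof (rule pconvI)
    show "\<forall>\<^sub>F n in sequentially. degree (p n * q n) \<le> D + E"
      using D E by eventually_elim (rule order.trans[OF degree_mult_le], simp)
    show "(\<lambda>n. coeff (p n * q n) i) \<longlonglongrightarrow> coeff (P * Q) i" for i
      unfolding coeff_mult by (intro tendsto_intros pconvD assms)
  qed
qed

lemma pconv_smult:
  assumes "c \<longlonglongrightarrow> C" "pconv p P"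
  shows "pconv (\<lambda>n. smult (c n) (p n)) (smult C P)"
proof -
  obtain D where D: "\<forall>\<^sub>F n in sequentially. degree (p n) \<le> D" using pconv_degree[OF assms(2)] .
  show ?thesis
  proof (rule pconvI)
    show "\<forall>\<^sub>F n in sequentially. degree (smult (c n) (p n)) \<le> D"
      using D by eventually_elim (rule order.trans[OF degree_smult_le])
    show "(\<lambda>n. coeff (smult (c n) (p n)) i) \<longlonglongrightarrow> coeff (smult C P) i" for i
      by (simp add: tendsto_mult pconvD assms)
  qed
qed

lemma pconv_diff: "pconv p P \<Longrightarrow> pconv q Q \<Longrightarrow> pconv (\<lambda>n. p n - q n) (P - Q)"
  using pconv_add[of p P "\<lambda>n. smult (- 1) (q n)" "smult (- 1) Q"] pconv_smult[of "\<lambda>_. - 1" "- 1" q Q]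
  by simp

lemma pconv_linear: "a \<longlonglongrightarrow> A \<Longrightarrow> pconv (\<lambda>n. [:- a n, 1:]) [:- A, 1:]"
proof (rule pconvI)
  assume a: "a \<longlonglongrightarrow> A"
  show "\<forall>\<^sub>F n in sequentially. degree [:- a n, 1:] \<le> 1" by simp
  show "(\<lambda>n. coeff [:- a n, 1:] i) \<longlonglongrightarrow> coeff [:- A, 1:] i" for i
  proof (cases i)
    case 0 then show ?thesis using tendsto_minus[OF a] by simp
  next
    case (Suc j) then show ?thesis by simp
  qed
qed

lemma pconv_power: "pconv p P \<Longrightarrow> pconv (\<lambda>n. p n ^ k) (P ^ k)"
  by (induction k) (simp_all add: pconv_const pconv_mult)

lemma pconv_prod: "(\<And>i. i \<in> A \<Longrightarrow> pconv (\<lambda>n. p n i) (P i)) \<Longrightarrow> pconv (\<lambda>n. \<Prod>i\<in>A. p n i) (\<Prod>i\<in>A. P i)"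
  by (induction A rule: infinite_finite_induct) (simp_all add: pconv_const pconv_mult)

lemma pconv_pderiv:
  assumes "pconv p P"
  shows "pconv (\<lambda>n. pderiv (p n)) (pderiv P)"
proof -
  obtain D where D: "\<forall>\<^sub>F n in sequentially. degree (p n) \<le> D" using pconv_degree[OF assms] .
  show ?thesis
  proof (rule pconvI)
    show "\<forall>\<^sub>F n in sequentially. degree (pderiv (p n)) \<le> D"
      using D by eventually_elim (simp add: degree_pderiv)
    show "(\<lambda>n. coeff (pderiv (p n)) i) \<longlonglongrightarrow> coeff (pderiv P) i" for i
      unfolding coeff_pderiv by (intro tendsto_intros pconvD assms)
  qed
qed

lemma pconv_wronskian: "pconv p P \<Longrightarrow> pconv q Q \<Longrightarrow> pconv (\<lambda>n. wronskian (p n) (q n)) (wronskian P Q)"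
  unfolding wronskian_def by (intro pconv_diff pconv_mult pconv_pderiv)

lemma poly_eq_sum_le: "degree (p :: complex poly) \<le> D \<Longrightarrow> poly p z = (\<Sum>i\<le>D. coeff p i * z ^ i)"
  unfolding poly_altdef by (intro sum.mono_neutral_left) (simp_all add: coeff_eq_0)

lemma pconv_poly:
  assumes "pconv p P" "z \<longlonglongrightarrow> Z"
  shows "(\<lambda>n. poly (p n) (z n)) \<longlonglongrightarrow> poly P Z"
proof -
  obtain D where D: "\<forall>\<^sub>F n in sequentially. degree (p n) \<le> D" "degree P \<le> D" using pconv_degree[OF assms(1)] .
  have "(\<lambda>n. \<Sum>i\<le>D. coeff (p n) i * z n ^ i) \<longlonglongrightarrow> (\<Sum>i\<le>D. coeff P i * Z ^ i)"
    by (intro tendsto_intros pconvD assms)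
  then have "(\<lambda>n. \<Sum>i\<le>D. coeff (p n) i * z n ^ i) \<longlonglongrightarrow> poly P Z"
    by (simp only: poly_eq_sum_le[OF D(2)])
  then show ?thesis
    by (rule Lim_transform_eventually) (use D(1) in eventually_elim, simp only: poly_eq_sum_le)
qed

lemma pconv_uniform_limit:
  assumes "pconv p P" "compact K"
  shows "uniform_limit K (\<lambda>n. poly (p n)) (poly P) sequentially"
proof -
  obtain D where D: "\<forall>\<^sub>F n in sequentially. degree (p n) \<le> D" "degree P \<le> D" using pconv_degree[OF assms(1)] .
  obtain B where B: "\<And>z. z \<in> K \<Longrightarrow> cmod z \<le> B"
    using compact_imp_bounded[OF assms(2)] by (auto simp: bounded_iff)
  define S where "S n = (\<Sum>i\<le>D. cmod (coeff (p n) i - coeff P i) * \<bar>B\<bar> ^ i)" for n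
  have "S \<longlonglongrightarrow> (\<Sum>i\<le>D. cmod (coeff P i - coeff P i) * \<bar>B\<bar> ^ i)"
    unfolding S_def by (intro tendsto_intros pconvD assms)
  then have S0: "S \<longlonglongrightarrow> 0" by simp
  have le: "dist (poly (p n) z) (poly P z) \<le> S n" if "degree (p n) \<le> D" "z \<in> K" for n z
  proof -
    have "poly (p n) z - poly P z = (\<Sum>i\<le>D. (coeff (p n) i - coeff P i) * z ^ i)"
      unfolding poly_eq_sum_le[OF D(2)] poly_eq_sum_le[OF that(1)]
      by (simp add: sum_subtractf left_diff_distrib)
    also have "cmod \<dots> \<le> (\<Sum>i\<le>D. cmod ((coeff (p n) i - coeff P i) * z ^ i))" by (rule norm_sum)
    also have "\<dots> \<le> S n" unfolding S_def norm_mult norm_power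
      using B[OF that(2)] by (intro sum_mono mult_left_mono power_mono) auto
    finally show ?thesis by (simp add: dist_norm)
  qed
  show ?thesis
  proof (rule uniform_limitI)
    fix e :: real assume "e > 0"
    with S0 have "\<forall>\<^sub>F n in sequentially. S n < e" by (rule order_tendstoD(2))
    with D(1) show "\<forall>\<^sub>F n in sequentially. \<forall>z\<in>K. dist (poly (p n) z) (poly P z) < e"
      by eventually_elim (meson le le_less_trans)
  qed
qed

lemma frequently_subseq:
  assumes "\<not> (\<forall>\<^sub>F n in sequentially. P n)"
  shows "\<exists>r :: nat \<Rightarrow> nat. strict_mono r \<and> (\<forall>n. \<not> P (r n))"
proof -
  have "infinite {n. \<not> P n}"
  proof
    assume "finite {n. \<not> P n}"
    then have "\<forall>\<^sub>F n in sequentially. n \<notin> {n. \<not> P n}"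
      using eventually_cofinite cofinite_eq_sequentially by (metis (mono_tags, lifting) Collect_cong not_not mem_Collect_eq)
    with assms show False by simp
  qed
  from infinite_enumerate[OF this] show ?thesis by auto
qed

lemma poly_not_constant_on_ball:
  fixes P :: "complex poly"
  assumes "P \<noteq> 0" "poly P a = 0" "e > 0"
  shows "\<not> (poly P) constant_on (ball a e)"
proof
  assume "(poly P) constant_on (ball a e)"
  then have "\<And>z. z \<in> ball a e \<Longrightarrow> poly P z = poly P a"
    using assms(3) unfolding constant_on_def by (metis centre_in_ball)
  then have "ball a e \<subseteq> {z. poly P z = 0}" using assms(2) by auto
  then have "finite (ball a e)" using poly_roots_finite[OF assms(1)] finite_subset by blast
  then show False using assms(3) finite_imp_not_open[of "ball a e"] by (metis centre_in_ball empty_iff open_ball)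
qed

text \<open>Hurwitz's theorem gives a root in every neighbourhood of \<open>a\<close> eventually; the nearest roots then form one sequence that
tends to \<open>a\<close>.\<close>

lemma pconv_root:
  assumes pc: "pconv p P" and nz: "P \<noteq> 0" and a: "poly P a = 0"
  obtains z where "z \<longlonglongrightarrow> a" "\<forall>\<^sub>F n in sequentially. poly (p n) (z n) = 0"
proof -
  have ev: "\<forall>\<^sub>F n in sequentially. \<exists>z. poly (p n) z = 0 \<and> dist z a < e" if e: "e > 0" for e
  proof (rule ccontr)
    assume nf: "\<not> ?thesis"
    obtain r :: "nat \<Rightarrow> nat" where r: "strict_mono r" "\<And>n. \<not> (\<exists>z. poly (p (r n)) z = 0 \<and> dist z a < e)"
      using frequently_subseq[OF nf] by auto
    have "poly P a \<noteq> 0"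
    proof (rule Hurwitz_no_zeros[where S = "ball a e" and \<F> = "\<lambda>n. poly (p (r n))" and g = "poly P" and ?z0.0 = a])
      show "uniform_limit K (\<lambda>n. poly (p (r n))) (poly P) sequentially" if "compact K" for K
        by (rule pconv_uniform_limit[OF pconv_subseq[OF pc r(1)] that])
      show "\<not> (poly P) constant_on (ball a e)" by (rule poly_not_constant_on_ball[OF nz a e])
      show "poly (p (r n)) z \<noteq> 0" if "z \<in> ball a e" for n z
        using r(2)[of n] that unfolding mem_ball dist_commute[of a z] by blast
    qed (use e in \<open>auto intro!: holomorphic_intros\<close>)
    with a show False by simp
  qed
  \<comment> \<open>A root nearest to \<open>a\<close>, and an arbitrary point if there is no root.\<close>
  have ex: "\<exists>z. (\<exists>w. poly (p n) w = 0) \<longrightarrow> poly (p n) z = 0 \<and> (\<forall>w. poly (p n) w = 0 \<longrightarrow> dist z a \<le> dist w a)" for n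
  proof (cases "p n = 0")
    case True
    then show ?thesis by (intro exI[of _ a]) simp
  next
    case False
    show ?thesis
    proof (cases "\<exists>w. poly (p n) w = 0")
      case True
      let ?R = "{w. poly (p n) w = 0}"
      have "finite ?R" "?R \<noteq> {}" using True poly_roots_finite[OF False] by auto
      then obtain z where "z \<in> ?R" "\<forall>w\<in>?R. dist z a \<le> dist w a"
        using arg_min_if_finite(1)[of ?R "\<lambda>w. dist w a"] arg_min_least[of ?R _ "\<lambda>w. dist w a"] by metis
      then show ?thesis by blast
    qed simp
  qed
  obtain z where z: "\<And>n. (\<exists>w. poly (p n) w = 0) \<Longrightarrow> poly (p n) (z n) = 0"
    "\<And>n w. poly (p n) w = 0 \<Longrightarrow> dist (z n) a \<le> dist w a"
    using ex by metis
  show ?thesis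
  proof
    show "z \<longlonglongrightarrow> a"
    proof (rule tendstoI)
      fix e :: real assume "e > 0"
      from ev[OF this] show "\<forall>\<^sub>F n in sequentially. dist (z n) a < e"
        by eventually_elim (use z(2) le_less_trans in blast)
    qed
    show "\<forall>\<^sub>F n in sequentially. poly (p n) (z n) = 0"
      using ev[OF zero_less_one] by eventually_elim (use z(1) in blast)
  qed
qed

text \<open>Divisibility expressed by vanishing derivatives is a closed condition in \<open>a\<close> and \<open>p\<close>, which gives the next lemma.\<close>

lemma linear_power_dvd_iff:
  fixes p :: "complex poly"
  shows "[:- a, 1:] ^ k dvd p \<longleftrightarrow> (\<forall>j<k. poly ((pderiv ^^ j) p) a = 0)"
proof (induction k arbitrary: p)
  case (Suc k)
  show ?case
  proof (cases "p = 0 \<or> poly p a \<noteq> 0")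
    case True
    then show ?thesis
    proof
      assume "p = 0"
      moreover have "(pderiv ^^ j) 0 = (0 :: complex poly)" for j by (induction j) simp_all
      ultimately show ?thesis by simp
    next
      assume na: "poly p a \<noteq> 0"
      then have "\<not> [:- a, 1:] ^ Suc k dvd p" using order_0I[OF na] order_divides[of a "Suc k" p] by auto
      moreover have "\<not> (\<forall>j<Suc k. poly ((pderiv ^^ j) p) a = 0)"
        using na by (auto intro!: exI[of _ 0])
      ultimately show ?thesis by blast
    qed
  next
    case False
    then have p: "p \<noteq> 0" "poly p a = 0" by auto
    have p': "pderiv p \<noteq> 0"
    proof
      assume "pderiv p = 0"
      then obtain c where "p = [:c:]" by (metis pderiv_eq_0_iff degree_eq_zeroE)
      with p show False by simp
    qed
    have "[:- a, 1:] ^ Suc k dvd p \<longleftrightarrow> [:- a, 1:] ^ k dvd pderiv p"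
      using order_pderiv[OF p] p p' by (simp only: order_divides) simp
    also have "\<dots> \<longleftrightarrow> (\<forall>j<k. poly ((pderiv ^^ Suc j) p) a = 0)"
      unfolding Suc.IH funpow_Suc_right o_apply by (rule refl)
    also have "\<dots> \<longleftrightarrow> (\<forall>j<Suc k. poly ((pderiv ^^ j) p) a = 0)"
      using p(2) by (auto simp: less_Suc_eq_0_disj)
    finally show ?thesis .
  qed
qed simp

lemma pconv_linear_power_dvd:
  assumes "pconv p P" "a \<longlonglongrightarrow> A" "\<exists>\<^sub>F n in sequentially. [:- a n, 1:] ^ k dvd p n"
  shows "[:- A, 1:] ^ k dvd P"
proof -
  have pd: "pconv (\<lambda>n. (pderiv ^^ j) (p n)) ((pderiv ^^ j) P)" for j
    by (induction j) (simp_all add: assms pconv_pderiv)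
  have "poly ((pderiv ^^ j) P) A = 0" if "j < k" for j
  proof (rule ccontr)
    assume "poly ((pderiv ^^ j) P) A \<noteq> 0"
    from tendsto_imp_eventually_ne[OF pconv_poly[OF pd assms(2)] this]
    have "\<forall>\<^sub>F n in sequentially. \<not> [:- a n, 1:] ^ k dvd p n"
      by eventually_elim (use that linear_power_dvd_iff in blast)
    with assms(3) show False by (simp add: frequently_def)
  qed
  then show ?thesis unfolding linear_power_dvd_iff by blast
qed

definition coeff_norm :: "nat \<Rightarrow> complex poly \<Rightarrow> real" where
  "coeff_norm D p = (\<Sum>i\<le>D. cmod (coeff p i))"

lemma coeff_norm_eq_0_iff: "degree p \<le> D \<Longrightarrow> coeff_norm D p = 0 \<longleftrightarrow> p = 0"
proof
  assume d: "degree p \<le> D" and "coeff_norm D p = 0"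
  then have "\<forall>i\<le>D. coeff p i = 0" unfolding coeff_norm_def by (simp add: sum_nonneg_eq_0_iff)
  then show "p = 0" using d by (metis leading_coeff_0_iff)
qed (simp add: coeff_norm_def)

lemma coeff_norm_nonneg: "coeff_norm D p \<ge> 0" by (simp add: coeff_norm_def sum_nonneg)

lemma coeff_norm_smult: "coeff_norm D (smult c p) = cmod c * coeff_norm D p"
  by (simp add: coeff_norm_def norm_mult sum_distrib_left)

lemma coeff_norm_coeff_le: "degree p \<le> D \<Longrightarrow> cmod (coeff p i) \<le> coeff_norm D p"
proof (cases "i \<le> D")
  case True then show ?thesis unfolding coeff_norm_def by (intro member_le_sum) auto
next
  case False
  assume "degree p \<le> D" with False show ?thesis by (simp add: coeff_eq_0 coeff_norm_nonneg)
qed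

lemma pconv_coeff_norm: "pconv p P \<Longrightarrow> (\<lambda>n. coeff_norm D (p n)) \<longlonglongrightarrow> coeff_norm D P"
  unfolding coeff_norm_def by (intro tendsto_intros pconvD)

lemma pconv_compact_family:
  fixes p :: "nat \<Rightarrow> 'i \<Rightarrow> complex poly"
  assumes "finite I" "\<And>n i. i \<in> I \<Longrightarrow> degree (p n i) \<le> D" "\<And>n i. i \<in> I \<Longrightarrow> coeff_norm D (p n i) \<le> B"
  shows "\<exists>r P. strict_mono (r :: nat \<Rightarrow> nat) \<and> (\<forall>i\<in>I. pconv (\<lambda>n. p (r n) i) (P i) \<and> degree (P i) \<le> D)"
proof -
  have "\<exists>r l. strict_mono (r :: nat \<Rightarrow> nat) \<and> (\<forall>k\<in>I \<times> {..D}. (\<lambda>n. coeff (p (r n) (fst k)) (snd k)) \<longlonglongrightarrow> l k)"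
  proof (rule finite_family_subseq)
    show "finite (I \<times> {..D})" using assms(1) by simp
    fix k assume "k \<in> I \<times> {..D}"
    then have "cmod (coeff (p n (fst k)) (snd k)) \<le> B" for n
      using order.trans[OF coeff_norm_coeff_le[OF assms(2)] assms(3)] by auto
    then show "bounded (range (\<lambda>n. coeff (p n (fst k)) (snd k)))" by (auto simp: bounded_iff)
  qed
  then obtain r l where r: "strict_mono (r :: nat \<Rightarrow> nat)"
    and l: "\<And>i j. i \<in> I \<Longrightarrow> j \<le> D \<Longrightarrow> (\<lambda>n. coeff (p (r n) i) j) \<longlonglongrightarrow> l (i, j)" by fastforce
  define P where "P i = (\<Sum>j\<le>D. monom (l (i, j)) j)" for i
  have cP: "coeff (P i) j = (if j \<le> D then l (i, j) else 0)" for i j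
    by (simp add: P_def coeff_sum)
  have "pconv (\<lambda>n. p (r n) i) (P i)" if "i \<in> I" for i
  proof (rule pconvI[of _ D])
    show "\<forall>\<^sub>F n in sequentially. degree (p (r n) i) \<le> D" using assms(2)[OF that] by simp
    fix j
    show "(\<lambda>n. coeff (p (r n) i) j) \<longlonglongrightarrow> coeff (P i) j"
    proof (cases "j \<le> D")
      case True then show ?thesis using l[OF that True] by (simp add: cP)
    next
      case False
      then have "coeff (p (r n) i) j = 0" for n using assms(2)[OF that, of "r n"] by (intro coeff_eq_0) simp
      then show ?thesis using False by (simp add: cP)
    qed
  qed
  moreover have "degree (P i) \<le> D" for i by (rule degree_le) (simp add: cP)
  ultimately show ?thesis using r by blast
qed

section \<open>Coefficients of convergent rational maps\<close>

text \<open>If the derivative of \<open>P / Q\<close> vanished, a zero \<open>z\<close> of \<open>P\<close> would have at least its multiplicity in \<open>P\<close> also as a zero of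
\<open>P' Q\<close>, although \<open>P'\<close> has one less and \<open>Q\<close> does not vanish there.\<close>

lemma wronskian_nonzero:
  assumes "coprime P Q" "degree Q < degree P"
  shows "wronskian P Q \<noteq> 0"
proof
  assume "wronskian P Q = 0"
  then have eq: "pderiv P * Q = P * pderiv Q" by (simp add: wronskian_def)
  have "\<not> constant (poly P)" using assms(2) by (simp add: constant_degree)
  then obtain z where z: "poly P z = 0" using fundamental_theorem_of_algebra by blast
  have P: "P \<noteq> 0" "pderiv P \<noteq> 0" using assms(2) by (auto simp: pderiv_eq_0_iff)
  have Qz: "poly Q z \<noteq> 0" by (rule coprime_no_common_root[OF assms(1) z])
  then have nz: "pderiv P * Q \<noteq> 0" using P by auto
  have "order z P \<le> order z (pderiv P * Q)"
    by (rule dvd_imp_order_le[OF nz]) (simp add: eq)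
  also have "\<dots> = order z (pderiv P)" using order_mult[OF nz, of z] order_0I[OF Qz] by simp
  finally show False using order_pderiv[OF P(1) z] by simp
qed

lemma rat_map_Some: "rat_map p q (Some z) = (if poly q z = 0 then None else Some (poly p z / poly q z))"
  by (simp add: rat_map_def)

lemma nondeg_no_common_root: "nondeg d p q \<Longrightarrow> poly p z \<noteq> 0 \<or> poly q z \<noteq> 0"
  using nondeg_iff coprime_no_common_root by blast

lemma rat_map_eq_Some_iff:
  assumes "nondeg d p q"
  shows "rat_map p q (Some z) = Some w \<longleftrightarrow> poly (p - smult w q) z = 0"
  using nondeg_no_common_root[OF assms, of z] by (cases "poly q z = 0") (simp_all add: rat_map_Some field_simps)

lemma cconv_value:
  assumes "cconv G (rat_map P Q)" "\<And>n. G n = rat_map (p n) (q n)" "z \<longlonglongrightarrow> a" "poly Q a \<noteq> 0"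
  shows "\<forall>\<^sub>F n in sequentially. poly (q n) (z n) \<noteq> 0"
    "(\<lambda>n. poly (p n) (z n) / poly (q n) (z n)) \<longlonglongrightarrow> poly P a / poly Q a"
proof -
  have "sconv (\<lambda>n. G n (Some (z n))) (Some (poly P a / poly Q a)) sequentially"
    using cconv_seq[OF assms(1) sconv_Some[OF assms(3)]] assms(4) by (simp add: rat_map_Some)
  note c = sconv_SomeD[OF this, unfolded assms(2)]
  show ev: "\<forall>\<^sub>F n in sequentially. poly (q n) (z n) \<noteq> 0"
    using c(1) by eventually_elim (auto simp: rat_map_Some split: if_splits)
  show "(\<lambda>n. poly (p n) (z n) / poly (q n) (z n)) \<longlonglongrightarrow> poly P a / poly Q a"
    by (rule Lim_transform_eventually[OF c(2)]) (use ev in eventually_elim, simp add: rat_map_Some)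
qed

lemma cconv_bounded_on_compact:
  assumes cc: "cconv G (rat_map P Q)" and G: "\<And>n. G n = rat_map (p n) (q n)"
    and K: "compact K" "\<And>z. z \<in> K \<Longrightarrow> poly Q z \<noteq> 0"
  obtains M where "\<forall>\<^sub>F n in sequentially. \<forall>z\<in>K. poly (q n) z \<noteq> 0 \<and> cmod (poly (p n) z / poly (q n) z) \<le> M"
proof -
  have "continuous_on K (\<lambda>z. poly P z / poly Q z)" using K(2) by (intro continuous_intros) auto
  then have "bounded ((\<lambda>z. poly P z / poly Q z) ` K)"
    using K(1) compact_continuous_image compact_imp_bounded by blast
  then obtain B where B: "\<And>z. z \<in> K \<Longrightarrow> cmod (poly P z / poly Q z) \<le> B" by (auto simp: bounded_iff)
  have "\<forall>\<^sub>F n in sequentially. \<forall>z\<in>K. poly (q n) z \<noteq> 0 \<and> cmod (poly (p n) z / poly (q n) z) \<le> B + 1"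
  proof (rule ccontr)
    assume nf: "\<not> ?thesis"
    obtain r :: "nat \<Rightarrow> nat" where r: "strict_mono r"
      "\<forall>n. \<not> (\<forall>z\<in>K. poly (q (r n)) z \<noteq> 0 \<and> cmod (poly (p (r n)) z / poly (q (r n)) z) \<le> B + 1)"
      using frequently_subseq[OF nf] by blast
    then obtain z where z: "\<And>n. z n \<in> K"
      "\<And>n. \<not> (poly (q (r n)) (z n) \<noteq> 0 \<and> cmod (poly (p (r n)) (z n) / poly (q (r n)) (z n)) \<le> B + 1)" by metis
    obtain a s where s: "a \<in> K" "strict_mono (s :: nat \<Rightarrow> nat)" "(z \<circ> s) \<longlonglongrightarrow> a"
      using K(1) z(1) unfolding compact_def by metis
    have rs: "strict_mono (\<lambda>n. r (s n))" using strict_mono_o[OF r(1) s(2)] by (simp add: o_def)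
    note c = cconv_value[OF cconv_subseq[OF cc rs] G s(3) K(2)[OF s(1)]]
    have "(\<lambda>n. cmod (poly (p (r (s n))) ((z \<circ> s) n) / poly (q (r (s n))) ((z \<circ> s) n))) \<longlonglongrightarrow> cmod (poly P a / poly Q a)"
      by (rule tendsto_norm[OF c(2)])
    moreover have "cmod (poly P a / poly Q a) < B + 1" using B[OF s(1)] by simp
    ultimately have "\<forall>\<^sub>F n in sequentially. cmod (poly (p (r (s n))) ((z \<circ> s) n) / poly (q (r (s n))) ((z \<circ> s) n)) < B + 1"
      by (rule order_tendstoD(2))
    with c(1) have "\<forall>\<^sub>F n in sequentially. False"
      by eventually_elim (use z(2) in \<open>force simp: o_def\<close>)
    then show False by simp
  qed
  then show ?thesis by (rule that)
qed

text \<open>Two preimages of \<open>w\<close> that merge produce a double one in the limit. Since only convergence of values is known at this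
stage, the second factor is carried over by the maximum principle and not by comparing coefficients.\<close>

lemma double_preimage_critical:
  assumes cc: "cconv G (rat_map P Q)" and G: "\<And>n. G n = rat_map (p n) (q n)"
    and z: "z \<longlonglongrightarrow> a" "z' \<longlonglongrightarrow> a"
    and dvd: "\<And>n. [:- z n, 1:] * [:- z' n, 1:] dvd p n - smult w (q n)"
    and a: "poly Q a \<noteq> 0" "poly (P - smult w Q) a = 0"
  shows "poly (pderiv (P - smult w Q)) a = 0"
proof -
  have "open {z. poly Q z \<noteq> 0}"
    by (rule open_Collect_neq) (auto intro: continuous_intros)
  then obtain \<rho> where \<rho>: "\<rho> > 0" "cball a \<rho> \<subseteq> {z. poly Q z \<noteq> 0}"
    using a(1) open_contains_cball by blast
  have QK: "\<And>z. z \<in> cball a \<rho> \<Longrightarrow> poly Q z \<noteq> 0" using \<rho>(2) by blast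
  obtain M where M: "\<forall>\<^sub>F n in sequentially. \<forall>z\<in>cball a \<rho>. poly (q n) z \<noteq> 0 \<and> cmod (poly (p n) z / poly (q n) z) \<le> M"
    using cconv_bounded_on_compact[OF cc G compact_cball QK] by blast
  obtain t where t: "\<And>n. p n - smult w (q n) = [:- z n, 1:] * [:- z' n, 1:] * t n"
    using dvd unfolding dvd_def by metis
  \<comment> \<open>On the circle of radius \<open>\<rho>\<close> both factors are at least \<open>\<rho> / 2\<close>, so the quotient \<open>h\<close> below is bounded by \<open>C\<close> there, hence inside.\<close>
  define C where "C = (M + cmod w) / (\<rho> / 2 * (\<rho> / 2))"
  have near: "\<forall>\<^sub>F n in sequentially. dist (z n) a < \<rho> / 2 \<and> dist (z' n) a < \<rho> / 2"
    using tendstoD[OF z(1), of "\<rho> / 2"] tendstoD[OF z(2), of "\<rho> / 2"] \<rho>(1) by (simp add: eventually_conj)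
  have bound: "\<forall>\<^sub>F n in sequentially. \<forall>x\<in>ball a \<rho>.
      cmod (poly (p n) x / poly (q n) x - w) \<le> C * (cmod (x - z n) * cmod (x - z' n))"
    using M near
  proof eventually_elim
    fix n assume M: "\<forall>z\<in>cball a \<rho>. poly (q n) z \<noteq> 0 \<and> cmod (poly (p n) z / poly (q n) z) \<le> M"
      and near: "dist (z n) a < \<rho> / 2 \<and> dist (z' n) a < \<rho> / 2"
    define h where "h x = poly (t n) x / poly (q n) x" for x
    have eq: "poly (p n) x / poly (q n) x - w = (x - z n) * (x - z' n) * h x" if "x \<in> cball a \<rho>" for x
    proof -
      have "poly (p n) x - w * poly (q n) x = (x - z n) * (x - z' n) * poly (t n) x"
        using arg_cong[OF t[of n], of "\<lambda>P. poly P x"] by (simp add: algebra_simps)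
      moreover have "poly (q n) x \<noteq> 0" using M that by blast
      then have "poly (p n) x / poly (q n) x - w = (poly (p n) x - w * poly (q n) x) / poly (q n) x"
        by (simp add: diff_divide_distrib)
      ultimately show ?thesis unfolding h_def by simp
    qed
    have hC: "cmod (h x) \<le> C" if x: "x \<in> ball a \<rho>" for x
    proof (rule maximum_modulus_frontier[where S = "ball a \<rho>" and f = h])
      show "h holomorphic_on interior (ball a \<rho>)"
        unfolding h_def using M by (intro holomorphic_intros) auto
      show "continuous_on (closure (ball a \<rho>)) h"
        unfolding h_def using M \<rho>(1) by (intro continuous_intros) (auto simp: closure_ball)
      fix y assume "y \<in> frontier (ball a \<rho>)"
      then have y: "dist a y = \<rho>" "y \<in> cball a \<rho>" using \<rho>(1) by (auto simp: frontier_ball)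
      have ge: "cmod (y - z n) \<ge> \<rho> / 2" "cmod (y - z' n) \<ge> \<rho> / 2"
        using near y(1) dist_triangle[of a y "z n"] dist_triangle[of a y "z' n"]
        by (simp_all add: dist_norm norm_minus_commute)
      have "cmod (y - z n) * cmod (y - z' n) * cmod (h y) = cmod (poly (p n) y / poly (q n) y - w)"
        unfolding eq[OF y(2)] norm_mult by (rule refl)
      also have "\<dots> \<le> M + cmod w"
        using M y(2) norm_triangle_ineq4[of "poly (p n) y / poly (q n) y" w] by fastforce
      finally have 1: "cmod (y - z n) * cmod (y - z' n) * cmod (h y) \<le> M + cmod w" .
      have "(\<rho> / 2 * (\<rho> / 2)) * cmod (h y) \<le> cmod (y - z n) * cmod (y - z' n) * cmod (h y)"
        using ge \<rho>(1) by (intro mult_right_mono mult_mono) auto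
      with 1 have "cmod (h y) * (\<rho> / 2 * (\<rho> / 2)) \<le> M + cmod w" by (simp add: mult.commute)
      then show "cmod (h y) \<le> C" unfolding C_def using \<rho>(1) by (subst pos_le_divide_eq) simp_all
    qed (use x in simp_all)
    show "\<forall>x\<in>ball a \<rho>. cmod (poly (p n) x / poly (q n) x - w) \<le> C * (cmod (x - z n) * cmod (x - z' n))"
    proof
      fix x assume x: "x \<in> ball a \<rho>"
      then have xc: "x \<in> cball a \<rho>" by simp
      have "cmod (h x) * (cmod (x - z n) * cmod (x - z' n)) \<le> C * (cmod (x - z n) * cmod (x - z' n))"
        using hC[OF x] by (intro mult_right_mono) auto
      then show "cmod (poly (p n) x / poly (q n) x - w) \<le> C * (cmod (x - z n) * cmod (x - z' n))"
        unfolding eq[OF xc] norm_mult by (simp add: mult.commute)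
    qed
  qed
  have lim: "cmod (poly P x / poly Q x - w) \<le> C * (cmod (x - a) * cmod (x - a))" if x: "x \<in> ball a \<rho>" for x
  proof (rule tendsto_le[OF sequentially_bot])
    have Qx: "poly Q x \<noteq> 0" using QK x by simp
    show "(\<lambda>n. cmod (poly (p n) x / poly (q n) x - w)) \<longlonglongrightarrow> cmod (poly P x / poly Q x - w)"
      by (intro tendsto_intros cconv_value(2)[OF cc G tendsto_const Qx])
    show "(\<lambda>n. C * (cmod (x - z n) * cmod (x - z' n))) \<longlonglongrightarrow> C * (cmod (x - a) * cmod (x - a))"
      by (intro tendsto_intros z)
    show "\<forall>\<^sub>F n in sequentially. cmod (poly (p n) x / poly (q n) x - w) \<le> C * (cmod (x - z n) * cmod (x - z' n))"
      using bound by eventually_elim (use x in blast)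
  qed
  \<comment> \<open>In the limit \<open>|f - w| \<le> C |x - a|\<^sup>2\<close>, so that \<open>a\<close> is also a root of the cofactor \<open>S\<close>.\<close>
  obtain S where S: "P - smult w Q = [:- a, 1:] * S" using a(2) poly_eq_0_iff_dvd by blast
  have le: "cmod (poly S x) \<le> C * cmod (x - a) * cmod (poly Q x)" if x: "x \<in> ball a \<rho>" "x \<noteq> a" for x
  proof -
    have Qx: "poly Q x \<noteq> 0" using QK x by simp
    have "poly P x - w * poly Q x = (x - a) * poly S x"
      using arg_cong[OF S, of "\<lambda>P. poly P x"] by (simp add: algebra_simps)
    then have "poly P x / poly Q x - w = (x - a) * poly S x / poly Q x"
      using Qx by (metis diff_divide_distrib nonzero_mult_div_cancel_right)
    then have "cmod (x - a) * cmod (poly S x) / cmod (poly Q x) \<le> C * (cmod (x - a) * cmod (x - a))"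
      using lim[OF x(1)] by (simp add: norm_mult norm_divide)
    then have "cmod (x - a) * cmod (poly S x) \<le> cmod (x - a) * (C * cmod (x - a) * cmod (poly Q x))"
      using Qx by (subst (asm) pos_divide_le_eq) (simp_all add: mult_ac)
    then show ?thesis using x(2) by (subst (asm) mult_le_cancel_left_pos) simp_all
  qed
  have "cmod (poly S a) \<le> C * cmod (a - a) * cmod (poly Q a)"
  proof (rule tendsto_le)
    show "((\<lambda>x. cmod (poly S x)) \<longlongrightarrow> cmod (poly S a)) (at a)" by (intro tendsto_norm isContD poly_isCont)
    show "((\<lambda>x. C * cmod (x - a) * cmod (poly Q x)) \<longlongrightarrow> C * cmod (a - a) * cmod (poly Q a)) (at a)"
      by (intro tendsto_intros isContD[OF poly_isCont])
    show "\<forall>\<^sub>F x in at a. cmod (poly S x) \<le> C * cmod (x - a) * cmod (poly Q x)"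
      unfolding eventually_at using \<rho>(1) le by (intro exI[of _ \<rho>]) (auto simp: dist_commute)
  qed simp
  then have "poly S a = 0" by simp
  then show ?thesis unfolding S pderiv_mult poly_add poly_mult by simp
qed

text \<open>Only finitely many values are taken at critical points; any other \<open>w\<close> will do.\<close>

lemma simple_fibre:
  assumes n: "nondeg d P Q" and d: "degree Q < degree P"
  obtains w where "\<And>z. poly (P - smult w Q) z = 0 \<Longrightarrow> poly Q z \<noteq> 0 \<and> poly (pderiv (P - smult w Q)) z \<noteq> 0"
proof -
  have cop: "coprime P Q" using n by (simp add: nondeg_iff)
  let ?F = "(\<lambda>c. poly P c / poly Q c) ` {c. poly (wronskian P Q) c = 0}"
  have "finite ?F" by (intro finite_imageI poly_roots_finite wronskian_nonzero cop d)
  then obtain w where w: "w \<notin> ?F" using ex_new_if_finite[OF infinite_UNIV_char_0] by blast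
  have "poly Q z \<noteq> 0 \<and> poly (pderiv (P - smult w Q)) z \<noteq> 0" if z: "poly (P - smult w Q) z = 0" for z
  proof -
    have Pz: "poly P z = w * poly Q z" using z by simp
    have Qz: "poly Q z \<noteq> 0" using Pz nondeg_no_common_root[OF n, of z] by auto
    then have "w = poly P z / poly Q z" using Pz by simp
    then have "poly (wronskian P Q) z \<noteq> 0" using w by blast
    moreover have "poly (wronskian P Q) z = poly (pderiv (P - smult w Q)) z * poly Q z"
      by (simp add: wronskian_def Pz pderiv_diff pderiv_smult algebra_simps)
    ultimately show ?thesis using Qz by simp
  qed
  then show ?thesis by (rule that)
qed

text \<open>A degree larger than \<open>d\<close> along a subsequence would give \<open>d + 1\<close> preimages of a value over which \<open>f\<close> has only \<open>d\<close> simple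
ones, and two of them would merge.\<close>

lemma cconv_degree_le:
  assumes cc: "cconv G (rat_map P Q)" and G: "\<And>n. G n = rat_map (p n) (q n)"
    and e: "\<And>n. nondeg (e n) (p n) (q n)"
    and n: "nondeg d P Q" and d: "degree Q < degree P"
  shows "\<forall>\<^sub>F n in sequentially. e n \<le> d"
proof (rule ccontr)
  assume nf: "\<not> ?thesis"
  have dP: "degree P = d" using n d by (simp add: nondeg_iff)
  have fN: "rat_map P Q None = None" using d by (simp add: rat_map_def Let_def max_def coeff_eq_0)
  obtain w where w: "\<And>z. poly (P - smult w Q) z = 0 \<Longrightarrow> poly Q z \<noteq> 0 \<and> poly (pderiv (P - smult w Q)) z \<noteq> 0"
    using simple_fibre[OF n d] by blast
  have evN: "\<forall>\<^sub>F n in sequentially. G n None \<noteq> Some w"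
    using sconv_eventually_neq[OF cconv_seq[OF cc sconv_const] sconv_const, of None "Some w"] fN by simp
  have "\<not> (\<forall>\<^sub>F n in sequentially. \<not> (e n > d \<and> G n None \<noteq> Some w))"
  proof
    assume "\<forall>\<^sub>F n in sequentially. \<not> (e n > d \<and> G n None \<noteq> Some w)"
    with evN have "\<forall>\<^sub>F n in sequentially. e n \<le> d" by eventually_elim simp
    with nf show False ..
  qed
  from frequently_subseq[OF this] obtain r :: "nat \<Rightarrow> nat" where r: "strict_mono r"
    "\<And>n. e (r n) > d" "\<And>n. G (r n) None \<noteq> Some w" by auto
  define R where "R n = p (r n) - smult w (q (r n))" for n
  have degR: "degree (R n) \<ge> e (r n)" for n
  proof (rule le_degree, rule notI)
    assume "coeff (R n) (e (r n)) = 0"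
    then have c: "coeff (p (r n)) (e (r n)) = w * coeff (q (r n)) (e (r n))" by (simp add: R_def)
    have "coeff (p (r n)) (e (r n)) \<noteq> 0 \<or> coeff (q (r n)) (e (r n)) \<noteq> 0"
      using nondeg_hom[OF e[of "r n"], of 1 0] by (simp add: hom_at_infinity)
    then have "coeff (q (r n)) (e (r n)) \<noteq> 0" using c by auto
    moreover have "max (degree (p (r n))) (degree (q (r n))) = e (r n)" using e[of "r n"] by (simp add: nondeg_iff)
    ultimately have "G (r n) None = Some w" using c by (simp add: G rat_map_def Let_def)
    with r(3) show False by blast
  qed
  have "\<exists>a. smult (lead_coeff (R n)) (\<Prod>i<degree (R n). [:- a i, 1:]) = R n" for n
    using complex_poly_decompose'[of "R n"] by metis
  then obtain a where a: "\<And>n. smult (lead_coeff (R n)) (\<Prod>i<degree (R n). [:- a n i, 1:]) = R n" by metis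
  have dvd: "(\<Prod>i\<in>I. [:- a n i, 1:]) dvd R n" if "I \<subseteq> {..d}" for n I
  proof -
    have "I \<subseteq> {..<degree (R n)}" using that degR[of n] r(2)[of n] by fastforce
    then have "(\<Prod>i\<in>I. [:- a n i, 1:]) dvd (\<Prod>i<degree (R n). [:- a n i, 1:])"
      by (intro prod_dvd_prod_subset) simp_all
    then show ?thesis by (subst a[symmetric]) (rule dvd_smult)
  qed
  have root: "poly (R n) (a n i) = 0" if "i \<le> d" for n i
    using dvd[of "{i}" n] that by (simp add: poly_eq_0_iff_dvd)
  \<comment> \<open>The roots may converge to \<open>\<infinity>\<close> a priori; this is excluded because \<open>\<infinity>\<close> is a fixed point, not a preimage of \<open>w\<close>.\<close>
  obtain s \<zeta> where s: "strict_mono (s :: nat \<Rightarrow> nat)"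
    and \<zeta>: "\<And>i. i \<le> d \<Longrightarrow> sconv (\<lambda>n. Some (a (s n) i)) (\<zeta> i) sequentially"
    using sphere_family_subseq[of "{..d}" "\<lambda>n i. Some (a n i)"] by auto
  have rs: "strict_mono (\<lambda>n. r (s n))" using strict_mono_o[OF r(1) s] by (simp add: o_def)
  have "\<exists>b. \<zeta> i = Some b \<and> poly (P - smult w Q) b = 0" if i: "i \<le> d" for i
  proof -
    have "G (r (s n)) (Some (a (s n) i)) = Some w" for n
      using root[OF i, of "s n"] unfolding G R_def rat_map_eq_Some_iff[OF e] .
    then have "sconv (\<lambda>n. Some w) (rat_map P Q (\<zeta> i)) sequentially"
      using cconv_seq[OF cconv_subseq[OF cc rs] \<zeta>[OF i]] by simp
    from sconv_unique[OF this sconv_const] have f: "rat_map P Q (\<zeta> i) = Some w" by simp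
    then obtain b where b: "\<zeta> i = Some b" using fN by (cases "\<zeta> i") auto
    with f rat_map_eq_Some_iff[OF n] show ?thesis by auto
  qed
  then obtain b where b: "\<And>i. i \<le> d \<Longrightarrow> \<zeta> i = Some (b i)" "\<And>i. i \<le> d \<Longrightarrow> poly (P - smult w Q) (b i) = 0"
    by metis
  have nz: "P - smult w Q \<noteq> 0" using d by (metis degree_smult_le eq_iff_diff_eq_0 leD)
  \<comment> \<open>There are \<open>d + 1\<close> limits but at most \<open>d\<close> roots.\<close>
  have "card {x. poly (P - smult w Q) x = 0} \<le> degree (P - smult w Q)"
    by (rule card_poly_roots_bound[OF nz])
  also have "\<dots> \<le> d" using d dP by (intro degree_diff_le) (auto intro: order.trans[OF degree_smult_le])
  finally have "card (b ` {..d}) \<le> d"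
    using card_mono[OF poly_roots_finite[OF nz], of "b ` {..d}"] b(2) by fastforce
  then have "\<not> inj_on b {..d}" by (auto dest: card_image)
  then obtain i j where ij: "i \<le> d" "j \<le> d" "i \<noteq> j" "b i = b j" by (auto simp: inj_on_def)
  have lim: "(\<lambda>n. a (s n) k) \<longlonglongrightarrow> b k" if "k \<le> d" for k
    using sconv_SomeD(2)[OF \<zeta>[OF that, unfolded b(1)[OF that]]] by simp
  have "poly (pderiv (P - smult w Q)) (b i) = 0"
  proof (rule double_preimage_critical[OF cconv_subseq[OF cc rs] G])
    show "(\<lambda>n. a (s n) i) \<longlonglongrightarrow> b i" "(\<lambda>n. a (s n) j) \<longlonglongrightarrow> b i" using lim ij by metis+
    show "[:- a (s n) i, 1:] * [:- a (s n) j, 1:] dvd p (r (s n)) - smult w (q (r (s n)))" for n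
      using dvd[of "{i, j}" "s n"] ij by (simp add: R_def)
    show "poly Q (b i) \<noteq> 0" "poly (P - smult w Q) (b i) = 0" using w b(2) ij by auto
  qed
  then show False using w b(2) ij by blast
qed

lemma nondeg_smult:
  assumes "nondeg d p q" "c \<noteq> 0"
  shows "nondeg d (smult c p) (smult c q)" "rat_map (smult c p) (smult c q) = rat_map p q"
proof -
  show n: "nondeg d (smult c p) (smult c q)"
  proof (rule nondegI)
    fix u v assume "hom d (smult c p) u v = 0" "hom d (smult c q) u v = 0"
    then have "hom d p u v = 0" "hom d q u v = 0" using assms(2) by (simp_all add: hom_smult)
    then show "u = 0 \<and> v = 0" by (rule nondegD[OF assms(1)])
  qed (use nondeg_degree[OF assms(1)] degree_smult_le order.trans in blast)+
  show "rat_map (smult c p) (smult c q) = rat_map p q"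
    using assms(2) by (auto simp: rat_map_def Let_def fun_eq_iff split: option.splits)
qed

text \<open>Induction on the degree of \<open>P\<close>: a root of \<open>P\<close> is one of \<open>A\<close>, since \<open>Q\<close> does not vanish there, and can be divided out.\<close>

lemma coprime_dvd_mult_complex_poly:
  fixes P Q A :: "complex poly"
  assumes "coprime P Q" "P \<noteq> 0" "P dvd A * Q"
  shows "P dvd A"
  using assms
proof (induction "degree P" arbitrary: P A)
  case 0
  then have "is_unit P" by (simp add: is_unit_iff_degree)
  then show ?case by (rule unit_imp_dvd)
next
  case (Suc k)
  have "\<not> constant (poly P)" using Suc.hyps(2) by (simp add: constant_degree)
  then obtain z where z: "poly P z = 0" using fundamental_theorem_of_algebra by blast
  have Qz: "poly Q z \<noteq> 0" by (rule coprime_no_common_root[OF Suc.prems(1) z])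
  obtain P' where P': "P = [:- z, 1:] * P'" using z poly_eq_0_iff_dvd by (metis dvdE)
  have "poly (A * Q) z = 0" using Suc.prems(3) z by (metis dvdE mult_zero_left poly_mult)
  then have "poly A z = 0" using Qz by simp
  then obtain A' where A': "A = [:- z, 1:] * A'" using poly_eq_0_iff_dvd by (metis dvdE)
  have nz: "[:- z, 1:] \<noteq> 0" by simp
  have P'0: "P' \<noteq> 0" using Suc.prems(2) P' by auto
  have "degree P = degree [:- z, 1:] + degree P'" unfolding P' by (rule degree_mult_eq[OF nz P'0])
  then have dP': "k = degree P'" using Suc.hyps(2) by simp
  have cop: "coprime P' Q"
  proof (rule complex_coprimeI)
    fix w assume w: "poly P' w = 0" "poly Q w = 0"
    then have "poly P w = 0" unfolding P' by simp
    with coprime_no_common_root[OF Suc.prems(1)] w(2) show False by blast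
  qed
  have "[:- z, 1:] * P' dvd [:- z, 1:] * (A' * Q)" using Suc.prems(3) unfolding P' A' by (simp only: mult.assoc)
  then have "P' dvd A' * Q" using nz by (simp only: dvd_mult_cancel_left) simp
  from Suc.hyps(1)[OF dP' cop P'0 this] have "P' dvd A'" .
  then show ?case unfolding P' A' by (rule mult_dvd_mono[OF dvd_refl])
qed

text \<open>The pair \<open>(P, Q)\<close> is the reduced form of the fraction \<open>A / B\<close>, and the degree leaves no room for a nonconstant common factor.\<close>

lemma cross_multiple:
  fixes P Q A B :: "complex poly"
  assumes "coprime P Q" "A * Q = B * P" "degree A \<le> degree P" "degree Q < degree P"
  obtains t where "A = smult t P" "B = smult t Q"
proof -
  have P: "P \<noteq> 0" using assms(4) by auto
  have "P dvd A * Q" using assms(2) by simp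
  then have "P dvd A" by (rule coprime_dvd_mult_complex_poly[OF assms(1) P])
  then obtain T where T: "A = P * T" by (auto simp: dvd_def)
  have "degree T = 0 \<or> T = 0"
    using assms(3) P degree_mult_eq[of P T] unfolding T by auto
  then obtain t where "T = [:t:]" by (metis degree_eq_zeroE degree_0)
  then have A: "A = smult t P" by (simp add: T)
  then have "P * B = P * smult t Q" using assms(2) by (simp add: mult.commute)
  then have "B = smult t Q" using P by (metis mult_cancel_left)
  with A show ?thesis by (rule that)
qed

text \<open>Compactness of the unit sphere of coefficient pairs: the limit pair represents the same map as \<open>(P, Q)\<close> off the poles,
so it is a multiple of it.\<close>

lemma cconv_coeff_subseq:
  assumes cc: "cconv G (rat_map P Q)" and G: "\<And>n. G n = rat_map (p n) (q n)"
    and e: "\<And>n. nondeg (e n) (p n) (q n)" "\<And>n. e n \<le> d"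
    and n: "nondeg d P Q" and d: "degree Q < degree P"
  obtains r c t where "strict_mono (r :: nat \<Rightarrow> nat)" "\<And>n. c n \<noteq> 0" "t \<noteq> 0"
    "pconv (\<lambda>n. smult (c n) (p (r n))) (smult t P)" "pconv (\<lambda>n. smult (c n) (q (r n))) (smult t Q)"
proof -
  have dP: "degree P = d" using n d by (simp add: nondeg_iff)
  have deg: "degree (p n) \<le> d" "degree (q n) \<le> d" for n
    using nondeg_degree[OF e(1)[of n]] e(2)[of n] by auto
  \<comment> \<open>Scaling by the whole norm is safe, whereas a single coefficient might tend to \<open>0\<close> relative to the others.\<close>
  define N where "N n = coeff_norm d (p n) + coeff_norm d (q n)" for n
  have Npos: "N n > 0" for n
  proof -
    have "p n \<noteq> 0 \<or> q n \<noteq> 0" using nondeg_no_common_root[OF e(1)[of n], of 0] by auto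
    then have "coeff_norm d (p n) \<noteq> 0 \<or> coeff_norm d (q n) \<noteq> 0" using coeff_norm_eq_0_iff[OF deg(1)] coeff_norm_eq_0_iff[OF deg(2)] by blast
    then show ?thesis using coeff_norm_nonneg[of d "p n"] coeff_norm_nonneg[of d "q n"] by (auto simp: N_def)
  qed
  define c where "c n = complex_of_real (1 / N n)" for n
  have c0: "c n \<noteq> 0" for n using Npos[of n] by (simp add: c_def)
  have cN: "cmod (c n) = 1 / N n" for n
    unfolding c_def norm_of_real using Npos[of n] by simp
  define u where "u n i = smult (c n) (if i then p n else q n)" for n i
  have un: "coeff_norm d (u n True) + coeff_norm d (u n False) = 1" for n
    using Npos[of n] by (simp add: u_def coeff_norm_smult cN add_divide_distrib[symmetric] N_def[symmetric])
  have "\<exists>r U. strict_mono (r :: nat \<Rightarrow> nat) \<and> (\<forall>i\<in>(UNIV :: bool set). pconv (\<lambda>n. u (r n) i) (U i) \<and> degree (U i) \<le> d)"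
  proof (rule pconv_compact_family)
    show "degree (u n i) \<le> d" for n i using deg[of n] by (cases i) (simp_all add: u_def order.trans[OF degree_smult_le])
    show "coeff_norm d (u n i) \<le> 1" for n i
      using un[of n] coeff_norm_nonneg[of d "u n True"] coeff_norm_nonneg[of d "u n False"] by (cases i) auto
  qed simp
  then obtain r U where r: "strict_mono (r :: nat \<Rightarrow> nat)" and U: "\<And>i. pconv (\<lambda>n. u (r n) i) (U i)" "\<And>i. degree (U i) \<le> d"
    by auto
  have "(\<lambda>n. coeff_norm d (u (r n) True) + coeff_norm d (u (r n) False)) \<longlonglongrightarrow> coeff_norm d (U True) + coeff_norm d (U False)"
    by (intro tendsto_add pconv_coeff_norm U)
  then have U1: "coeff_norm d (U True) + coeff_norm d (U False) = 1"
    unfolding un using LIMSEQ_unique tendsto_const by metis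
  have Q0: "Q \<noteq> 0"
  proof
    assume "Q = 0"
    then have "is_unit P" using n by (simp add: nondeg_iff)
    moreover have "P \<noteq> 0" using d by auto
    ultimately have "degree P = 0" using is_unit_iff_degree by blast
    with d show False by simp
  qed
  have "poly (U True * Q) z = poly (U False * P) z" if z: "poly Q z \<noteq> 0" for z
  proof -
    note v = cconv_value[OF cconv_subseq[OF cc r] G tendsto_const z]
    have "(\<lambda>n. poly (p (r n)) z / poly (q (r n)) z * poly (u (r n) False) z) \<longlonglongrightarrow> poly P z / poly Q z * poly (U False) z"
      by (intro tendsto_mult v(2) pconv_poly[OF U(1)] tendsto_const)
    then have "(\<lambda>n. poly (u (r n) True) z) \<longlonglongrightarrow> poly P z / poly Q z * poly (U False) z"
      by (rule Lim_transform_eventually) (use v(1) in eventually_elim, simp add: u_def)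
    then have "poly (U True) z = poly P z / poly Q z * poly (U False) z"
      using LIMSEQ_unique pconv_poly[OF U(1) tendsto_const] by blast
    then show ?thesis using z by simp
  qed
  then have "{z. poly Q z \<noteq> 0} \<subseteq> {z. poly (U True * Q - U False * P) z = 0}" by auto
  moreover have "infinite {z. poly Q z \<noteq> 0}"
  proof
    assume "finite {z. poly Q z \<noteq> 0}"
    then have "finite ({z. poly Q z \<noteq> 0} \<union> {z. poly Q z = 0})" using poly_roots_finite[OF Q0] by simp
    moreover have "{z. poly Q z \<noteq> 0} \<union> {z. poly Q z = 0} = UNIV" by blast
    ultimately show False using infinite_UNIV_char_0[where 'a = complex] by simp
  qed
  ultimately have "infinite {z. poly (U True * Q - U False * P) z = 0}" using finite_subset by blast
  then have "U True * Q - U False * P = 0" using poly_roots_finite by blast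
  then have "U True * Q = U False * P" by simp
  from cross_multiple[OF _ this _ d] n U(2) dP obtain t where t: "U True = smult t P" "U False = smult t Q"
    by (auto simp: nondeg_iff)
  have "t \<noteq> 0" using U1 t by (auto simp: coeff_norm_def)
  moreover have "pconv (\<lambda>n. smult (c (r n)) (p (r n))) (smult t P)" "pconv (\<lambda>n. smult (c (r n)) (q (r n))) (smult t Q)"
    using U(1)[of True] U(1)[of False] by (simp_all add: u_def t)
  ultimately show ?thesis using that[OF r, of "\<lambda>n. c (r n)"] c0 by blast
qed

text \<open>From convergence of maps to convergence of polynomials, the step that makes everything that follows algebraic.
The hypothesis \<open>degree Q < degree P\<close> says that \<open>\<infinity>\<close> is fixed; it provides a nonzero coefficient to normalise by.\<close>

theorem cconv_imp_coeff_conv: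
  assumes cc: "cconv G (rat_map P Q)" and G: "\<forall>\<^sub>F n in sequentially. \<exists>e. rat_deg e (G n)"
    and n: "nondeg d P Q" and d: "degree Q < degree P"
  obtains p q where "pconv p P" "pconv q Q"
    "\<forall>\<^sub>F n in sequentially. nondeg d (p n) (q n) \<and> G n = rat_map (p n) (q n)"
proof -
  have dP: "degree P = d" using n d by (simp add: nondeg_iff)
  have Pd: "coeff P d \<noteq> 0" using d dP leading_coeff_0_iff[of P] by auto
  have "\<exists>e p q. (\<exists>e. rat_deg e (G n)) \<longrightarrow> nondeg e p q \<and> G n = rat_map p q" for n
    unfolding rat_deg_def by blast
  then obtain e p q where epq: "\<And>n. (\<exists>e. rat_deg e (G n)) \<Longrightarrow> nondeg (e n) (p n) (q n) \<and> G n = rat_map (p n) (q n)"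
    by metis
  from G obtain n0 where n0: "\<And>n. n \<ge> n0 \<Longrightarrow> \<exists>e. rat_deg e (G n)" unfolding eventually_sequentially by blast
  have sh: "strict_mono (\<lambda>n. n + n0)" by (simp add: strict_mono_def)
  have "\<forall>\<^sub>F n in sequentially. e (n + n0) \<le> d"
    by (rule cconv_degree_le[OF cconv_subseq[OF cc sh], of "\<lambda>n. p (n + n0)" "\<lambda>n. q (n + n0)"])
      (use epq n0 n d in auto)
  then obtain n1 where n1: "\<And>n. n \<ge> n1 \<Longrightarrow> e (n + n0) \<le> d" unfolding eventually_sequentially by blast
  have big: "nondeg (e n) (p n) (q n)" "G n = rat_map (p n) (q n)" "e n \<le> d" if "n \<ge> n0 + n1" for n
    using epq[OF n0[of n]] n1[of "n - n0"] that by auto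
  \<comment> \<open>This scaling fixes the coefficient of index \<open>d\<close> of the numerator. It does not depend on a subsequence, so all
    subsequential limits agree.\<close>
  define c where "c n = coeff P d / coeff (p n) d" for n
  have sub: "\<exists>s :: nat \<Rightarrow> nat. strict_mono s \<and> pconv (\<lambda>n. smult (c (r (s n))) (p (r (s n)))) P
     \<and> pconv (\<lambda>n. smult (c (r (s n))) (q (r (s n)))) Q" if r: "strict_mono r" for r :: "nat \<Rightarrow> nat"
  proof -
    define m where "m = n0 + n1"
    define \<rho> where "\<rho> n = r (n + m)" for n
    have \<rho>: "strict_mono \<rho>" using r by (simp add: \<rho>_def strict_mono_def)
    have ge: "\<rho> n \<ge> n0 + n1" for n
      using seq_suble[OF r, of "n + m"] by (simp add: \<rho>_def m_def)
    obtain s b t where s: "strict_mono (s :: nat \<Rightarrow> nat)" "\<And>n. b n \<noteq> 0" "t \<noteq> 0"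
      "pconv (\<lambda>n. smult (b n) (p (\<rho> (s n)))) (smult t P)"
      "pconv (\<lambda>n. smult (b n) (q (\<rho> (s n)))) (smult t Q)"
      using cconv_coeff_subseq[where G = "\<lambda>n. G (\<rho> n)" and p = "\<lambda>n. p (\<rho> n)" and q = "\<lambda>n. q (\<rho> n)"
          and e = "\<lambda>n. e (\<rho> n)", OF cconv_subseq[OF cc \<rho>] big(2)[OF ge] big(1)[OF ge] big(3)[OF ge] n d]
      by blast
    have tP: "coeff (smult t P) d \<noteq> 0" using Pd s(3) by simp
    have k0: "(\<lambda>n. coeff P d / coeff (smult (b n) (p (\<rho> (s n)))) d) \<longlonglongrightarrow> coeff P d / coeff (smult t P) d"
      by (rule tendsto_divide[OF tendsto_const pconvD[OF s(4)] tP])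
    have k1: "coeff P d / coeff (smult t P) d = 1 / t" using Pd s(3) by simp
    have eq: "smult (coeff P d / coeff (smult (b n) (p (\<rho> (s n)))) d) (smult (b n) f) = smult (c (\<rho> (s n))) f" for n f
      using s(2)[of n] by (simp add: c_def)
    have t1: "smult (1 / t) (smult t f) = f" for f using s(3) by simp
    have "pconv (\<lambda>n. smult (c (\<rho> (s n))) (p (\<rho> (s n)))) P" "pconv (\<lambda>n. smult (c (\<rho> (s n))) (q (\<rho> (s n)))) Q"
      using pconv_smult[OF k0 s(4)] pconv_smult[OF k0 s(5)] unfolding eq k1 t1 .
    moreover have "strict_mono (\<lambda>n. s n + m)" using s(1) by (simp add: strict_mono_def)
    ultimately show ?thesis unfolding \<rho>_def by (intro exI[of _ "\<lambda>n. s n + m"]) simp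
  qed
  have conv: "(\<lambda>n. coeff (smult (c n) (f n)) i) \<longlonglongrightarrow> coeff F i"
    if fF: "(f, F) = (p, P) \<or> (f, F) = (q, Q)" for f F i
  proof (rule ccontr)
    assume "\<not> ?thesis"
    then obtain \<epsilon> where \<epsilon>: "\<epsilon> > 0" "\<not> (\<forall>\<^sub>F n in sequentially. dist (coeff (smult (c n) (f n)) i) (coeff F i) < \<epsilon>)"
      unfolding tendsto_iff by blast
    from frequently_subseq[OF \<epsilon>(2)] obtain r :: "nat \<Rightarrow> nat" where r: "strict_mono r"
      "\<And>n. \<not> dist (coeff (smult (c (r n)) (f (r n))) i) (coeff F i) < \<epsilon>" by blast
    from sub[OF r(1)] obtain s :: "nat \<Rightarrow> nat" where "pconv (\<lambda>n. smult (c (r (s n))) (f (r (s n)))) F"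
      using fF by auto
    from tendstoD[OF pconvD[OF this, of i] \<epsilon>(1)] have "\<forall>\<^sub>F n in sequentially. False"
      by eventually_elim (use r(2) in blast)
    then show False by simp
  qed
  have "\<forall>\<^sub>F n in sequentially. coeff (smult (c n) (p n)) d \<noteq> 0"
    by (rule tendsto_imp_eventually_ne[OF conv Pd]) simp
  then have ev: "\<forall>\<^sub>F n in sequentially. nondeg d (smult (c n) (p n)) (smult (c n) (q n))
      \<and> G n = rat_map (smult (c n) (p n)) (smult (c n) (q n))"
    using eventually_ge_at_top[of "n0 + n1"]
  proof eventually_elim
    case (elim n)
    note b = big[OF elim(2)]
    have c: "c n \<noteq> 0" "coeff (p n) d \<noteq> 0" using elim(1) by auto
    have "e n = d" using b(3) nondeg_degree(1)[OF b(1)] le_degree[OF c(2)] by linarith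
    with b nondeg_smult[OF b(1) c(1)] show ?case by simp
  qed
  have "pconv (\<lambda>n. smult (c n) (p n)) P" "pconv (\<lambda>n. smult (c n) (q n)) Q"
  proof -
    have "\<forall>\<^sub>F n in sequentially. degree (smult (c n) (p n)) \<le> d"
      using ev by eventually_elim (blast dest: nondeg_degree(1))
    then show "pconv (\<lambda>n. smult (c n) (p n)) P" by (rule pconvI) (rule conv, simp)
    have "\<forall>\<^sub>F n in sequentially. degree (smult (c n) (q n)) \<le> d"
      using ev by eventually_elim (blast dest: nondeg_degree(2))
    then show "pconv (\<lambda>n. smult (c n) (q n)) Q" by (rule pconvI) (rule conv, simp)
  qed
  then show ?thesis using ev by (rule that)
qed

section \<open>Fibres over the critical values\<close>

lemma wronskian_shift: "wronskian (p - smult y q) q = wronskian p q"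
  by (simp add: wronskian_def pderiv_diff pderiv_smult algebra_simps)

text \<open>A preimage of multiplicity \<open>e\<close> is a zero of the Wronskian of order \<open>e - 1\<close>: subtracting a multiple of \<open>q\<close> from \<open>p\<close> does not
change the Wronskian.\<close>

lemma wronskian_order:
  assumes W: "wronskian p q \<noteq> 0" and a: "poly (p - smult y q) a = 0" "poly q a \<noteq> 0"
  shows "order a (p - smult y q) = Suc (order a (wronskian p q))"
proof -
  define R where "R = p - smult y q"
  have W_eq: "wronskian p q = pderiv R * q - R * pderiv q"
    unfolding R_def wronskian_shift[symmetric, of p q y] by (simp only: wronskian_def)
  have R: "R \<noteq> 0" "poly R a = 0" using W a(1) by (auto simp: W_eq R_def[symmetric])
  have R': "pderiv R \<noteq> 0"
  proof
    assume "pderiv R = 0"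
    then obtain c where "R = [:c:]" by (metis pderiv_eq_0_iff degree_eq_zeroE)
    with R show False by simp
  qed
  obtain k where k: "order a R = Suc k" "order a (pderiv R) = k" using order_pderiv[OF R] by blast
  have "q \<noteq> 0" using a(2) by auto
  then have R'q: "pderiv R * q \<noteq> 0" "order a (pderiv R * q) = k"
    using R' k(2) order_0I[OF a(2)] by (simp_all add: order_mult)
  have d1: "[:- a, 1:] ^ Suc k dvd R * pderiv q" using order_1[of a R] k(1) by (simp add: dvd_mult2)
  have "[:- a, 1:] ^ k dvd pderiv R * q" using R'q by (simp add: order_divides)
  moreover have "[:- a, 1:] ^ k dvd R * pderiv q" using d1 by (rule power_le_dvd) simp
  ultimately have "[:- a, 1:] ^ k dvd wronskian p q" unfolding W_eq by (rule dvd_diff)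
  then have ge: "k \<le> order a (wronskian p q)" using W by (simp add: order_divides)
  have "\<not> [:- a, 1:] ^ Suc k dvd wronskian p q"
  proof
    assume "[:- a, 1:] ^ Suc k dvd wronskian p q"
    from dvd_add[OF this d1] have "[:- a, 1:] ^ Suc k dvd pderiv R * q" by (simp add: W_eq)
    then show False using R'q by (simp only: order_divides) simp
  qed
  then have "order a (wronskian p q) \<le> k" using W by (simp only: order_divides) simp
  with ge k(1) show ?thesis by (simp add: R_def)
qed

lemma sum_order_eq_degree:
  fixes p :: "complex poly"
  assumes "p \<noteq> 0"
  shows "(\<Sum>a | poly p a = 0. order a p) = degree p"
proof -
  have "degree p = degree (smult (lead_coeff p) (\<Prod>z | poly p z = 0. [:- z, 1:] ^ order z p))"
    by (simp only: complex_poly_decompose)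
  also have "\<dots> = degree (\<Prod>z | poly p z = 0. [:- z, 1:] ^ order z p)" using assms by simp
  also have "\<dots> = (\<Sum>z | poly p z = 0. degree ([:- z, 1:] ^ order z p))"
    by (intro degree_prod_sum_eq) simp
  also have "\<dots> = (\<Sum>z | poly p z = 0. order z p)" by (simp add: degree_power_eq)
  finally show ?thesis ..
qed

text \<open>The finite preimages of \<open>y\<close> under \<open>p / q\<close>; for coprime \<open>p\<close> and \<open>q\<close> no root here is a common one.\<close>

definition fibre :: "complex poly \<Rightarrow> complex poly \<Rightarrow> complex \<Rightarrow> complex set" where
  "fibre p q y = {z. poly (p - smult y q) z = 0}"

lemma fibre_disjoint: "nondeg d p q \<Longrightarrow> z \<in> fibre p q x \<Longrightarrow> z \<in> fibre p q y \<Longrightarrow> x = y"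
  using nondeg_no_common_root[of d p q z] by (auto simp: fibre_def)

lemma fibre_denominator: "nondeg d p q \<Longrightarrow> z \<in> fibre p q x \<Longrightarrow> poly q z \<noteq> 0"
  using nondeg_no_common_root[of d p q z] by (auto simp: fibre_def)

text \<open>The multiplicities over each point of \<open>Y\<close> add up to \<open>d\<close>, and a multiplicity exceeds \<open>1\<close> by the order of the
Wronskian. Applied to a set of values that contains all critical ones, this determines the number of preimages.\<close>

lemma riemann_hurwitz_count:
  assumes n: "nondeg d p q" and W: "wronskian p q \<noteq> 0" and Y: "finite Y"
    and deg: "\<And>y. y \<in> Y \<Longrightarrow> degree (p - smult y q) = d" and d: "d \<ge> 1"
  defines "A \<equiv> \<Union>y\<in>Y. fibre p q y"
  shows "finite A" "card A + (\<Sum>a\<in>A. order a (wronskian p q)) = card Y * d"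
proof -
  have nz: "p - smult y q \<noteq> 0" if "y \<in> Y" for y using deg[OF that] d by auto
  have fin: "finite (fibre p q y)" if "y \<in> Y" for y unfolding fibre_def by (rule poly_roots_finite[OF nz[OF that]])
  show "finite A" unfolding A_def using Y fin by blast
  have "card A + (\<Sum>a\<in>A. order a (wronskian p q)) = (\<Sum>a\<in>A. Suc (order a (wronskian p q)))"
    by (simp add: sum_Suc)
  also have "\<dots> = (\<Sum>y\<in>Y. \<Sum>a\<in>fibre p q y. Suc (order a (wronskian p q)))"
    unfolding A_def using Y fin fibre_disjoint[OF n] by (intro sum.UNION_disjoint) blast+
  also have "\<dots> = (\<Sum>y\<in>Y. d)"
  proof (rule sum.cong[OF refl])
    fix y assume y: "y \<in> Y"
    have "(\<Sum>a\<in>fibre p q y. Suc (order a (wronskian p q))) = (\<Sum>a\<in>fibre p q y. order a (p - smult y q))"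
    proof (rule sum.cong[OF refl])
      fix a assume a: "a \<in> fibre p q y"
      then have "poly (p - smult y q) a = 0" unfolding fibre_def by blast
      from wronskian_order[OF W this fibre_denominator[OF n a]]
      show "Suc (order a (wronskian p q)) = order a (p - smult y q)" ..
    qed
    also have "\<dots> = d" unfolding fibre_def sum_order_eq_degree[OF nz[OF y]] by (rule deg[OF y])
    finally show "(\<Sum>a\<in>fibre p q y. Suc (order a (wronskian p q))) = d" .
  qed
  finally show "card A + (\<Sum>a\<in>A. order a (wronskian p q)) = card Y * d" by simp
qed

lemma sum_order_subset_le:
  fixes W :: "complex poly"
  assumes "W \<noteq> 0" "finite A"
  shows "(\<Sum>a\<in>A. order a W) \<le> degree W"
proof -
  have "(\<Sum>a\<in>A. order a W) = (\<Sum>a\<in>A \<inter> {a. poly W a = 0}. order a W)"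
    using assms(2) by (intro sum.mono_neutral_right) (auto simp: order_0I)
  also have "\<dots> \<le> (\<Sum>a | poly W a = 0. order a W)"
    by (intro sum_mono2 poly_roots_finite assms) auto
  finally show ?thesis using sum_order_eq_degree[OF assms(1)] by simp
qed

lemma sum_order_superset_eq:
  fixes W :: "complex poly"
  assumes "W \<noteq> 0" "finite A" "{a. poly W a = 0} \<subseteq> A"
  shows "(\<Sum>a\<in>A. order a W) = degree W"
proof -
  have "(\<Sum>a\<in>A. order a W) = (\<Sum>a | poly W a = 0. order a W)"
    using assms by (intro sum.mono_neutral_right) (auto simp: order_0I)
  then show ?thesis using sum_order_eq_degree[OF assms(1)] by simp
qed

lemma degree_fibre_poly:
  fixes P Q :: "complex poly"
  assumes "degree P = d" "degree Q < degree P"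
  shows "degree (P - smult y Q) = d"
proof -
  have "degree (smult y Q) < degree P" using assms(2) degree_smult_le[of y Q] by linarith
  then have "degree (P - smult y Q) = degree P"
    using degree_add_eq_left[of "- smult y Q" P] by simp
  then show ?thesis using assms(1) by simp
qed

lemma eventually_inj:
  assumes "finite B" "\<And>b. b \<in> B \<Longrightarrow> (\<lambda>n. f n b) \<longlonglongrightarrow> b"
  shows "\<forall>\<^sub>F n in sequentially. inj_on (f n) (B :: 'a::real_normed_vector set)"
proof -
  have "\<forall>\<^sub>F n in sequentially. \<forall>b\<in>B. \<forall>c\<in>B. b \<noteq> c \<longrightarrow> f n b \<noteq> f n c"
  proof (intro eventually_ball_finite[OF assms(1)] ballI)
    fix b c assume bc: "b \<in> B" "c \<in> B"
    show "\<forall>\<^sub>F n in sequentially. b \<noteq> c \<longrightarrow> f n b \<noteq> f n c"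
    proof (cases "b = c")
      case False
      have "(\<lambda>n. f n b - f n c) \<longlonglongrightarrow> b - c" by (intro tendsto_diff assms bc)
      then have "\<forall>\<^sub>F n in sequentially. f n b - f n c \<noteq> 0" by (rule tendsto_imp_eventually_ne) (use False in simp)
      then show ?thesis by eventually_elim simp
    qed simp
  qed
  then show ?thesis by eventually_elim (auto simp: inj_on_def)
qed

text \<open>A sequence of maps \<open>p n / q n\<close> converging to \<open>P / Q\<close>, where \<open>P / Q\<close> fixes \<open>\<infinity>\<close> and all finite critical points lie over
\<open>X\<close>, respectively over the moved set \<open>\<phi> n ` X\<close>.\<close>

locale fibre_family =
  fixes d :: nat and P Q :: "complex poly" and X :: "complex set" and \<phi> :: "nat \<Rightarrow> complex \<Rightarrow> complex"
    and p q :: "nat \<Rightarrow> complex poly"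
  assumes nd: "nondeg d P Q" and dQ: "degree Q < degree P" and finX: "finite X"
    and crit: "\<And>z. poly (wronskian P Q) z = 0 \<Longrightarrow> \<exists>x\<in>X. z \<in> fibre P Q x"
    and \<phi>: "\<And>x. x \<in> X \<Longrightarrow> (\<lambda>n. \<phi> n x) \<longlonglongrightarrow> x"
    and p: "pconv p P" and q: "pconv q Q"
    and ndn: "\<forall>\<^sub>F n in sequentially. nondeg d (p n) (q n)"
    and critn: "\<forall>\<^sub>F n in sequentially. \<forall>z. poly (wronskian (p n) (q n)) z = 0 \<longrightarrow> (\<exists>x\<in>X. z \<in> fibre (p n) (q n) (\<phi> n x))"
begin

definition "A = (\<Union>x\<in>X. fibre P Q x)"
abbreviation "R x \<equiv> P - smult x Q"
abbreviation "Rn n x \<equiv> p n - smult (\<phi> n x) (q n)"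

lemma dP: "degree P = d" using nd dQ by (simp add: nondeg_iff)
lemma d1: "d \<ge> 1" using dP dQ by simp
lemma degR: "degree (R x) = d" by (rule degree_fibre_poly[OF dP dQ])
lemma R0: "R x \<noteq> 0" using degR[of x] d1 by auto
lemma W0: "wronskian P Q \<noteq> 0" using nd dQ by (intro wronskian_nonzero) (simp_all add: nondeg_iff)
lemma Rn: "x \<in> X \<Longrightarrow> pconv (\<lambda>n. Rn n x) (R x)" by (intro pconv_diff pconv_smult p q \<phi>)
lemma finA: "finite A" and countA: "card A + (\<Sum>a\<in>A. order a (wronskian P Q)) = card X * d"
  unfolding A_def using riemann_hurwitz_count[OF nd W0 finX degR d1] by auto
lemma sumA: "(\<Sum>a\<in>A. order a (wronskian P Q)) = degree (wronskian P Q)"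
  by (rule sum_order_superset_eq[OF W0 finA]) (use crit A_def in blast)
lemma fin_fibre: "finite (fibre P Q x)" unfolding fibre_def by (rule poly_roots_finite[OF R0])
lemma order_fibre:
  assumes "a \<in> fibre P Q x"
  shows "order a (R x) = Suc (order a (wronskian P Q))"
proof -
  have "poly (R x) a = 0" using assms unfolding fibre_def by blast
  from wronskian_order[OF W0 this fibre_denominator[OF nd assms]] show ?thesis .
qed

text \<open>The preimages of \<open>X\<close> move continuously and keep their multiplicities. Each persists by Hurwitz's theorem, and
Riemann-Hurwitz shows that there are no others: \<open>|\<phi>\<^sub>n(X)| d - deg W\<^sub>n \<le> |X| d - deg W\<close>, as the degree of the Wronskian
cannot grow in the limit.\<close>

theorem fibre_structure:
  obtains \<alpha> where "\<And>a. a \<in> A \<Longrightarrow> (\<lambda>n. \<alpha> n a) \<longlonglongrightarrow> a"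
    "\<forall>\<^sub>F n in sequentially. inj_on (\<alpha> n) A"
    "\<forall>\<^sub>F n in sequentially. \<forall>x\<in>X. Rn n x
       = smult (lead_coeff (Rn n x)) (\<Prod>a\<in>fibre P Q x. [:- \<alpha> n a, 1:] ^ Suc (order a (wronskian P Q)))"
proof -
  define val where "val a = poly P a / poly Q a" for a
  have val: "val a = x" if "a \<in> fibre P Q x" for a x
    using fibre_denominator[OF nd that] that by (simp add: val_def fibre_def)
  have "\<exists>\<alpha>. \<alpha> \<longlonglongrightarrow> a \<and> (\<forall>\<^sub>F n in sequentially. poly (Rn n (val a)) (\<alpha> n) = 0)" if a: "a \<in> A" for a
  proof -
    obtain x where x: "x \<in> X" "a \<in> fibre P Q x" using a by (auto simp: A_def)
    have "poly (R x) a = 0" using x(2) by (simp add: fibre_def)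
    from pconv_root[OF Rn[OF x(1)] R0 this] show ?thesis unfolding val[OF x(2)] by blast
  qed
  then obtain \<alpha>' where \<alpha>': "\<And>a. a \<in> A \<Longrightarrow> \<alpha>' a \<longlonglongrightarrow> a"
    "\<And>a. a \<in> A \<Longrightarrow> \<forall>\<^sub>F n in sequentially. poly (Rn n (val a)) (\<alpha>' a n) = 0" by metis
  define \<alpha> where "\<alpha> n a = \<alpha>' a n" for n a
  have lim: "(\<lambda>n. \<alpha> n a) \<longlonglongrightarrow> a" if "a \<in> A" for a using \<alpha>'(1)[OF that] by (simp add: \<alpha>_def)
  have root: "\<forall>\<^sub>F n in sequentially. \<forall>a\<in>A. poly (Rn n (val a)) (\<alpha> n a) = 0"
    using \<alpha>'(2) by (intro eventually_ball_finite[OF finA] ballI) (simp add: \<alpha>_def)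
  have inj: "\<forall>\<^sub>F n in sequentially. inj_on (\<alpha> n) A" by (rule eventually_inj[OF finA lim])
  have inj\<phi>: "\<forall>\<^sub>F n in sequentially. inj_on (\<phi> n) X" by (rule eventually_inj[OF finX \<phi>])
  have degRn: "\<forall>\<^sub>F n in sequentially. \<forall>x\<in>X. degree (Rn n x) = d"
  proof (intro eventually_ball_finite[OF finX] ballI)
    fix x assume x: "x \<in> X"
    have "coeff (R x) d \<noteq> 0" using degR[of x] R0[of x] leading_coeff_0_iff by metis
    from tendsto_imp_eventually_ne[OF pconvD[OF Rn[OF x]] this] ndn
    show "\<forall>\<^sub>F n in sequentially. degree (Rn n x) = d"
    proof eventually_elim
      case (elim n)
      have "degree (Rn n x) \<le> d"
        using nondeg_degree[OF elim(2)] by (intro degree_diff_le) (auto intro: order.trans[OF degree_smult_le])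
      with le_degree[OF elim(1)] show ?case by simp
    qed
  qed
  have degW: "\<forall>\<^sub>F n in sequentially. degree (wronskian (p n) (q n)) \<ge> degree (wronskian P Q) \<and> wronskian (p n) (q n) \<noteq> 0"
  proof -
    have "coeff (wronskian P Q) (degree (wronskian P Q)) \<noteq> 0" using W0 by simp
    from tendsto_imp_eventually_ne[OF pconvD[OF pconv_wronskian[OF p q]] this]
    show ?thesis by eventually_elim (auto intro: le_degree)
  qed
  \<comment> \<open>The \<open>\<alpha> n a\<close> are \<open>card A\<close> distinct points over \<open>\<phi> n ` X\<close>, and by the count there are no more.\<close>
  have roots: "\<forall>\<^sub>F n in sequentially. \<forall>x\<in>X. fibre (p n) (q n) (\<phi> n x) = \<alpha> n ` fibre P Q x"
    using root inj inj\<phi> degRn degW ndn critn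
  proof eventually_elim
    case (elim n)
    note nn = elim(6)
    define An where "An = (\<Union>y\<in>\<phi> n ` X. fibre (p n) (q n) y)"
    have rh: "finite An" "card An + (\<Sum>a\<in>An. order a (wronskian (p n) (q n))) = card (\<phi> n ` X) * d"
      unfolding An_def
      using riemann_hurwitz_count[OF nn conjunct2[OF elim(5)] finite_imageI[OF finX], of "\<phi> n"] elim(4) d1 by fast+
    have "(\<Sum>a\<in>An. order a (wronskian (p n) (q n))) = degree (wronskian (p n) (q n))"
      by (rule sum_order_superset_eq) (use elim(5,7) rh(1) An_def in blast)+
    then have card: "card An \<le> card A"
      using rh(2) countA sumA elim(5) card_image[OF elim(3)] by simp
    have sub: "\<alpha> n a \<in> fibre (p n) (q n) (\<phi> n x)" if "a \<in> fibre P Q x" "x \<in> X" for a x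
      using elim(1) that val[OF that(1)] unfolding A_def fibre_def by fastforce
    then have "\<alpha> n ` A \<subseteq> An" unfolding An_def A_def by blast
    then have An: "\<alpha> n ` A = An"
      using card card_image[OF elim(2)] card_mono[OF rh(1), of "\<alpha> n ` A"]
      by (intro card_subset_eq[OF rh(1)]) simp_all
    show ?case
    proof (intro ballI equalityI subsetI)
      fix x r assume x: "x \<in> X" and r: "r \<in> fibre (p n) (q n) (\<phi> n x)"
      then have "r \<in> An" unfolding An_def by blast
      then obtain a x' where a: "r = \<alpha> n a" "a \<in> fibre P Q x'" "x' \<in> X" unfolding An[symmetric] A_def by blast
      have "\<phi> n x = \<phi> n x'" using fibre_disjoint[OF nn r] sub[OF a(2,3)] a(1) by blast
      then have "x = x'" using elim(3) x a(3) by (auto dest: inj_onD)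
      then show "r \<in> \<alpha> n ` fibre P Q x" using a by blast
    next
      fix x r assume "x \<in> X" "r \<in> \<alpha> n ` fibre P Q x"
      then show "r \<in> fibre (p n) (q n) (\<phi> n x)" using sub by blast
    qed
  qed
  \<comment> \<open>Multiplicities can only go up in the limit; as they add up to \<open>d\<close> on both sides, they are equal.\<close>
  have ordle: "\<forall>\<^sub>F n in sequentially. \<forall>x\<in>X. \<forall>a\<in>fibre P Q x. order (\<alpha> n a) (Rn n x) \<le> order a (R x)"
  proof (intro eventually_ball_finite[OF finX] eventually_ball_finite[OF fin_fibre] ballI)
    fix x a assume x: "x \<in> X" and a: "a \<in> fibre P Q x"
    have "a \<in> A" using x a by (auto simp: A_def)
    have "\<not> [:- a, 1:] ^ Suc (order a (R x)) dvd R x" by (rule order_2[OF R0])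
    then have "\<not> (\<exists>\<^sub>F n in sequentially. [:- \<alpha> n a, 1:] ^ Suc (order a (R x)) dvd Rn n x)"
      using pconv_linear_power_dvd[OF Rn[OF x] lim[OF \<open>a \<in> A\<close>]] by blast
    then have "\<forall>\<^sub>F n in sequentially. \<not> [:- \<alpha> n a, 1:] ^ Suc (order a (R x)) dvd Rn n x"
      by (simp add: not_frequently)
    then show "\<forall>\<^sub>F n in sequentially. order (\<alpha> n a) (Rn n x) \<le> order a (R x)"
      by eventually_elim (simp only: order_divides, simp)
  qed
  have fact: "\<forall>\<^sub>F n in sequentially. \<forall>x\<in>X. Rn n x
       = smult (lead_coeff (Rn n x)) (\<Prod>a\<in>fibre P Q x. [:- \<alpha> n a, 1:] ^ Suc (order a (wronskian P Q)))"
    using roots ordle degRn inj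
  proof eventually_elim
    case (elim n)
    show ?case
    proof
      fix x assume x: "x \<in> X"
      have sub: "fibre P Q x \<subseteq> A" using x by (auto simp: A_def)
      have injx: "inj_on (\<alpha> n) (fibre P Q x)" using elim(4) sub by (rule inj_on_subset)
      have nz: "Rn n x \<noteq> 0" using elim(3) x d1 by force
      have eq: "{r. poly (Rn n x) r = 0} = \<alpha> n ` fibre P Q x" using elim(1) x by (simp add: fibre_def)
      have "(\<Sum>a\<in>fibre P Q x. order (\<alpha> n a) (Rn n x)) = (\<Sum>r\<in>\<alpha> n ` fibre P Q x. order r (Rn n x))"
        by (simp add: sum.reindex[OF injx])
      also have "\<dots> = d" unfolding eq[symmetric] sum_order_eq_degree[OF nz] using elim(3) x by blast
      also have "\<dots> = (\<Sum>a\<in>fibre P Q x. order a (R x))"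
        unfolding fibre_def sum_order_eq_degree[OF R0] degR by (rule refl)
      finally have sums: "(\<Sum>a\<in>fibre P Q x. order (\<alpha> n a) (Rn n x)) = (\<Sum>a\<in>fibre P Q x. order a (R x))" .
      have ord: "order (\<alpha> n a) (Rn n x) = Suc (order a (wronskian P Q))" if a: "a \<in> fibre P Q x" for a
      proof -
        have "order (\<alpha> n a) (Rn n x) = order a (R x)"
          by (rule sum_mono_inv[OF sums _ a fin_fibre]) (use elim(2) x in blast)
        then show ?thesis by (simp only: order_fibre[OF a])
      qed
      have "Rn n x = smult (lead_coeff (Rn n x)) (\<Prod>r | poly (Rn n x) r = 0. [:- r, 1:] ^ order r (Rn n x))"
        by (rule complex_poly_decompose[symmetric])
      also have "(\<Prod>r | poly (Rn n x) r = 0. [:- r, 1:] ^ order r (Rn n x))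
         = (\<Prod>a\<in>fibre P Q x. [:- \<alpha> n a, 1:] ^ order (\<alpha> n a) (Rn n x))"
        unfolding eq by (simp add: prod.reindex[OF injx])
      also have "\<dots> = (\<Prod>a\<in>fibre P Q x. [:- \<alpha> n a, 1:] ^ Suc (order a (wronskian P Q)))"
        by (rule prod.cong[OF refl]) (simp only: ord)
      finally show "Rn n x
         = smult (lead_coeff (Rn n x)) (\<Prod>a\<in>fibre P Q x. [:- \<alpha> n a, 1:] ^ Suc (order a (wronskian P Q)))" .
    qed
  qed
  show ?thesis by (rule that[OF lim inj fact])
qed

text \<open>All other roots over the same value stay away from \<open>a\<close>.\<close>

lemma fibre_root_unique:
  assumes \<alpha>: "\<And>a. a \<in> A \<Longrightarrow> (\<lambda>n. \<alpha> n a) \<longlonglongrightarrow> a"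
    and fact: "\<forall>\<^sub>F n in sequentially. \<forall>x\<in>X. Rn n x
       = smult (lead_coeff (Rn n x)) (\<Prod>a\<in>fibre P Q x. [:- \<alpha> n a, 1:] ^ Suc (order a (wronskian P Q)))"
    and x: "x \<in> X" "a \<in> fibre P Q x"
    and z: "z \<longlonglongrightarrow> a" "\<forall>\<^sub>F n in sequentially. poly (Rn n x) (z n) = 0"
  shows "\<forall>\<^sub>F n in sequentially. z n = \<alpha> n a"
proof -
  have far: "\<forall>\<^sub>F n in sequentially. \<forall>b\<in>fibre P Q x. b \<noteq> a \<longrightarrow> z n \<noteq> \<alpha> n b"
  proof (intro eventually_ball_finite[OF fin_fibre] ballI)
    fix b assume b: "b \<in> fibre P Q x"
    then have bA: "b \<in> A" using x(1) by (auto simp: A_def)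
    show "\<forall>\<^sub>F n in sequentially. b \<noteq> a \<longrightarrow> z n \<noteq> \<alpha> n b"
    proof (cases "b = a")
      case False
      have "(\<lambda>n. z n - \<alpha> n b) \<longlonglongrightarrow> a - b" by (intro tendsto_diff z \<alpha> bA)
      then have "\<forall>\<^sub>F n in sequentially. z n - \<alpha> n b \<noteq> 0" by (rule tendsto_imp_eventually_ne) (use False in simp)
      then show ?thesis by eventually_elim simp
    qed simp
  qed
  have nz: "\<forall>\<^sub>F n in sequentially. coeff (Rn n x) d \<noteq> 0"
    by (rule tendsto_imp_eventually_ne[OF pconvD[OF Rn[OF x(1)]]]) (use degR[of x] R0[of x] leading_coeff_0_iff in metis)
  show ?thesis using far fact nz z(2)
  proof eventually_elim
    case (elim n)
    let ?\<Pi> = "\<Prod>a\<in>fibre P Q x. [:- \<alpha> n a, 1:] ^ Suc (order a (wronskian P Q))"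
    have "Rn n x = smult (lead_coeff (Rn n x)) ?\<Pi>" using elim(2) x(1) by blast
    then have "poly (smult (lead_coeff (Rn n x)) ?\<Pi>) (z n) = 0" using elim(4) by metis
    moreover have "lead_coeff (Rn n x) \<noteq> 0" using elim(3) by (metis coeff_0 leading_coeff_0_iff)
    ultimately have "poly ?\<Pi> (z n) = 0" by (simp only: poly_smult mult_eq_0_iff) simp
    then obtain b where b: "b \<in> fibre P Q x" "z n = \<alpha> n b"
      using fin_fibre by (auto simp: poly_prod prod_zero_iff poly_power)
    with elim(1) have "b = a" by metis
    with b show ?case by simp
  qed
qed

end

section \<open>Maps with the same branching\<close>

lemma pconv_linear_power_dvd_all:
  assumes "pconv p P" "a \<longlonglongrightarrow> A" "\<And>n. [:- a n, 1:] ^ k dvd p n"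
  shows "[:- A, 1:] ^ k dvd P"
  using assms(3)
  by (intro pconv_linear_power_dvd[OF assms(1,2)] eventually_frequently always_eventually allI) simp_all

text \<open>If a root of multiplicity \<open>k + 1\<close> sits at \<open>\<alpha> n\<close> for one polynomial and at \<open>\<beta> n\<close> for the other, then the
normalised differences lose at most one order of vanishing in the limit. This is the derivative of a moving root:
\<open>(z - \<alpha>) ^ (k + 1) - (z - \<beta>) ^ (k + 1)\<close> is \<open>\<beta> - \<alpha>\<close> times a polynomial that tends to \<open>(k + 1) (z - a) ^ k\<close>.\<close>

lemma first_order_divisibility:
  fixes A B :: "nat \<Rightarrow> complex poly"
  assumes T: "\<And>n. T n = [:- \<alpha> n, 1:] ^ Suc k * A n - [:- \<beta> n, 1:] ^ Suc k * B n"
    and \<alpha>: "\<alpha> \<longlonglongrightarrow> a" and \<beta>: "\<beta> \<longlonglongrightarrow> a" and A: "pconv A C" and B: "pconv B C" and C: "poly C a \<noteq> 0"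
    and c: "\<And>n. c n > 0" and U: "pconv (\<lambda>n. smult (of_real (1 / c n)) (T n)) U"
  shows "[:- a, 1:] ^ k dvd U"
proof -
  \<comment> \<open>Either of \<open>c n\<close> and \<open>\<beta> n - \<alpha> n\<close> may be the dominant one. After division by the larger, the pair of ratios \<open>v n\<close> is bounded
    and bounded away from the origin.\<close>
  define m where "m n = max (c n) (cmod (\<beta> n - \<alpha> n))" for n
  have m: "m n > 0" for n using c[of n] by (simp add: m_def)
  define v where "v n = (complex_of_real (c n / m n), (\<beta> n - \<alpha> n) / of_real (m n))" for n
  have v1: "cmod (fst (v n)) \<le> 1" "cmod (snd (v n)) \<le> 1" "cmod (fst (v n)) = 1 \<or> cmod (snd (v n)) = 1" for n
  proof -
    have f: "cmod (fst (v n)) = c n / m n" unfolding v_def fst_conv norm_of_real using c[of n] m[of n] by simp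
    have s: "cmod (snd (v n)) = cmod (\<beta> n - \<alpha> n) / m n" unfolding v_def snd_conv norm_divide norm_of_real using m[of n] by simp
    show "cmod (fst (v n)) \<le> 1" "cmod (snd (v n)) \<le> 1" unfolding f s using m[of n] by (simp_all add: m_def)
    show "cmod (fst (v n)) = 1 \<or> cmod (snd (v n)) = 1"
      unfolding f s using m[of n] by (auto simp: m_def max_def)
  qed
  have "bounded (range v)"
  proof -
    have "norm (v n) \<le> 2" for n
      using norm_Pair_le[of "fst (v n)" "snd (v n)"] v1(1,2)[of n] by simp
    then show ?thesis by (auto simp: bounded_iff)
  qed
  then obtain l r where r: "strict_mono (r :: nat \<Rightarrow> nat)" and l: "(v \<circ> r) \<longlonglongrightarrow> l"
    using bounded_imp_convergent_subsequence by blast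
  define \<kappa> \<mu> where "\<kappa> = fst l" and "\<mu> = snd l"
  have \<kappa>: "(\<lambda>n. fst (v (r n))) \<longlonglongrightarrow> \<kappa>" and \<mu>: "(\<lambda>n. snd (v (r n))) \<longlonglongrightarrow> \<mu>"
    using tendsto_fst[OF l] tendsto_snd[OF l] by (simp_all add: \<kappa>_def \<mu>_def o_def)
  have nz: "\<kappa> \<noteq> 0 \<or> \<mu> \<noteq> 0"
  proof -
    have "(\<lambda>n. (cmod (fst (v (r n))) - 1) * (cmod (snd (v (r n))) - 1)) \<longlonglongrightarrow> (cmod \<kappa> - 1) * (cmod \<mu> - 1)"
      by (intro tendsto_intros \<kappa> \<mu>)
    moreover have "(cmod (fst (v (r n))) - 1) * (cmod (snd (v (r n))) - 1) = 0" for n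
      using v1(3)[of "r n"] by auto
    ultimately have "(\<lambda>n::nat. 0) \<longlonglongrightarrow> (cmod \<kappa> - 1) * (cmod \<mu> - 1)" by (simp only:)
    from LIMSEQ_unique[OF this tendsto_const] have "(cmod \<kappa> - 1) * (cmod \<mu> - 1) = 0" .
    then show ?thesis by auto
  qed
  let ?x = "\<lambda>n. [:- \<alpha> (r n), 1:]" and ?y = "\<lambda>n. [:- \<beta> (r n), 1:]"
  let ?S = "\<lambda>n. \<Sum>i<Suc k. ?y n ^ (Suc k - Suc i) * ?x n ^ i"
  have \<alpha>r: "(\<lambda>n. \<alpha> (r n)) \<longlonglongrightarrow> a" and \<beta>r: "(\<lambda>n. \<beta> (r n)) \<longlonglongrightarrow> a"
    using LIMSEQ_subseq_LIMSEQ[OF \<alpha> r] LIMSEQ_subseq_LIMSEQ[OF \<beta> r] by (simp_all add: o_def)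
  have pconv_sum: "pconv (\<lambda>n. \<Sum>i\<in>I. f n i) (\<Sum>i\<in>I. F i)" if "\<And>i. i \<in> I \<Longrightarrow> pconv (\<lambda>n. f n i) (F i)"
    for I :: "nat set" and f F
    using that by (induction I rule: infinite_finite_induct) (simp_all add: pconv_const pconv_add)
  have S: "pconv ?S (\<Sum>i<Suc k. [:- a, 1:] ^ (Suc k - Suc i) * [:- a, 1:] ^ i)"
    by (intro pconv_sum pconv_mult pconv_power pconv_linear \<alpha>r \<beta>r)
  have S_eq: "(\<Sum>i<Suc k. [:- a, 1:] ^ (Suc k - Suc i) * [:- a, 1:] ^ i) = smult (of_nat (Suc k)) ([:- a, 1:] ^ k)"
  proof -
    have "(\<Sum>i<Suc k. [:- a, 1:] ^ (Suc k - Suc i) * [:- a, 1:] ^ i) = (\<Sum>i<Suc k. [:- a, 1:] ^ k)"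
      by (intro sum.cong refl) (simp flip: power_add)
    also have "\<dots> = smult (of_nat (Suc k)) ([:- a, 1:] ^ k)"
      by (simp add: of_nat_poly smult_add_left)
    finally show ?thesis .
  qed
  have smult_pull: "smult c t - b * smult c z = smult c (t - b * z)" for c :: complex and t b z
    by (simp add: smult_diff_right)
  \<comment> \<open>The limit of \<open>(T - B ((z - \<alpha>) ^ (k + 1) - (z - \<beta>) ^ (k + 1))) / m\<close>, whose numerator is \<open>(z - \<alpha>) ^ (k + 1) (A - B)\<close>.\<close>
  define L where "L = smult \<kappa> U - C * smult \<mu> (smult (of_nat (Suc k)) ([:- a, 1:] ^ k))"
  have "pconv (\<lambda>n. smult (fst (v (r n))) (smult (of_real (1 / c (r n))) (T (r n))) - B (r n) * smult (snd (v (r n))) (?S n)) L"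
    unfolding L_def S_eq[symmetric]
    by (intro pconv_diff pconv_smult pconv_mult \<kappa> \<mu> S pconv_subseq[OF U r] pconv_subseq[OF B r])
  moreover have "?x n ^ Suc k dvd smult (fst (v (r n))) (smult (of_real (1 / c (r n))) (T (r n))) - B (r n) * smult (snd (v (r n))) (?S n)" for n
  proof -
    have "?x n ^ Suc k - ?y n ^ Suc k = (?x n - ?y n) * ?S n" by (rule power_diff_sumr2)
    also have "?x n - ?y n = [:\<beta> (r n) - \<alpha> (r n):]" by simp
    finally have d: "smult (\<beta> (r n) - \<alpha> (r n)) (?S n) = ?x n ^ Suc k - ?y n ^ Suc k" by simp
    have 1: "smult (fst (v (r n))) (smult (of_real (1 / c (r n))) (T (r n))) = smult (1 / of_real (m (r n))) (T (r n))"
      using c[of "r n"] by (simp add: v_def)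
    have 2: "smult (snd (v (r n))) (?S n) = smult (1 / of_real (m (r n))) (?x n ^ Suc k - ?y n ^ Suc k)"
      unfolding d[symmetric] by (simp add: v_def)
    have "smult (fst (v (r n))) (smult (of_real (1 / c (r n))) (T (r n))) - B (r n) * smult (snd (v (r n))) (?S n)
       = smult (1 / of_real (m (r n))) (T (r n) - B (r n) * (?x n ^ Suc k - ?y n ^ Suc k))"
      unfolding 1 2 by (rule smult_pull)
    also have "T (r n) - B (r n) * (?x n ^ Suc k - ?y n ^ Suc k) = ?x n ^ Suc k * (A (r n) - B (r n))"
      unfolding T by (simp only: algebra_simps)
    finally show ?thesis by (simp add: dvd_smult)
  qed
  ultimately have dvdL: "[:- a, 1:] ^ Suc k dvd L"
    by (rule pconv_linear_power_dvd_all[OF _ \<alpha>r])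
  \<comment> \<open>Otherwise \<open>L\<close> would be a multiple of \<open>C (z - a) ^ k\<close>, which vanishes at \<open>a\<close> only to order \<open>k\<close>.\<close>
  have "\<kappa> \<noteq> 0"
  proof
    assume \<kappa>0: "\<kappa> = 0"
    then have \<mu>0: "\<mu> \<noteq> 0" using nz by simp
    have "L = smult (- (\<mu> * of_nat (Suc k))) (C * [:- a, 1:] ^ k)" unfolding L_def \<kappa>0 by (simp del: of_nat_Suc)
    moreover have "- (\<mu> * of_nat (Suc k)) \<noteq> 0" using \<mu>0 by (simp del: of_nat_Suc)
    ultimately have "[:- a, 1:] ^ Suc k dvd C * [:- a, 1:] ^ k" using dvdL dvd_smult_iff by metis
    then have "[:- a, 1:] * [:- a, 1:] ^ k dvd C * [:- a, 1:] ^ k" by simp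
    then have "[:- a, 1:] dvd C" by (subst (asm) dvd_mult_cancel_right) simp
    then show False using C by (simp add: poly_eq_0_iff_dvd)
  qed
  have "[:- a, 1:] ^ k dvd L" using dvdL by (rule power_le_dvd) simp
  moreover have "[:- a, 1:] ^ k dvd C * smult \<mu> (smult (of_nat (Suc k)) ([:- a, 1:] ^ k))"
    by (intro dvd_mult dvd_smult dvd_refl)
  ultimately have "[:- a, 1:] ^ k dvd L + C * smult \<mu> (smult (of_nat (Suc k)) ([:- a, 1:] ^ k))" by (rule dvd_add)
  then have "[:- a, 1:] ^ k dvd smult \<kappa> U" unfolding L_def by simp
  then show ?thesis using \<open>\<kappa> \<noteq> 0\<close> by (simp add: dvd_smult_iff)
qed

text \<open>Otherwise \<open>p\<^sub>n s\<^sub>n - r\<^sub>n q\<^sub>n\<close>, scaled to norm \<open>1\<close>, has a nonzero limit \<open>U\<close> of degree at most \<open>2d\<close>. By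
\<open>first_order_divisibility\<close> it vanishes at every preimage of \<open>X\<close> to the order of the Wronskian there, together at least
\<open>2d - 2\<close> zeros, and the preimages in \<open>J\<close>, being common to both sequences, contribute one more each.\<close>

theorem same_branching_imp_equal:
  assumes F: "fibre_family d P Q X \<phi> p q" and G: "fibre_family d P Q X \<phi> r s"
    and W: "degree (wronskian P Q) \<ge> 2 * d - 2"
    and J: "card J = 3" "\<And>a. a \<in> J \<Longrightarrow> \<exists>x\<in>X. a \<in> fibre P Q x \<and> (\<exists>c. c \<longlonglongrightarrow> a \<and>
        (\<forall>\<^sub>F n in sequentially. c n \<in> fibre (p n) (q n) (\<phi> n x) \<and> c n \<in> fibre (r n) (s n) (\<phi> n x)))"
  shows "\<forall>\<^sub>F n in sequentially. p n * s n = r n * q n"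
proof (rule ccontr)
  assume nf: "\<not> ?thesis"
  interpret F: fibre_family d P Q X \<phi> p q by (rule F)
  interpret G: fibre_family d P Q X \<phi> r s by (rule G)
  obtain \<alpha> where \<alpha>: "\<And>a. a \<in> F.A \<Longrightarrow> (\<lambda>n. \<alpha> n a) \<longlonglongrightarrow> a"
    "\<forall>\<^sub>F n in sequentially. \<forall>x\<in>X. F.Rn n x
       = smult (lead_coeff (F.Rn n x)) (\<Prod>a\<in>fibre P Q x. [:- \<alpha> n a, 1:] ^ Suc (order a (wronskian P Q)))"
    using F.fibre_structure by blast
  obtain \<beta> where \<beta>: "\<And>a. a \<in> F.A \<Longrightarrow> (\<lambda>n. \<beta> n a) \<longlonglongrightarrow> a"
    "\<forall>\<^sub>F n in sequentially. \<forall>x\<in>X. G.Rn n x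
       = smult (lead_coeff (G.Rn n x)) (\<Prod>a\<in>fibre P Q x. [:- \<beta> n a, 1:] ^ Suc (order a (wronskian P Q)))"
    using G.fibre_structure by blast
  have J_sub: "J \<subseteq> F.A" using J(2) unfolding F.A_def by blast
  have finJ: "finite J" using J(1) card.infinite by fastforce
  have "\<forall>\<^sub>F n in sequentially. \<alpha> n a = \<beta> n a" if a: "a \<in> J" for a
  proof -
    obtain x c where xc: "x \<in> X" "a \<in> fibre P Q x" "c \<longlonglongrightarrow> a"
      "\<forall>\<^sub>F n in sequentially. c n \<in> fibre (p n) (q n) (\<phi> n x) \<and> c n \<in> fibre (r n) (s n) (\<phi> n x)"
      using J(2)[OF a] by blast
    have 1: "\<forall>\<^sub>F n in sequentially. poly (F.Rn n x) (c n) = 0" "\<forall>\<^sub>F n in sequentially. poly (G.Rn n x) (c n) = 0"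
      using xc(4) by (auto simp: fibre_def elim: eventually_mono)
    have "\<forall>\<^sub>F n in sequentially. c n = \<alpha> n a"
      by (rule F.fibre_root_unique[OF _ \<alpha>(2) xc(1-3) 1(1)]) (rule \<alpha>(1))
    moreover have "\<forall>\<^sub>F n in sequentially. c n = \<beta> n a"
      by (rule G.fibre_root_unique[OF _ \<beta>(2) xc(1-3) 1(2)]) (rule \<beta>(1))
    ultimately show ?thesis by eventually_elim simp
  qed
  then have evJ: "\<forall>\<^sub>F n in sequentially. \<forall>a\<in>J. \<alpha> n a = \<beta> n a" by (intro eventually_ball_finite finJ ballI)
  define T where "T n = p n * s n - r n * q n" for n
  define good where "good n \<longleftrightarrow> nondeg d (p n) (q n) \<and> nondeg d (r n) (s n) \<and> (\<forall>a\<in>J. \<alpha> n a = \<beta> n a)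
     \<and> (\<forall>x\<in>X. F.Rn n x = smult (lead_coeff (F.Rn n x)) (\<Prod>a\<in>fibre P Q x. [:- \<alpha> n a, 1:] ^ Suc (order a (wronskian P Q))))
     \<and> (\<forall>x\<in>X. G.Rn n x = smult (lead_coeff (G.Rn n x)) (\<Prod>a\<in>fibre P Q x. [:- \<beta> n a, 1:] ^ Suc (order a (wronskian P Q))))" for n
  have goodD: "nondeg d (p n) (q n)" "nondeg d (r n) (s n)" "\<forall>a\<in>J. \<alpha> n a = \<beta> n a"
    "\<forall>x\<in>X. F.Rn n x = smult (lead_coeff (F.Rn n x)) (\<Prod>a\<in>fibre P Q x. [:- \<alpha> n a, 1:] ^ Suc (order a (wronskian P Q)))"
    "\<forall>x\<in>X. G.Rn n x = smult (lead_coeff (G.Rn n x)) (\<Prod>a\<in>fibre P Q x. [:- \<beta> n a, 1:] ^ Suc (order a (wronskian P Q)))"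
    if "good n" for n
    using that unfolding good_def by - (elim conjE, assumption)+
  have good: "\<forall>\<^sub>F n in sequentially. good n"
    unfolding good_def using F.ndn G.ndn evJ \<alpha>(2) \<beta>(2) by eventually_elim (intro conjI)
  have "\<not> (\<forall>\<^sub>F n in sequentially. \<not> (good n \<and> T n \<noteq> 0))"
  proof
    assume "\<forall>\<^sub>F n in sequentially. \<not> (good n \<and> T n \<noteq> 0)"
    with good have "\<forall>\<^sub>F n in sequentially. p n * s n = r n * q n" by eventually_elim (simp add: T_def)
    with nf show False ..
  qed
  \<comment> \<open>One subsequence avoids equality, a further one makes the normalised differences converge.\<close>
  from frequently_subseq[OF this] obtain \<rho>1 :: "nat \<Rightarrow> nat" where \<rho>1: "strict_mono \<rho>1"
    "\<And>n. good (\<rho>1 n)" "\<And>n. T (\<rho>1 n) \<noteq> 0" by blast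
  have degT: "degree (T (\<rho>1 n)) \<le> 2 * d" for n
  proof -
    have 1: "nondeg d (p (\<rho>1 n)) (q (\<rho>1 n))" "nondeg d (r (\<rho>1 n)) (s (\<rho>1 n))" by (rule goodD[OF \<rho>1(2)])+
    have "degree (p (\<rho>1 n) * s (\<rho>1 n)) \<le> d + d"
      by (rule order.trans[OF degree_mult_le add_mono[OF nondeg_degree(1)[OF 1(1)] nondeg_degree(2)[OF 1(2)]]])
    moreover have "degree (r (\<rho>1 n) * q (\<rho>1 n)) \<le> d + d"
      by (rule order.trans[OF degree_mult_le add_mono[OF nondeg_degree(1)[OF 1(2)] nondeg_degree(2)[OF 1(1)]]])
    ultimately have "degree (p (\<rho>1 n) * s (\<rho>1 n)) \<le> d + d" "degree (r (\<rho>1 n) * q (\<rho>1 n)) \<le> d + d" .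
    then show ?thesis unfolding T_def mult_2 by (rule degree_diff_le)
  qed
  have Npos: "coeff_norm (2 * d) (T (\<rho>1 n)) > 0" for n
    using coeff_norm_eq_0_iff[OF degT] \<rho>1(3)[of n] coeff_norm_nonneg[of "2 * d" "T (\<rho>1 n)"] by fastforce
  define u where "u n = smult (of_real (1 / coeff_norm (2 * d) (T (\<rho>1 n)))) (T (\<rho>1 n))" for n
  have un: "coeff_norm (2 * d) (u n) = 1" for n
    unfolding u_def coeff_norm_smult norm_of_real using Npos[of n] by simp
  have degu: "degree (u n) \<le> 2 * d" for n unfolding u_def using degree_smult_le degT by (rule order.trans)
  obtain \<rho>2 U where \<rho>2: "strict_mono (\<rho>2 :: nat \<Rightarrow> nat)" and U: "pconv (\<lambda>n. u (\<rho>2 n)) U" "degree U \<le> 2 * d"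
    using pconv_compact_family[of "{()}" "\<lambda>n _. u n" "2 * d" 1] degu un by auto
  have "coeff_norm (2 * d) U = 1" using LIMSEQ_unique[OF pconv_coeff_norm[OF U(1)]] un by simp
  then have U0: "U \<noteq> 0" by (auto simp: coeff_norm_def)
  define \<rho> where "\<rho> n = \<rho>1 (\<rho>2 n)" for n
  have \<rho>: "strict_mono \<rho>" using strict_mono_o[OF \<rho>1(1) \<rho>2] by (simp add: \<rho>_def[abs_def] o_def)
  have good\<rho>: "good (\<rho> n)" for n by (simp add: \<rho>_def \<rho>1(2))
  define c where "c n = coeff_norm (2 * d) (T (\<rho> n))" for n
  have c: "c n > 0" for n by (simp add: c_def \<rho>_def Npos)
  have Uc: "pconv (\<lambda>n. smult (of_real (1 / c n)) (T (\<rho> n))) U" using U(1) by (simp add: u_def c_def \<rho>_def)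
  \<comment> \<open>For each \<open>x\<close>, the difference can be written by the fibre polynomials over \<open>\<phi> n x\<close>, whose roots are known.\<close>
  have T_split: "T n = F.Rn n x * s n - G.Rn n x * q n" for n x
    unfolding T_def by (simp add: algebra_simps)
  have ord: "order a (wronskian P Q) + (if a \<in> J then 1 else 0) \<le> order a U" if a: "a \<in> F.A" for a
  proof -
    obtain x where x: "x \<in> X" "a \<in> fibre P Q x" using a by (auto simp: F.A_def)
    define k where "k = order a (wronskian P Q)"
    define A' where "A' n = smult (lead_coeff (F.Rn n x)) (\<Prod>b\<in>fibre P Q x - {a}. [:- \<alpha> n b, 1:] ^ Suc (order b (wronskian P Q)))" for n
    define B' where "B' n = smult (lead_coeff (G.Rn n x)) (\<Prod>b\<in>fibre P Q x - {a}. [:- \<beta> n b, 1:] ^ Suc (order b (wronskian P Q)))" for n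
    have split: "F.Rn (\<rho> n) x = [:- \<alpha> (\<rho> n) a, 1:] ^ Suc k * A' (\<rho> n)" "G.Rn (\<rho> n) x = [:- \<beta> (\<rho> n) a, 1:] ^ Suc k * B' (\<rho> n)" for n
    proof -
      have "F.Rn (\<rho> n) x = smult (lead_coeff (F.Rn (\<rho> n) x)) (\<Prod>a\<in>fibre P Q x. [:- \<alpha> (\<rho> n) a, 1:] ^ Suc (order a (wronskian P Q)))"
        by (rule bspec[OF goodD(4)[OF good\<rho>] x(1)])
      also have "(\<Prod>a\<in>fibre P Q x. [:- \<alpha> (\<rho> n) a, 1:] ^ Suc (order a (wronskian P Q)))
         = [:- \<alpha> (\<rho> n) a, 1:] ^ Suc k * (\<Prod>b\<in>fibre P Q x - {a}. [:- \<alpha> (\<rho> n) b, 1:] ^ Suc (order b (wronskian P Q)))"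
        unfolding k_def by (rule prod.remove[OF F.fin_fibre x(2)])
      finally show "F.Rn (\<rho> n) x = [:- \<alpha> (\<rho> n) a, 1:] ^ Suc k * A' (\<rho> n)"
        unfolding A'_def by (simp only: mult_smult_right)
      have "G.Rn (\<rho> n) x = smult (lead_coeff (G.Rn (\<rho> n) x)) (\<Prod>a\<in>fibre P Q x. [:- \<beta> (\<rho> n) a, 1:] ^ Suc (order a (wronskian P Q)))"
        by (rule bspec[OF goodD(5)[OF good\<rho>] x(1)])
      also have "(\<Prod>a\<in>fibre P Q x. [:- \<beta> (\<rho> n) a, 1:] ^ Suc (order a (wronskian P Q)))
         = [:- \<beta> (\<rho> n) a, 1:] ^ Suc k * (\<Prod>b\<in>fibre P Q x - {a}. [:- \<beta> (\<rho> n) b, 1:] ^ Suc (order b (wronskian P Q)))"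
        unfolding k_def by (rule prod.remove[OF F.fin_fibre x(2)])
      finally show "G.Rn (\<rho> n) x = [:- \<beta> (\<rho> n) a, 1:] ^ Suc k * B' (\<rho> n)"
        unfolding B'_def by (simp only: mult_smult_right)
    qed
    show ?thesis
    proof (cases "a \<in> J")
      case True
      have "[:- \<alpha> (\<rho> n) a, 1:] ^ Suc k dvd T (\<rho> n)" for n
      proof -
        have "\<alpha> (\<rho> n) a = \<beta> (\<rho> n) a" by (rule bspec[OF goodD(3)[OF good\<rho>] True])
        then show ?thesis unfolding T_split[of _ x] split by (intro dvd_diff dvd_mult2) simp_all
      qed
      then have dv: "[:- \<alpha> (\<rho> n) a, 1:] ^ Suc k dvd smult (of_real (1 / c n)) (T (\<rho> n))" for n by (rule dvd_smult)
      have "(\<lambda>n. \<alpha> (\<rho> n) a) \<longlonglongrightarrow> a" using LIMSEQ_subseq_LIMSEQ[OF \<alpha>(1)[OF a] \<rho>] by (simp add: o_def)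
      from pconv_linear_power_dvd_all[OF Uc this dv] have "[:- a, 1:] ^ Suc k dvd U" .
      then show ?thesis using U0 True by (simp only: order_divides k_def) simp
    next
      case False
      have lc: "pconv (\<lambda>n. smult (lead_coeff (H n)) (\<Prod>b\<in>fibre P Q x - {a}. [:- \<gamma> n b, 1:] ^ Suc (order b (wronskian P Q))))
          (smult (lead_coeff (P - smult x Q)) (\<Prod>b\<in>fibre P Q x - {a}. [:- b, 1:] ^ Suc (order b (wronskian P Q))))"
        if H: "pconv H (P - smult x Q)" "\<forall>\<^sub>F n in sequentially. degree (H n) \<le> d" and \<gamma>: "\<And>b. b \<in> F.A \<Longrightarrow> (\<lambda>n. \<gamma> n b) \<longlonglongrightarrow> b" for H \<gamma>
      proof (intro pconv_smult pconv_prod pconv_power pconv_linear)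
        have cd: "coeff (P - smult x Q) d \<noteq> 0" using F.degR[of x] F.R0[of x] leading_coeff_0_iff by metis
        have "\<forall>\<^sub>F n in sequentially. coeff (H n) d = lead_coeff (H n)"
          using tendsto_imp_eventually_ne[OF pconvD[OF H(1)] cd] H(2)
          by eventually_elim (metis le_antisym le_degree)
        from Lim_transform_eventually[OF pconvD[OF H(1)] this]
        show "(\<lambda>n. lead_coeff (H n)) \<longlonglongrightarrow> lead_coeff (P - smult x Q)" by (simp add: F.degR)
        fix b assume "b \<in> fibre P Q x - {a}"
        then show "(\<lambda>n. \<gamma> n b) \<longlonglongrightarrow> b" using x(1) by (intro \<gamma>) (auto simp: F.A_def)
      qed
      have dH: "\<forall>\<^sub>F n in sequentially. degree (f n - smult (\<phi> n x) (g n)) \<le> d"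
        if "\<forall>\<^sub>F n in sequentially. nondeg d (f n) (g n)" for f g
        using that
      proof eventually_elim
        case (elim n)
        show ?case using nondeg_degree[OF elim] by (intro degree_diff_le) (auto intro: order.trans[OF degree_smult_le])
      qed
      define C where "C = smult (lead_coeff (P - smult x Q)) (\<Prod>b\<in>fibre P Q x - {a}. [:- b, 1:] ^ Suc (order b (wronskian P Q)))"
      have A': "pconv A' C" unfolding A'_def[abs_def] C_def by (rule lc[OF F.Rn[OF x(1)] dH[OF F.ndn] \<alpha>(1)])
      have B': "pconv B' C" unfolding B'_def[abs_def] C_def by (rule lc[OF G.Rn[OF x(1)] dH[OF G.ndn] \<beta>(1)])
      have Ca: "poly (C * Q) a \<noteq> 0"
      proof -
        have 1: "poly (\<Prod>b\<in>fibre P Q x - {a}. [:- b, 1:] ^ Suc (order b (wronskian P Q))) a \<noteq> 0"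
          unfolding poly_prod using F.fin_fibre[of x] by (subst prod_zero_iff) (auto simp: poly_power)
        have 2: "lead_coeff (P - smult x Q) \<noteq> 0" using F.R0[of x] leading_coeff_0_iff by blast
        show ?thesis unfolding C_def poly_mult poly_smult
          using 1 2 fibre_denominator[OF F.nd x(2)] by (simp only: mult_eq_0_iff) simp
      qed
      have "[:- a, 1:] ^ k dvd U"
      proof (rule first_order_divisibility[OF _ _ _ _ _ Ca c Uc])
        show "T (\<rho> n) = [:- \<alpha> (\<rho> n) a, 1:] ^ Suc k * (A' (\<rho> n) * s (\<rho> n)) - [:- \<beta> (\<rho> n) a, 1:] ^ Suc k * (B' (\<rho> n) * q (\<rho> n))" for n
          unfolding T_split[of _ x] split by (simp only: mult.assoc)
        show "(\<lambda>n. \<alpha> (\<rho> n) a) \<longlonglongrightarrow> a" "(\<lambda>n. \<beta> (\<rho> n) a) \<longlonglongrightarrow> a"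
          using LIMSEQ_subseq_LIMSEQ[OF \<alpha>(1)[OF a] \<rho>] LIMSEQ_subseq_LIMSEQ[OF \<beta>(1)[OF a] \<rho>] by (simp_all add: o_def)
        show "pconv (\<lambda>n. A' (\<rho> n) * s (\<rho> n)) (C * Q)" "pconv (\<lambda>n. B' (\<rho> n) * q (\<rho> n)) (C * Q)"
          by (intro pconv_mult pconv_subseq[OF A' \<rho>] pconv_subseq[OF B' \<rho>] pconv_subseq[OF F.q \<rho>] pconv_subseq[OF G.q \<rho>])+
      qed
      then show ?thesis using U0 False by (simp only: order_divides k_def) simp
    qed
  qed
  have "(\<Sum>a\<in>F.A. order a (wronskian P Q)) + card J = (\<Sum>a\<in>F.A. order a (wronskian P Q) + (if a \<in> J then 1 else 0))"
  proof -
    have "F.A \<inter> J = J" "J \<inter> F.A = J" using J_sub by blast+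
    then show ?thesis by (simp add: sum.distrib sum.If_cases[OF F.finA])
  qed
  also have "\<dots> \<le> (\<Sum>a\<in>F.A. order a U)" by (intro sum_mono ord)
  also have "\<dots> \<le> degree U" by (rule sum_order_subset_le[OF U0 F.finA])
  \<comment> \<open>\<open>2d - 2 + 3 \<le> deg U \<le> 2d\<close> is impossible.\<close>
  finally show False using F.sumA W J(1) U(2) F.d1 by linarith
qed

section \<open>Local uniqueness on the sphere\<close>

lemma mobius_to_infinity: "\<exists>A. mobius A \<and> A x = None"
proof (cases x)
  case None
  then show ?thesis using mobius_id by (intro exI[of _ id]) simp
next
  case (Some z)
  have ad: "(0::complex) * (- z) - 1 * 1 \<noteq> 0" by simp
  have "lin 0 1 1 (- z) (proj z 1) = proj (0 * z + 1 * 1) (1 * z + (- z) * 1)"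
    by (rule lin_proj(1)[OF ad]) simp
  then have "lin 0 1 1 (- z) x = None" by (simp add: Some proj_1 proj_def)
  moreover have "mobius (lin 0 1 1 (- z))" unfolding mobius_lin using ad by blast
  ultimately show ?thesis by blast
qed

lemma mobius_from_infinity: "\<exists>C. mobius C \<and> C None = x"
proof -
  obtain A where A: "mobius A" "A x = None" using mobius_to_infinity by blast
  have "inv A None = x" using A mobius_inverse(3)[OF A(1)] by (metis comp_apply id_apply)
  then show ?thesis using mobius_inverse(2)[OF A(1)] by blast
qed

lemma mobius_sphere_cont: "mobius A \<Longrightarrow> sphere_cont A" by (simp add: mobius_iff sphere_cont_rat)
lemma mobius_rat_deg: "mobius A \<Longrightarrow> rat_deg 1 A" by (simp add: mobius_iff)
lemma mobius_inj: "mobius A \<Longrightarrow> A x = A y \<longleftrightarrow> x = y"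
  using mobius_inverse(1) by (metis bij_is_inj inj_eq)

lemma mobius_inv_apply: "mobius A \<Longrightarrow> inv A (A x) = x" "mobius A \<Longrightarrow> A (inv A x) = x"
  using mobius_inverse(3,4) by (metis comp_apply id_apply)+

lemma rat_deg_mobius:
  assumes "rat_deg d f" "mobius A" "mobius C"
  shows "rat_deg d (A \<circ> f \<circ> C)"
  using rat_deg_comp[OF rat_deg_comp[OF mobius_rat_deg[OF assms(2)] assms(1)] mobius_rat_deg[OF assms(3)]] by simp

lemma critical_points_mobius_comp:
  assumes "rat_deg d f" "mobius A" "mobius C"
  shows "x \<in> critical_points (A \<circ> f \<circ> C) \<longleftrightarrow> C x \<in> critical_points f"
  using critical_points_comp[OF rat_deg_comp[OF mobius_rat_deg[OF assms(2)] assms(1)] mobius_rat_deg[OF assms(3)], of x]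
    critical_points_comp[OF mobius_rat_deg[OF assms(2)] assms(1), of "C x"]
    critical_points_mobius[OF assms(2)] critical_points_mobius[OF assms(3)] by simp

lemma critical_values_mobius_comp:
  assumes "rat_deg d f" "mobius A" "mobius C"
  shows "critical_values (A \<circ> f \<circ> C) = A ` critical_values f"
proof -
  have "critical_values (A \<circ> f \<circ> C) = {A (f (C x)) | x. C x \<in> critical_points f}"
    unfolding critical_values_def using critical_points_mobius_comp[OF assms] by auto
  also have "\<dots> = A ` critical_values f"
    unfolding critical_values_def using mobius_inv_apply(2)[OF assms(3)] by (auto simp: image_iff) metis
  finally show ?thesis .
qed

lemma cconv_mobius_comp:
  assumes "cconv G f" "mobius A" "mobius C"
  shows "cconv (\<lambda>n. A \<circ> G n \<circ> C) (A \<circ> f \<circ> C)"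
  by (intro cconv_comp cconv_const mobius_sphere_cont assms)

text \<open>Moebius changes of coordinate at source and target that make a point outside \<open>S\<close> play the role of \<open>\<infinity>\<close> and one
of its preimages that of a fixed \<open>\<infinity>\<close>. The two are independent, as no iteration is involved at this stage.\<close>

lemma normal_coordinates:
  assumes f: "rat_deg d f" "d \<ge> 1" and S: "finite S"
  obtains A C P Q where "mobius A" "mobius C" "nondeg d P Q" "degree Q < degree P"
    "A \<circ> f \<circ> C = rat_map P Q" "None \<notin> A ` S" "(A \<circ> f \<circ> C) None = None"
proof -
  have "infinite (UNIV :: sphere set)"
    by (simp add: finite_option_UNIV infinite_UNIV_char_0)
  then obtain b where b: "b \<notin> S" using ex_new_if_finite S by blast
  obtain c where c: "f c = b" using rat_deg_surj[OF f] by metis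
  obtain A where A: "mobius A" "A b = None" using mobius_to_infinity by blast
  obtain C where C: "mobius C" "C None = c" using mobius_from_infinity by blast
  obtain P Q where PQ: "nondeg d P Q" "A \<circ> f \<circ> C = rat_map P Q"
    using rat_deg_mobius[OF f(1) A(1) C(1)] unfolding rat_deg_def by blast
  have N: "(A \<circ> f \<circ> C) None = None" by (simp add: A C c)
  have m: "max (degree P) (degree Q) = d" using PQ(1) by (simp add: nondeg_iff)
  have "coeff Q d = 0"
    using N unfolding PQ(2) by (simp add: rat_map_def Let_def m split: if_splits)
  then have "degree Q \<noteq> d" using f(2) by (metis degree_0 leading_coeff_0_iff not_one_le_zero)
  then have "degree Q < degree P" using m by (auto simp: max_def split: if_splits)
  moreover have "None \<notin> A ` S" using A b mobius_inj[OF A(1)] by (metis imageE)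
  ultimately show ?thesis using that A(1) C(1) PQ N by blast
qed

lemma normal_coeff_conv:
  assumes "cconv G f" "\<forall>\<^sub>F n in sequentially. \<exists>e. rat_deg e (G n)"
    and "mobius A" "mobius C" "nondeg d P Q" "degree Q < degree P" "A \<circ> f \<circ> C = rat_map P Q"
  obtains p q where "pconv p P" "pconv q Q"
    "\<forall>\<^sub>F n in sequentially. nondeg d (p n) (q n) \<and> A \<circ> G n \<circ> C = rat_map (p n) (q n)"
proof -
  have cc: "cconv (\<lambda>n. A \<circ> G n \<circ> C) (rat_map P Q)" using cconv_mobius_comp[OF assms(1,3,4)] assms(7) by simp
  have ev: "\<forall>\<^sub>F n in sequentially. \<exists>e. rat_deg e (A \<circ> G n \<circ> C)"
    using assms(2) by eventually_elim (use rat_deg_mobius assms(3,4) in blast)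
  show ?thesis by (rule cconv_imp_coeff_conv[OF cc ev assms(5,6)]) (rule that)
qed

lemma finite_coordinate:
  assumes "mobius C" "(A \<circ> f \<circ> C) None = None" "A (f a) \<noteq> None"
  shows "\<exists>\<gamma>. inv C a = Some \<gamma> \<and> C (Some \<gamma>) = a"
proof (cases "inv C a")
  case None
  then have "C None = a" using mobius_inv_apply(2)[OF assms(1), of a] by simp
  with assms(2,3) show ?thesis by simp
next
  case (Some \<gamma>)
  then show ?thesis using mobius_inv_apply(2)[OF assms(1), of a] by simp
qed

lemma preimage_persists:
  assumes f: "rat_deg d f" "d \<ge> 1" and G: "cconv G f" "\<forall>\<^sub>F n in sequentially. \<exists>e. rat_deg e (G n)"
    and y: "sconv y (f a) sequentially"
  obtains x where "sconv x a sequentially" "\<forall>\<^sub>F n in sequentially. G n (x n) = y n"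
proof -
  obtain A C P Q where AC: "mobius A" "mobius C" and n: "nondeg d P Q" "degree Q < degree P" "A \<circ> f \<circ> C = rat_map P Q"
    and N: "None \<notin> A ` {f a}" "(A \<circ> f \<circ> C) None = None"
    using normal_coordinates[OF f finite.insertI[OF finite.emptyI]] .
  obtain p q where pq: "pconv p P" "pconv q Q"
    "\<forall>\<^sub>F n in sequentially. nondeg d (p n) (q n) \<and> A \<circ> G n \<circ> C = rat_map (p n) (q n)"
    using normal_coeff_conv[OF G AC n] .
  obtain \<beta> where \<beta>: "A (f a) = Some \<beta>" using N(1) by (cases "A (f a)") auto
  obtain \<gamma> where \<gamma>: "inv C a = Some \<gamma>" and C\<gamma>: "C (Some \<gamma>) = a"
    using finite_coordinate[OF AC(2) N(2), of a] \<beta> by auto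
  have y': "sconv (\<lambda>n. A (y n)) (Some \<beta>) sequentially" using sphere_contD[OF mobius_sphere_cont[OF AC(1)] y] by (simp add: \<beta>)
  define \<eta> where "\<eta> n = the (A (y n))" for n
  have \<eta>: "\<eta> \<longlonglongrightarrow> \<beta>" "\<forall>\<^sub>F n in sequentially. A (y n) = Some (\<eta> n)" using sconv_SomeD[OF y'] by (simp_all add: \<eta>_def[abs_def])
  have R: "pconv (\<lambda>n. p n - smult (\<eta> n) (q n)) (P - smult \<beta> Q)" by (intro pconv_diff pconv_smult pq \<eta>)
  have "rat_map P Q (Some \<gamma>) = Some \<beta>" using fun_cong[OF n(3), of "Some \<gamma>"] C\<gamma> \<beta> by simp
  then have root: "poly (P - smult \<beta> Q) \<gamma> = 0" by (simp only: rat_map_eq_Some_iff[OF n(1)])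
  have nz: "P - smult \<beta> Q \<noteq> 0" using degree_fibre_poly[OF refl n(2), of \<beta>] n(2) by auto
  obtain z where z: "z \<longlonglongrightarrow> \<gamma>" "\<forall>\<^sub>F n in sequentially. poly (p n - smult (\<eta> n) (q n)) (z n) = 0"
    using pconv_root[OF R nz root] by blast
  show ?thesis
  proof
    show "sconv (\<lambda>n. C (Some (z n))) a sequentially"
      using sphere_contD[OF mobius_sphere_cont[OF AC(2)] sconv_Some[OF z(1)]] by (simp add: C\<gamma>)
    show "\<forall>\<^sub>F n in sequentially. G n (C (Some (z n))) = y n"
      using z(2) pq(3) \<eta>(2)
    proof eventually_elim
      case (elim n)
      have "rat_map (p n) (q n) (Some (z n)) = Some (\<eta> n)"
        using elim(1) rat_map_eq_Some_iff elim(2) by blast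
      then have "A (G n (C (Some (z n)))) = A (y n)"
        using elim(3) fun_cong[OF conjunct2[OF elim(2)], of "Some (z n)"] by simp
      then show ?case by (simp add: mobius_inj[OF AC(1)])
    qed
  qed
qed

lemma critical_Some_iff:
  assumes "nondeg d p q"
  shows "Some z \<in> critical_points (rat_map p q) \<longleftrightarrow> poly (wronskian p q) z = 0"
  unfolding critical_rat_map_iff[OF assms] by (simp add: chart_poly_def chart_def)

text \<open>The zeros of the Wronskian persist by Hurwitz's theorem.\<close>

lemma critical_value_persists:
  assumes f: "rat_deg d f" "d \<ge> 1" and G: "cconv G f" "\<forall>\<^sub>F n in sequentially. \<exists>e. rat_deg e (G n)"
    and x: "x \<in> critical_values f"
  obtains v where "sconv v x sequentially" "\<forall>\<^sub>F n in sequentially. v n \<in> critical_values (G n)"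
proof -
  obtain c where c: "c \<in> critical_points f" "f c = x" using x by (auto simp: critical_values_def)
  obtain A C P Q where AC: "mobius A" "mobius C" and n: "nondeg d P Q" "degree Q < degree P" "A \<circ> f \<circ> C = rat_map P Q"
    and N: "None \<notin> A ` {x}" "(A \<circ> f \<circ> C) None = None"
    using normal_coordinates[OF f finite.insertI[OF finite.emptyI]] .
  obtain p q where pq: "pconv p P" "pconv q Q"
    "\<forall>\<^sub>F n in sequentially. nondeg d (p n) (q n) \<and> A \<circ> G n \<circ> C = rat_map (p n) (q n)"
    using normal_coeff_conv[OF G AC n] .
  have "A (f c) \<noteq> None" using N(1) c(2) by (metis imageI singletonI)
  from finite_coordinate[OF AC(2) N(2) this]
  obtain \<gamma> where \<gamma>: "inv C c = Some \<gamma>" and C\<gamma>: "C (Some \<gamma>) = c" by blast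
  have "Some \<gamma> \<in> critical_points (rat_map P Q)"
    using critical_points_mobius_comp[OF f(1) AC, of "Some \<gamma>"] c(1) by (simp add: n(3)[symmetric] C\<gamma>)
  then have root: "poly (wronskian P Q) \<gamma> = 0" by (simp add: critical_Some_iff[OF n(1)])
  have W0: "wronskian P Q \<noteq> 0" using n by (intro wronskian_nonzero) (simp_all add: nondeg_iff)
  obtain z where z: "z \<longlonglongrightarrow> \<gamma>" "\<forall>\<^sub>F n in sequentially. poly (wronskian (p n) (q n)) (z n) = 0"
    using pconv_root[OF pconv_wronskian[OF pq(1,2)] W0 root] by blast
  have zc: "sconv (\<lambda>n. C (Some (z n))) c sequentially"
    using sphere_contD[OF mobius_sphere_cont[OF AC(2)] sconv_Some[OF z(1)]] by (simp add: C\<gamma>)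
  show ?thesis
  proof
    show "sconv (\<lambda>n. G n (C (Some (z n)))) x sequentially" using cconv_seq[OF G(1) zc] by (simp add: c(2))
    show "\<forall>\<^sub>F n in sequentially. G n (C (Some (z n))) \<in> critical_values (G n)"
      using z(2) pq(3) G(2)
    proof eventually_elim
      case (elim n)
      then obtain e where e: "rat_deg e (G n)" by blast
      have "Some (z n) \<in> critical_points (A \<circ> G n \<circ> C)"
        using elim(1,2) critical_Some_iff[of d "p n" "q n" "z n"] by simp
      then have "C (Some (z n)) \<in> critical_points (G n)" by (simp add: critical_points_mobius_comp[OF e AC])
      then show ?case by (simp add: critical_values_def)
    qed
  qed
qed

text \<open>The degree drops below \<open>2d - 2\<close> exactly when \<open>\<infinity>\<close> is critical: the coefficient of index \<open>2d - 2\<close> is the value of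
the Wronskian in the chart at \<open>\<infinity>\<close>, up to sign.\<close>

lemma wronskian_degree_ge:
  assumes n: "nondeg d P Q" and d: "degree Q < degree P" and c: "None \<notin> critical_points (rat_map P Q)"
  shows "degree (wronskian P Q) \<ge> 2 * d - 2"
proof -
  have dP: "degree P = d" using n d by (simp add: nondeg_iff)
  have d1: "1 \<le> d" using d dP by simp
  have Qd: "coeff Q d = 0" using d dP by (simp add: coeff_eq_0)
  have "poly (wronskian (rev_poly d P) (rev_poly d Q)) 0 \<noteq> 0"
    using c unfolding critical_rat_map_iff[OF n] by (simp add: chart_poly_def chart_def)
  moreover have "poly (wronskian (rev_poly d P) (rev_poly d Q)) 0 = - coeff P d * coeff Q (d - 1)"
    unfolding wronskian_def poly_diff poly_mult unfolding poly_0_coeff_0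
    using d1 by (simp add: coeff_pderiv coeff_rev_poly Qd)
  ultimately have nz: "coeff P d \<noteq> 0" "coeff Q (d - 1) \<noteq> 0" by auto
  have dQ: "degree Q = d - 1" using le_degree[OF nz(2)] d dP by simp
  have "coeff (wronskian P Q) (2 * d - 2) = coeff P d * coeff Q (d - 1)"
  proof -
    have 1: "coeff (pderiv P * Q) (2 * d - 2) = of_nat d * coeff P d * coeff Q (d - 1)"
    proof -
      have "degree (pderiv P) + degree Q = 2 * d - 2" by (simp add: degree_pderiv dP dQ)
      then show ?thesis
        using coeff_mult_degree_sum[of "pderiv P" Q] d1
        by (simp add: degree_pderiv dP dQ coeff_pderiv)
    qed
    have 2: "coeff (P * pderiv Q) (2 * d - 2) = of_nat (d - 1) * coeff P d * coeff Q (d - 1)"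
    proof (cases "d = 1")
      case True
      then have "pderiv Q = 0" using dQ by (simp add: pderiv_eq_0_iff)
      then show ?thesis using True by simp
    next
      case False
      then have "d + (d - 1 - 1) = 2 * d - 2" "Suc (d - 1 - 1) = d - 1" using d1 by auto
      then show ?thesis
        using coeff_mult_degree_sum[of P "pderiv Q"]
        by (simp add: degree_pderiv dP dQ coeff_pderiv mult_ac)
    qed
    show ?thesis unfolding wronskian_def coeff_diff 1 2 using d1 by (simp add: of_nat_diff algebra_simps)
  qed
  then show ?thesis using nz by (intro le_degree) simp
qed

lemma eventually_ball_finiteI:
  assumes "finite X" "\<And>x. x \<in> X \<Longrightarrow> \<forall>\<^sub>F n in sequentially. P n x"
  shows "\<forall>\<^sub>F n in sequentially. \<forall>x\<in>X. P n x"
  using assms by (intro eventually_ball_finite) auto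

text \<open>One choice of coordinates that serves every sequence \<open>G\<close> converging to \<open>f\<close> at once; two sequences can be compared
only in common coordinates.\<close>

lemma normal_fibre_family:
  assumes f: "rat_deg d f" "d \<ge> 1" and X: "finite X" "critical_values f \<subseteq> X"
    and \<phi>: "\<forall>x\<in>X. sconv (\<lambda>n. \<phi> n x) x sequentially"
  obtains A C P Q X' \<psi> where "mobius A" "mobius C" "nondeg d P Q" "A \<circ> f \<circ> C = rat_map P Q"
    "degree (wronskian P Q) \<ge> 2 * d - 2" "(A \<circ> f \<circ> C) None = None"
    "\<forall>x\<in>X. \<exists>\<xi>\<in>X'. A x = Some \<xi> \<and> (\<forall>\<^sub>F n in sequentially. A (\<phi> n x) = Some (\<psi> n \<xi>))"
    "\<forall>G. cconv G f \<and> (\<forall>\<^sub>F n in sequentially. (\<exists>e. rat_deg e (G n)) \<and> critical_values (G n) \<subseteq> \<phi> n ` X) \<longrightarrow>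
       (\<exists>p q. fibre_family d P Q X' \<psi> p q \<and> (\<forall>\<^sub>F n in sequentially. nondeg d (p n) (q n) \<and> A \<circ> G n \<circ> C = rat_map (p n) (q n)))"
proof -
  obtain A C P Q where AC: "mobius A" "mobius C" and n: "nondeg d P Q" "degree Q < degree P" "A \<circ> f \<circ> C = rat_map P Q"
    and N: "None \<notin> A ` X" "(A \<circ> f \<circ> C) None = None"
    using normal_coordinates[OF f X(1)] .
  define X' where "X' = (\<lambda>x. the (A x)) ` X"
  define \<psi> where "\<psi> n \<xi> = the (A (\<phi> n (inv A (Some \<xi>))))" for n \<xi>
  have AX: "A x = Some (the (A x))" if "x \<in> X" for x using N(1) that by (cases "A x") (force+)
  have \<phi>A: "sconv (\<lambda>n. A (\<phi> n x)) (Some (the (A x))) sequentially" if x: "x \<in> X" for x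
    using sphere_contD[OF mobius_sphere_cont[OF AC(1)] bspec[OF \<phi> x]] AX[OF x] by simp
  have \<psi>_eq: "\<psi> n (the (A x)) = the (A (\<phi> n x))" if "x \<in> X" for n x
    unfolding \<psi>_def AX[OF that, symmetric] mobius_inv_apply(1)[OF AC(1)] by (rule refl)
  have \<psi>: "(\<lambda>n. \<psi> n \<xi>) \<longlonglongrightarrow> \<xi>" if "\<xi> \<in> X'" for \<xi>
    using that sconv_SomeD(2)[OF \<phi>A] \<psi>_eq by (auto simp: X'_def)
  have \<phi>ev: "\<forall>\<^sub>F n in sequentially. A (\<phi> n x) = Some (\<psi> n (the (A x)))" if "x \<in> X" for x
    using sconv_SomeD(1)[OF \<phi>A[OF that]] by eventually_elim (simp add: \<psi>_eq[OF that])
  have Vf: "critical_values (rat_map P Q) = A ` critical_values f"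
    using critical_values_mobius_comp[OF f(1) AC] n(3) by simp
  have nc: "None \<notin> critical_points (rat_map P Q)"
  proof
    assume "None \<in> critical_points (rat_map P Q)"
    then have "rat_map P Q None \<in> critical_values (rat_map P Q)" unfolding critical_values_def by (rule imageI)
    then have "rat_map P Q None \<in> A ` critical_values f" unfolding Vf .
    then show False using N X(2) n(3) by auto
  qed
  have crit: "\<exists>\<xi>\<in>X'. z \<in> fibre P Q \<xi>" if z: "poly (wronskian P Q) z = 0" for z
  proof -
    have "Some z \<in> critical_points (rat_map P Q)" using z by (simp add: critical_Some_iff[OF n(1)])
    then have "rat_map P Q (Some z) \<in> critical_values (rat_map P Q)" unfolding critical_values_def by (rule imageI)
    then have "rat_map P Q (Some z) \<in> A ` critical_values f" unfolding Vf .
    then obtain x where x: "x \<in> X" "rat_map P Q (Some z) = A x" using X(2) by blast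
    then have "rat_map P Q (Some z) = Some (the (A x))" using AX by simp
    then have "z \<in> fibre P Q (the (A x))" by (simp add: fibre_def rat_map_eq_Some_iff[OF n(1)])
    then show ?thesis using x(1) by (auto simp: X'_def)
  qed
  have fam: "\<exists>p q. fibre_family d P Q X' \<psi> p q \<and> (\<forall>\<^sub>F n in sequentially. nondeg d (p n) (q n) \<and> A \<circ> G n \<circ> C = rat_map (p n) (q n))"
    if G: "cconv G f" "\<forall>\<^sub>F n in sequentially. (\<exists>e. rat_deg e (G n)) \<and> critical_values (G n) \<subseteq> \<phi> n ` X" for G
  proof -
    have rG: "\<forall>\<^sub>F n in sequentially. \<exists>e. rat_deg e (G n)" using G(2) by eventually_elim simp
    obtain p q where pq: "pconv p P" "pconv q Q"
      "\<forall>\<^sub>F n in sequentially. nondeg d (p n) (q n) \<and> A \<circ> G n \<circ> C = rat_map (p n) (q n)"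
      using normal_coeff_conv[OF G(1) rG AC n] .
    have all: "\<forall>\<^sub>F n in sequentially. \<forall>x\<in>X. A (\<phi> n x) = Some (\<psi> n (the (A x)))"
      by (rule eventually_ball_finiteI[OF X(1) \<phi>ev])
    have ndn: "\<forall>\<^sub>F n in sequentially. nondeg d (p n) (q n)" using pq(3) by eventually_elim simp
    have critn: "\<forall>\<^sub>F n in sequentially. \<forall>z. poly (wronskian (p n) (q n)) z = 0 \<longrightarrow> (\<exists>\<xi>\<in>X'. z \<in> fibre (p n) (q n) (\<psi> n \<xi>))"
      using G(2) pq(3) all
    proof eventually_elim
      case (elim n)
      obtain e where e: "rat_deg e (G n)" using elim(1) by blast
      have nn: "nondeg d (p n) (q n)" and eq: "A \<circ> G n \<circ> C = rat_map (p n) (q n)" using elim(2) by blast+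
      have V: "critical_values (rat_map (p n) (q n)) = A ` critical_values (G n)"
        using critical_values_mobius_comp[OF e AC] eq by simp
      show ?case
      proof (intro allI impI)
        fix z assume "poly (wronskian (p n) (q n)) z = 0"
        then have "Some z \<in> critical_points (rat_map (p n) (q n))" by (simp add: critical_Some_iff[OF nn])
        then have "rat_map (p n) (q n) (Some z) \<in> critical_values (rat_map (p n) (q n))" unfolding critical_values_def by (rule imageI)
        then have "rat_map (p n) (q n) (Some z) \<in> A ` critical_values (G n)" unfolding V .
        then obtain x where x: "x \<in> X" "rat_map (p n) (q n) (Some z) = A (\<phi> n x)" using elim(1) by blast
        then have "rat_map (p n) (q n) (Some z) = Some (\<psi> n (the (A x)))" using elim(3) by simp
        then have "z \<in> fibre (p n) (q n) (\<psi> n (the (A x)))" by (simp add: fibre_def rat_map_eq_Some_iff[OF nn])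
        then show "\<exists>\<xi>\<in>X'. z \<in> fibre (p n) (q n) (\<psi> n \<xi>)" using x(1) by (auto simp: X'_def)
      qed
    qed
    have "fibre_family d P Q X' \<psi> p q"
    proof (unfold_locales)
      show "finite X'" unfolding X'_def using X(1) by simp
    qed (use n(1,2) crit \<psi> pq(1,2) ndn critn in blast)+
    with pq(3) show ?thesis by blast
  qed
  show ?thesis
  proof (rule that[OF AC n(1,3) wronskian_degree_ge[OF n(1,2) nc] N(2)])
    show "\<forall>x\<in>X. \<exists>\<xi>\<in>X'. A x = Some \<xi> \<and> (\<forall>\<^sub>F n in sequentially. A (\<phi> n x) = Some (\<psi> n \<xi>))"
    proof
      fix x assume x: "x \<in> X"
      show "\<exists>\<xi>\<in>X'. A x = Some \<xi> \<and> (\<forall>\<^sub>F n in sequentially. A (\<phi> n x) = Some (\<psi> n \<xi>))"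
        using AX[OF x] \<phi>ev[OF x] x by (intro bexI[of _ "the (A x)"] conjI) (simp_all add: X'_def)
    qed
  qed (use fam in blast)
qed

lemma rat_map_eqI:
  assumes "nondeg d p q" "nondeg d r s" "p * s = r * q"
  shows "rat_map p q = rat_map r s"
proof
  fix x
  obtain u v where x: "x = proj u v" "u \<noteq> 0 \<or> v \<noteq> 0" by (rule proj_surj)
  have "hom d p u v * hom d s u v = hom d r u v * hom d q u v"
    using hom_mult[OF nondeg_degree(1)[OF assms(1)] nondeg_degree(2)[OF assms(2)], of u v]
      hom_mult[OF nondeg_degree(1)[OF assms(2)] nondeg_degree(2)[OF assms(1)], of u v] assms(3) by simp
  then show "rat_map p q x = rat_map r s x"
    unfolding x(1) rat_map_proj[OF assms(1) x(2)] rat_map_proj[OF assms(2) x(2)]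
    by (subst proj_eq_iff[OF nondeg_hom[OF assms(1) x(2)] nondeg_hom[OF assms(2) x(2)]])
qed

text \<open>Maps near \<open>f\<close> with prescribed critical values form a single orbit under precomposition with Moebius maps, and
three marked preimages remove that freedom. In the coordinates of \<open>normal_fibre_family\<close> this is
\<open>same_branching_imp_equal\<close>.\<close>

theorem local_uniqueness:
  assumes f: "rat_deg d f" "d \<ge> 1" and X: "finite X" "critical_values f \<subseteq> X"
    and \<phi>: "\<And>x. x \<in> X \<Longrightarrow> sconv (\<lambda>n. \<phi> n x) x sequentially"
    and G: "cconv G f" "\<forall>\<^sub>F n in sequentially. (\<exists>e. rat_deg e (G n)) \<and> critical_values (G n) \<subseteq> \<phi> n ` X"
    and H: "cconv H f" "\<forall>\<^sub>F n in sequentially. (\<exists>e. rat_deg e (H n)) \<and> critical_values (H n) \<subseteq> \<phi> n ` X"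
    and J: "card J = 3" "\<And>a. a \<in> J \<Longrightarrow> f a \<in> X"
      "\<And>a. a \<in> J \<Longrightarrow> \<exists>c. sconv c a sequentially \<and> (\<forall>\<^sub>F n in sequentially. G n (c n) = \<phi> n (f a) \<and> H n (c n) = \<phi> n (f a))"
  shows "\<forall>\<^sub>F n in sequentially. G n = H n"
proof -
  obtain A C P Q X' \<psi> where AC: "mobius A" "mobius C" and n: "nondeg d P Q" "A \<circ> f \<circ> C = rat_map P Q"
    and W: "degree (wronskian P Q) \<ge> 2 * d - 2" and N: "(A \<circ> f \<circ> C) None = None"
    and X': "\<forall>x\<in>X. \<exists>\<xi>\<in>X'. A x = Some \<xi> \<and> (\<forall>\<^sub>F n in sequentially. A (\<phi> n x) = Some (\<psi> n \<xi>))"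
    and fam: "\<forall>G. cconv G f \<and> (\<forall>\<^sub>F n in sequentially. (\<exists>e. rat_deg e (G n)) \<and> critical_values (G n) \<subseteq> \<phi> n ` X) \<longrightarrow>
       (\<exists>p q. fibre_family d P Q X' \<psi> p q \<and> (\<forall>\<^sub>F n in sequentially. nondeg d (p n) (q n) \<and> A \<circ> G n \<circ> C = rat_map (p n) (q n)))"
    using normal_fibre_family[OF f X ballI[OF \<phi>]] .
  obtain p q where F: "fibre_family d P Q X' \<psi> p q"
    and pq: "\<forall>\<^sub>F n in sequentially. nondeg d (p n) (q n) \<and> A \<circ> G n \<circ> C = rat_map (p n) (q n)"
    using fam G by blast
  obtain r s where K: "fibre_family d P Q X' \<psi> r s"
    and rs: "\<forall>\<^sub>F n in sequentially. nondeg d (r n) (s n) \<and> A \<circ> H n \<circ> C = rat_map (r n) (s n)"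
    using fam H by blast
  have fin: "\<exists>\<alpha>. inv C a = Some \<alpha>" if "a \<in> J" for a
  proof -
    have "A (f a) \<noteq> None" using bspec[OF X' J(2)[OF that]] by auto
    from finite_coordinate[OF AC(2) N this] show ?thesis by blast
  qed
  define J' where "J' = (\<lambda>a. the (inv C a)) ` J"
  have inj: "inj_on (\<lambda>a. the (inv C a)) J"
  proof (rule inj_onI)
    fix a b assume ab: "a \<in> J" "b \<in> J" "the (inv C a) = the (inv C b)"
    then have "inv C a = inv C b" using fin[OF ab(1)] fin[OF ab(2)] by auto
    then show "a = b" using mobius_inv_apply(2)[OF AC(2)] by metis
  qed
  have "\<forall>\<^sub>F n in sequentially. p n * s n = r n * q n"
  proof (rule same_branching_imp_equal[OF F K W])
    show "card J' = 3" unfolding J'_def using card_image[OF inj] J(1) by simp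
    fix \<alpha> assume "\<alpha> \<in> J'"
    then obtain a where a: "a \<in> J" "\<alpha> = the (inv C a)" by (auto simp: J'_def)
    then have \<alpha>: "inv C a = Some \<alpha>" "C (Some \<alpha>) = a" using fin[OF a(1)] mobius_inv_apply(2)[OF AC(2), of a] by auto
    obtain \<xi> where \<xi>: "\<xi> \<in> X'" "A (f a) = Some \<xi>" "\<forall>\<^sub>F n in sequentially. A (\<phi> n (f a)) = Some (\<psi> n \<xi>)"
      using bspec[OF X' J(2)[OF a(1)]] by blast
    obtain c where c: "sconv c a sequentially" "\<forall>\<^sub>F n in sequentially. G n (c n) = \<phi> n (f a) \<and> H n (c n) = \<phi> n (f a)"
      using J(3)[OF a(1)] by blast
    have "sconv (\<lambda>n. inv C (c n)) (Some \<alpha>) sequentially"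
      using sphere_contD[OF mobius_sphere_cont[OF mobius_inverse(2)[OF AC(2)]] c(1)] by (simp add: \<alpha>)
    note c' = sconv_SomeD[OF this]
    have "rat_map P Q (Some \<alpha>) = Some \<xi>" using fun_cong[OF n(2), of "Some \<alpha>"] \<alpha> \<xi> by simp
    then have 1: "\<alpha> \<in> fibre P Q \<xi>" by (simp add: fibre_def rat_map_eq_Some_iff[OF n(1)])
    have 2: "\<forall>\<^sub>F n in sequentially. the (inv C (c n)) \<in> fibre (p n) (q n) (\<psi> n \<xi>) \<and> the (inv C (c n)) \<in> fibre (r n) (s n) (\<psi> n \<xi>)"
      using pq rs \<xi>(3) c(2) c'(1)
    proof eventually_elim
      case (elim n)
      have "rat_map (p n) (q n) (inv C (c n)) = Some (\<psi> n \<xi>)" "rat_map (r n) (s n) (inv C (c n)) = Some (\<psi> n \<xi>)"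
        using elim(3,4) fun_cong[OF conjunct2[OF elim(1)], of "inv C (c n)"] fun_cong[OF conjunct2[OF elim(2)], of "inv C (c n)"]
        by (simp_all add: mobius_inv_apply(2)[OF AC(2)])
      then have "rat_map (p n) (q n) (Some (the (inv C (c n)))) = Some (\<psi> n \<xi>)"
        "rat_map (r n) (s n) (Some (the (inv C (c n)))) = Some (\<psi> n \<xi>)"
        unfolding elim(5)[symmetric] .
      then show ?case unfolding fibre_def
        using elim(1,2) rat_map_eq_Some_iff[of d "p n" "q n"] rat_map_eq_Some_iff[of d "r n" "s n"] by blast
    qed
    show "\<exists>x\<in>X'. \<alpha> \<in> fibre P Q x \<and> (\<exists>c. c \<longlonglongrightarrow> \<alpha> \<and>
        (\<forall>\<^sub>F n in sequentially. c n \<in> fibre (p n) (q n) (\<psi> n x) \<and> c n \<in> fibre (r n) (s n) (\<psi> n x)))"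
      using \<xi>(1) 1 2 c'(2) by blast
  qed
  then show ?thesis using pq rs
  proof eventually_elim
    case (elim n)
    then have "rat_map (p n) (q n) = rat_map (r n) (s n)" using rat_map_eqI by blast
    then have eq: "A \<circ> G n \<circ> C = A \<circ> H n \<circ> C" using elim(2,3) by simp
    show ?case
    proof
      fix x show "G n x = H n x"
        using fun_cong[OF eq, of "inv C x"] by (simp add: mobius_inv_apply[OF AC(2)] mobius_inj[OF AC(1)])
    qed
  qed
qed

text \<open>Although \<open>a\<close> may be critical, its preimage under the perturbed map is a single point of the same multiplicity, because
the critical value moves along with it.\<close>

lemma preimage_unique:
  assumes f: "rat_deg d f" "d \<ge> 1" and X: "finite X" "critical_values f \<subseteq> X"
    and \<phi>: "\<And>x. x \<in> X \<Longrightarrow> sconv (\<lambda>n. \<phi> n x) x sequentially"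
    and G: "cconv G f" "\<forall>\<^sub>F n in sequentially. (\<exists>e. rat_deg e (G n)) \<and> critical_values (G n) \<subseteq> \<phi> n ` X"
    and a: "f a \<in> X"
    and c: "sconv c a sequentially" "\<forall>\<^sub>F n in sequentially. G n (c n) = \<phi> n (f a)"
    and c': "sconv c' a sequentially" "\<forall>\<^sub>F n in sequentially. G n (c' n) = \<phi> n (f a)"
  shows "\<forall>\<^sub>F n in sequentially. c n = c' n"
proof -
  obtain A C P Q X' \<psi> where AC: "mobius A" "mobius C" and n: "nondeg d P Q" "A \<circ> f \<circ> C = rat_map P Q"
    and "degree (wronskian P Q) \<ge> 2 * d - 2" and N: "(A \<circ> f \<circ> C) None = None"
    and X': "\<forall>x\<in>X. \<exists>\<xi>\<in>X'. A x = Some \<xi> \<and> (\<forall>\<^sub>F n in sequentially. A (\<phi> n x) = Some (\<psi> n \<xi>))"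
    and fam: "\<forall>G. cconv G f \<and> (\<forall>\<^sub>F n in sequentially. (\<exists>e. rat_deg e (G n)) \<and> critical_values (G n) \<subseteq> \<phi> n ` X) \<longrightarrow>
       (\<exists>p q. fibre_family d P Q X' \<psi> p q \<and> (\<forall>\<^sub>F n in sequentially. nondeg d (p n) (q n) \<and> A \<circ> G n \<circ> C = rat_map (p n) (q n)))"
    using normal_fibre_family[OF f X ballI[OF \<phi>]] .
  obtain p q where F: "fibre_family d P Q X' \<psi> p q"
    and pq: "\<forall>\<^sub>F n in sequentially. nondeg d (p n) (q n) \<and> A \<circ> G n \<circ> C = rat_map (p n) (q n)"
    using fam G by blast
  interpret F: fibre_family d P Q X' \<psi> p q by (rule F)
  obtain \<alpha> where \<alpha>: "\<And>a. a \<in> F.A \<Longrightarrow> (\<lambda>n. \<alpha> n a) \<longlonglongrightarrow> a"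
    "\<forall>\<^sub>F n in sequentially. \<forall>x\<in>X'. F.Rn n x
       = smult (lead_coeff (F.Rn n x)) (\<Prod>a\<in>fibre P Q x. [:- \<alpha> n a, 1:] ^ Suc (order a (wronskian P Q)))"
    using F.fibre_structure by blast
  obtain \<xi> where \<xi>: "\<xi> \<in> X'" "A (f a) = Some \<xi>" "\<forall>\<^sub>F n in sequentially. A (\<phi> n (f a)) = Some (\<psi> n \<xi>)"
    using bspec[OF X' a] by blast
  obtain \<gamma> where \<gamma>: "inv C a = Some \<gamma>" and C\<gamma>: "C (Some \<gamma>) = a"
    using finite_coordinate[OF AC(2) N, of a] \<xi>(2) by auto
  have "rat_map P Q (Some \<gamma>) = Some \<xi>" using fun_cong[OF n(2), of "Some \<gamma>"] C\<gamma> \<xi> by simp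
  then have \<gamma>f: "\<gamma> \<in> fibre P Q \<xi>" by (simp add: fibre_def rat_map_eq_Some_iff[OF n(1)])
  have key: "\<forall>\<^sub>F n in sequentially. inv C (b n) = Some (\<alpha> n \<gamma>)"
    if b: "sconv b a sequentially" "\<forall>\<^sub>F n in sequentially. G n (b n) = \<phi> n (f a)" for b
  proof -
    have "sconv (\<lambda>n. inv C (b n)) (Some \<gamma>) sequentially"
      using sphere_contD[OF mobius_sphere_cont[OF mobius_inverse(2)[OF AC(2)]] b(1)] by (simp add: \<gamma>)
    note b' = sconv_SomeD[OF this]
    have "\<forall>\<^sub>F n in sequentially. poly (F.Rn n \<xi>) (the (inv C (b n))) = 0"
      using pq \<xi>(3) b(2) b'(1)
    proof eventually_elim
      case (elim n)
      have "rat_map (p n) (q n) (inv C (b n)) = Some (\<psi> n \<xi>)"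
        using elim(2,3) fun_cong[OF conjunct2[OF elim(1)], of "inv C (b n)"] by (simp add: mobius_inv_apply(2)[OF AC(2)])
      then have "rat_map (p n) (q n) (Some (the (inv C (b n)))) = Some (\<psi> n \<xi>)"
        unfolding elim(4)[symmetric] .
      then show ?case using elim(1) rat_map_eq_Some_iff[of d "p n" "q n"] by blast
    qed
    then have "\<forall>\<^sub>F n in sequentially. the (inv C (b n)) = \<alpha> n \<gamma>"
      by (intro F.fibre_root_unique[OF _ \<alpha>(2) \<xi>(1) \<gamma>f b'(2)] \<alpha>(1))
    then show ?thesis using b'(1) by eventually_elim metis
  qed
  from key[OF c] key[OF c'] show ?thesis
    by eventually_elim (metis mobius_inv_apply(2)[OF AC(2)])
qed

section \<open>Moebius maps through three points\<close>

lemma cconv_cong: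
  assumes "cconv F f" "\<forall>\<^sub>F n in sequentially. F n = G n"
  shows "cconv G f"
  unfolding cconv_def
proof
  fix a
  have "\<forall>\<^sub>F k in sequentially \<times>\<^sub>F sphere_nhds a. F (fst k) = G (fst k)"
    by (rule eventually_compose_filterlim[OF assms(2) filterlim_fst])
  then have ev: "\<forall>\<^sub>F k in sequentially \<times>\<^sub>F sphere_nhds a. F (fst k) (snd k) = G (fst k) (snd k)"
    by eventually_elim simp
  have "sconv (\<lambda>k. F (fst k) (snd k)) (f a) (sequentially \<times>\<^sub>F sphere_nhds a)"
    using assms(1) by (simp add: cconv_def case_prod_unfold)
  from sconv_cong[OF this ev] show "sconv (\<lambda>(n, y). G n y) (f a) (sequentially \<times>\<^sub>F sphere_nhds a)"
    by (simp add: case_prod_unfold)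
qed

text \<open>Homogeneous coordinates can be chosen convergent by using one chart throughout.\<close>

lemma sconv_representatives:
  assumes "sconv x a sequentially"
  obtains u v u0 v0 where "u \<longlonglongrightarrow> u0" "v \<longlonglongrightarrow> v0" "u0 \<noteq> 0 \<or> v0 \<noteq> 0" "a = proj u0 v0"
    "\<forall>\<^sub>F n in sequentially. (u n \<noteq> 0 \<or> v n \<noteq> 0) \<and> x n = proj (u n) (v n)"
proof (cases "a = None")
  case True
  show ?thesis
  proof
    show "(\<lambda>_. 1) \<longlonglongrightarrow> (1::complex)" by simp
    show "(\<lambda>n. chart a (x n)) \<longlonglongrightarrow> chart a a" by (rule sconv_chart(1)[OF assms])
    show "(1::complex) \<noteq> 0 \<or> chart a a \<noteq> 0" by simp
    show "a = proj 1 (chart a a)" using chart_inv_chart_self[of a] True by (simp add: chart_inv_proj)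
    show "\<forall>\<^sub>F n in sequentially. ((1::complex) \<noteq> 0 \<or> chart a (x n) \<noteq> 0) \<and> x n = proj 1 (chart a (x n))"
      using sconv_chart(2)[OF assms] by eventually_elim (simp add: chart_inv_proj True)
  qed
next
  case False
  show ?thesis
  proof (rule that[of "\<lambda>n. chart a (x n)" "chart a a" "\<lambda>_. 1" 1])
    show "(\<lambda>n. chart a (x n)) \<longlonglongrightarrow> chart a a" by (rule sconv_chart(1)[OF assms])
    show "(\<lambda>_. 1) \<longlonglongrightarrow> (1::complex)" by simp
    show "chart a a \<noteq> 0 \<or> (1::complex) \<noteq> 0" by simp
    show "a = proj (chart a a) 1" using chart_inv_chart_self[of a] False by (simp add: chart_inv_proj)
    show "\<forall>\<^sub>F n in sequentially. (chart a (x n) \<noteq> 0 \<or> (1::complex) \<noteq> 0) \<and> x n = proj (chart a (x n)) 1"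
      using sconv_chart(2)[OF assms] False by (auto elim!: eventually_mono simp: chart_inv_proj)
  qed
qed

definition det2 :: "complex \<Rightarrow> complex \<Rightarrow> complex \<Rightarrow> complex \<Rightarrow> complex" where
  "det2 a b c d = a * d - b * c"

text \<open>The map that takes \<open>0, 1, \<infinity>\<close> to \<open>[a : a'], [b : b'], [c : c']\<close>. Its matrix has columns proportional to the
vectors \<open>c\<close> and \<open>a\<close>, scaled such that their sum is proportional to \<open>b\<close>; being polynomial in the data, it depends
continuously on the three points.\<close>

definition lin_triple :: "complex \<Rightarrow> complex \<Rightarrow> complex \<Rightarrow> complex \<Rightarrow> complex \<Rightarrow> complex \<Rightarrow> sphere \<Rightarrow> sphere" where
  "lin_triple a a' b b' c c' = lin (det2 b b' a a' * c) (det2 c c' b b' * a) (det2 b b' a a' * c') (det2 c c' b b' * a')"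

lemma lin_triple_values:
  assumes "a \<noteq> 0 \<or> a' \<noteq> 0" "b \<noteq> 0 \<or> b' \<noteq> 0" "c \<noteq> 0 \<or> c' \<noteq> 0"
    and ne: "proj a a' \<noteq> proj b b'" "proj b b' \<noteq> proj c c'" "proj a a' \<noteq> proj c c'"
  shows "(det2 b b' a a' * c) * (det2 c c' b b' * a') - (det2 c c' b b' * a) * (det2 b b' a a' * c') \<noteq> 0"
    "lin_triple a a' b b' c c' (Some 0) = proj a a'" "lin_triple a a' b b' c c' (Some 1) = proj b b'" "lin_triple a a' b b' c c' None = proj c c'"
proof -
  have d: "det2 b b' a a' \<noteq> 0" "det2 c c' b b' \<noteq> 0" "det2 c c' a a' \<noteq> 0"
    using ne assms(1-3) unfolding det2_def by (simp_all add: proj_eq_iff mult.commute)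
  have "(det2 b b' a a' * c) * (det2 c c' b b' * a') - (det2 c c' b b' * a) * (det2 b b' a a' * c')
     = det2 b b' a a' * det2 c c' b b' * det2 c c' a a'"
    by (simp add: det2_def algebra_simps)
  with d show nz: "(det2 b b' a a' * c) * (det2 c c' b b' * a') - (det2 c c' b b' * a) * (det2 b b' a a' * c') \<noteq> 0" by simp
  have r: "Some 0 = proj 0 1" "Some 1 = proj 1 1" "None = proj 1 0" by (simp_all add: proj_def)
  show "lin_triple a a' b b' c c' (Some 0) = proj a a'"
    unfolding r lin_triple_def using lin_proj(1)[OF nz, of 0 1] proj_scale[OF d(2), of a a'] by simp
  show "lin_triple a a' b b' c c' None = proj c c'"
    unfolding r lin_triple_def using lin_proj(1)[OF nz, of 1 0] proj_scale[OF d(1), of c c'] by simp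
  have e: "det2 b b' a a' * c * 1 + det2 c c' b b' * a * 1 = det2 c c' a a' * b"
    "det2 b b' a a' * c' * 1 + det2 c c' b b' * a' * 1 = det2 c c' a a' * b'"
    by (simp_all add: det2_def algebra_simps)
  have "lin_triple a a' b b' c c' (proj 1 1) = proj (det2 c c' a a' * b) (det2 c c' a a' * b')"
    unfolding lin_triple_def e[symmetric] by (rule lin_proj(1)[OF nz]) simp
  then show "lin_triple a a' b b' c c' (Some 1) = proj b b'" unfolding r(2) by (simp add: proj_scale[OF d(3)])
qed

lemma lin_inv: "a * d - b * c \<noteq> 0 \<Longrightarrow> inv (lin a b c d) = lin d (- b) (- c) a"
  by (rule inv_unique_comp[OF lin_inverse(2,1)])

text \<open>The inverses are included, since they are given by the adjugate matrix and converge for the same reason.\<close>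

lemma mobius_triple:
  assumes ne: "a \<noteq> b" "b \<noteq> c" "a \<noteq> c"
    and x: "sconv x a sequentially" and y: "sconv y b sequentially" and z: "sconv z c sequentially"
  obtains T Tn where "mobius T" "T (Some 0) = a" "T (Some 1) = b" "T None = c"
    "cconv Tn T" "cconv (\<lambda>n. inv (Tn n)) (inv T)"
    "\<forall>\<^sub>F n in sequentially. mobius (Tn n) \<and> Tn n (Some 0) = x n \<and> Tn n (Some 1) = y n \<and> Tn n None = z n"
proof -
  obtain x1 x2 a1 a2 where X: "x1 \<longlonglongrightarrow> a1" "x2 \<longlonglongrightarrow> a2" "a1 \<noteq> 0 \<or> a2 \<noteq> 0" "a = proj a1 a2"
    "\<forall>\<^sub>F n in sequentially. (x1 n \<noteq> 0 \<or> x2 n \<noteq> 0) \<and> x n = proj (x1 n) (x2 n)"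
    using sconv_representatives[OF x] .
  obtain y1 y2 b1 b2 where Y: "y1 \<longlonglongrightarrow> b1" "y2 \<longlonglongrightarrow> b2" "b1 \<noteq> 0 \<or> b2 \<noteq> 0" "b = proj b1 b2"
    "\<forall>\<^sub>F n in sequentially. (y1 n \<noteq> 0 \<or> y2 n \<noteq> 0) \<and> y n = proj (y1 n) (y2 n)"
    using sconv_representatives[OF y] .
  obtain z1 z2 c1 c2 where Z: "z1 \<longlonglongrightarrow> c1" "z2 \<longlonglongrightarrow> c2" "c1 \<noteq> 0 \<or> c2 \<noteq> 0" "c = proj c1 c2"
    "\<forall>\<^sub>F n in sequentially. (z1 n \<noteq> 0 \<or> z2 n \<noteq> 0) \<and> z n = proj (z1 n) (z2 n)"
    using sconv_representatives[OF z] .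
  define Tn where "Tn n = lin_triple (x1 n) (x2 n) (y1 n) (y2 n) (z1 n) (z2 n)" for n
  define T where "T = lin_triple a1 a2 b1 b2 c1 c2"
  note t = lin_triple_values[OF X(3) Y(3) Z(3) ne[unfolded X(4) Y(4) Z(4)]]
  have L: "(\<lambda>n. det2 (y1 n) (y2 n) (x1 n) (x2 n)) \<longlonglongrightarrow> det2 b1 b2 a1 a2"
    "(\<lambda>n. det2 (z1 n) (z2 n) (y1 n) (y2 n)) \<longlonglongrightarrow> det2 c1 c2 b1 b2"
    unfolding det2_def by (intro tendsto_intros X Y Z)+
  have c: "cconv Tn T" unfolding Tn_def[abs_def] T_def lin_triple_def
    by (rule cconv_lin(1)[OF t(1)]) (intro tendsto_mult L X Y Z)+
  have nzn: "\<forall>\<^sub>F n in sequentially. (det2 (y1 n) (y2 n) (x1 n) (x2 n) * z1 n) * (det2 (z1 n) (z2 n) (y1 n) (y2 n) * x2 n)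
      - (det2 (z1 n) (z2 n) (y1 n) (y2 n) * x1 n) * (det2 (y1 n) (y2 n) (x1 n) (x2 n) * z2 n) \<noteq> 0"
    by (rule cconv_lin(2)[OF t(1)]) (intro tendsto_mult L X Y Z)+
  have nzi: "det2 c1 c2 b1 b2 * a2 * (det2 b1 b2 a1 a2 * c1) - - (det2 c1 c2 b1 b2 * a1) * - (det2 b1 b2 a1 a2 * c2) \<noteq> 0"
    using t(1) by (simp add: mult.commute)
  have "cconv (\<lambda>n. lin (det2 (z1 n) (z2 n) (y1 n) (y2 n) * x2 n) (- (det2 (z1 n) (z2 n) (y1 n) (y2 n) * x1 n))
      (- (det2 (y1 n) (y2 n) (x1 n) (x2 n) * z2 n)) (det2 (y1 n) (y2 n) (x1 n) (x2 n) * z1 n)) (inv T)"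
    unfolding T_def lin_triple_def lin_inv[OF t(1)]
    by (rule cconv_lin(1)[OF nzi]) (intro tendsto_minus tendsto_mult L X Y Z)+
  then have ci: "cconv (\<lambda>n. inv (Tn n)) (inv T)"
  proof (rule cconv_cong)
    show "\<forall>\<^sub>F n in sequentially. lin (det2 (z1 n) (z2 n) (y1 n) (y2 n) * x2 n) (- (det2 (z1 n) (z2 n) (y1 n) (y2 n) * x1 n))
      (- (det2 (y1 n) (y2 n) (x1 n) (x2 n) * z2 n)) (det2 (y1 n) (y2 n) (x1 n) (x2 n) * z1 n) = inv (Tn n)"
      using nzn unfolding Tn_def lin_triple_def by eventually_elim (rule lin_inv[symmetric])
  qed
  have ev: "\<forall>\<^sub>F n in sequentially. mobius (Tn n) \<and> Tn n (Some 0) = x n \<and> Tn n (Some 1) = y n \<and> Tn n None = z n"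
    using X(5) Y(5) Z(5) sconv_eventually_neq[OF x y ne(1)] sconv_eventually_neq[OF y z ne(2)] sconv_eventually_neq[OF x z ne(3)]
  proof eventually_elim
    case (elim n)
    have "x1 n \<noteq> 0 \<or> x2 n \<noteq> 0" "y1 n \<noteq> 0 \<or> y2 n \<noteq> 0" "z1 n \<noteq> 0 \<or> z2 n \<noteq> 0"
      "proj (x1 n) (x2 n) \<noteq> proj (y1 n) (y2 n)" "proj (y1 n) (y2 n) \<noteq> proj (z1 n) (z2 n)" "proj (x1 n) (x2 n) \<noteq> proj (z1 n) (z2 n)"
      using elim by metis+
    note tn = lin_triple_values[OF this]
    have "mobius (Tn n)" unfolding mobius_lin Tn_def lin_triple_def using tn(1) by (intro exI conjI) (rule refl | assumption)+
    then show ?case using tn(2-4) elim(1-3) by (simp add: Tn_def)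
  qed
  have m: "mobius T" unfolding mobius_lin T_def lin_triple_def using t(1) by (intro exI conjI) (rule refl | assumption)+
  show ?thesis
    by (rule that[OF m _ _ _ c ci ev]) (simp_all only: T_def t X(4) Y(4) Z(4))
qed

lemma mobius_move:
  assumes ne: "a \<noteq> b" "b \<noteq> c" "a \<noteq> c"
    and "sconv x a sequentially" "sconv y b sequentially" "sconv z c sequentially"
  obtains K where "cconv K id" "cconv (\<lambda>n. inv (K n)) id"
    "\<forall>\<^sub>F n in sequentially. mobius (K n) \<and> K n a = x n \<and> K n b = y n \<and> K n c = z n"
proof -
  obtain T Tn where T: "mobius T" "T (Some 0) = a" "T (Some 1) = b" "T None = c"
    "cconv Tn T" "cconv (\<lambda>n. inv (Tn n)) (inv T)"
    and ev: "\<forall>\<^sub>F n in sequentially. mobius (Tn n) \<and> Tn n (Some 0) = x n \<and> Tn n (Some 1) = y n \<and> Tn n None = z n"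
    using mobius_triple[OF assms] .
  note Ti = mobius_inverse[OF T(1)]
  have iT: "inv T a = Some 0" "inv T b = Some 1" "inv T c = None"
    using mobius_inv_apply(1)[OF T(1)] T(2-4) by metis+
  have "cconv (\<lambda>n. Tn n \<circ> inv T) (T \<circ> inv T)" "cconv (\<lambda>n. T \<circ> inv (Tn n)) (T \<circ> inv T)"
    by (intro cconv_comp T cconv_const mobius_sphere_cont Ti(2))+
  then have c1: "cconv (\<lambda>n. Tn n \<circ> inv T) id" and c2: "cconv (\<lambda>n. T \<circ> inv (Tn n)) id" by (simp_all only: Ti(4))
  have "\<forall>\<^sub>F n in sequentially. T \<circ> inv (Tn n) = inv (Tn n \<circ> inv T)"
    using ev
  proof eventually_elim
    case (elim n)
    note m = mobius_inverse[OF conjunct1[OF elim]]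
    show ?case using o_inv_distrib[OF m(1) mobius_inverse(1)[OF Ti(2)]] by (simp add: inv_inv_eq[OF Ti(1)])
  qed
  from cconv_cong[OF c2 this] have c3: "cconv (\<lambda>n. inv (Tn n \<circ> inv T)) id" .
  have "\<forall>\<^sub>F n in sequentially. mobius (Tn n \<circ> inv T) \<and> (Tn n \<circ> inv T) a = x n \<and> (Tn n \<circ> inv T) b = y n \<and> (Tn n \<circ> inv T) c = z n"
    using ev by eventually_elim (simp add: mobius_comp Ti(2) iT)
  with c1 c3 show ?thesis by (rule that)
qed

lemma mobius_through:
  assumes "a \<noteq> b" "b \<noteq> c" "a \<noteq> c"
  obtains T where "mobius T" "T (Some 0) = a" "T (Some 1) = b" "T None = c"
  using mobius_triple[OF assms sconv_const sconv_const sconv_const] by metis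

section \<open>Maps with prescribed critical values\<close>

definition square_map :: "sphere \<Rightarrow> sphere" where "square_map = rat_map [:0, 0, 1:] 1"

lemma nondeg_square_map: "nondeg 2 [:0, 0, 1:] 1"
  unfolding nondeg_iff by simp

lemma rat_deg_square_map: "rat_deg 2 square_map" unfolding rat_deg_def square_map_def using nondeg_square_map by blast

lemma square_map_simps: "square_map None = None" "square_map (Some z) = Some (z\<^sup>2)"
  by (simp_all add: square_map_def rat_map_def Let_def power2_eq_square)

lemma critical_points_square_map: "critical_points square_map = {Some 0, None}"
proof -
  have "Some z \<in> critical_points square_map \<longleftrightarrow> z = 0" for z
    unfolding square_map_def critical_Some_iff[OF nondeg_square_map] by (simp add: wronskian_def pderiv_pCons)
  moreover have "None \<in> critical_points square_map"
    unfolding square_map_def critical_rat_map_iff[OF nondeg_square_map] chart_poly_def wronskian_def poly_diff poly_mult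
    unfolding chart_None_None poly_0_coeff_0 by (simp add: coeff_pderiv coeff_rev_poly)
  ultimately show ?thesis by (auto simp: set_eq_iff split_option_all)
qed

lemma critical_values_square_map: "critical_values square_map = {Some 0, None}"
  by (simp add: critical_values_def critical_points_square_map square_map_simps)

lemma critical_values_mobius_left: "rat_deg d f \<Longrightarrow> mobius A \<Longrightarrow> critical_values (A \<circ> f) = A ` critical_values f"
  using critical_values_mobius_comp[of d f A id] mobius_id by simp

lemma third_point: "\<exists>z :: sphere. z \<noteq> x \<and> z \<noteq> y"
proof -
  have "infinite (UNIV :: sphere set)" by (simp add: finite_option_UNIV infinite_UNIV_char_0)
  then obtain z where "z \<notin> {x, y}" using ex_new_if_finite[of "{x, y}"] by blast
  then show ?thesis by blast
qed

text \<open>Induction on the number of points. A Moebius map after squaring has two critical values \<open>x\<^sub>1, x\<^sub>2\<close>. For the others,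
precompose with a map \<open>h\<close> whose critical values are one preimage of each remaining point and the critical point \<open>0\<close>
over \<open>x\<^sub>1\<close>: these are fewer by one, and including \<open>0\<close> keeps their number at least two. The construction follows
a perturbation \<open>\<phi>\<close> of the points step by step, which is the second half of the claim.\<close>

theorem prescribed_critical_values:
  assumes "finite X" "card X \<ge> 2"
  shows "\<exists>h d. d \<ge> 2 \<and> rat_deg d h \<and> critical_values h = X \<and>
    (\<forall>\<phi>. (\<forall>x\<in>X. sconv (\<lambda>n. \<phi> n x) x sequentially) \<longrightarrow>
      (\<exists>H. cconv H h \<and> (\<forall>\<^sub>F n in sequentially. rat_deg d (H n) \<and> critical_values (H n) = \<phi> n ` X)))"
  using assms
proof (induction "card X" arbitrary: X rule: less_induct)
  case less
  obtain x1 x2 where x12: "x1 \<in> X" "x2 \<in> X" "x1 \<noteq> x2"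
    using less.prems card_le_Suc0_iff_eq[OF less.prems(1)] by (metis One_nat_def Suc_1 not_less_eq_eq)
  obtain x3 where x3: "x3 \<noteq> x1" "x3 \<noteq> x2" using third_point by blast
  obtain T where T: "mobius T" "T (Some 0) = x1" "T (Some 1) = x3" "T None = x2"
    using mobius_through[OF x3(1)[symmetric] x3(2) x12(3)] .
  define g where "g = T \<circ> square_map"
  have rg: "rat_deg 2 g" unfolding g_def using rat_deg_comp[OF mobius_rat_deg[OF T(1)] rat_deg_square_map] by simp
  have Vg: "critical_values g = {x1, x2}"
    unfolding g_def critical_values_mobius_left[OF rat_deg_square_map T(1)] critical_values_square_map by (simp add: T)
  have g0: "g (Some 0) = x1" by (simp add: g_def square_map_simps T)
  \<comment> \<open>The case of two points with its perturbation; the third point \<open>x3\<close> only pins down the Moebius map.\<close>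
  have near: "\<exists>Gn. cconv Gn g \<and> (\<forall>\<^sub>F n in sequentially. rat_deg 2 (Gn n) \<and> critical_values (Gn n) = {\<phi> n x1, \<phi> n x2}
      \<and> Gn n (Some 0) = \<phi> n x1)"
    if \<phi>: "\<forall>x\<in>X. sconv (\<lambda>n. \<phi> n x) x sequentially" for \<phi>
  proof -
    obtain K where K: "cconv K id" "cconv (\<lambda>n. inv (K n)) id"
      and ev: "\<forall>\<^sub>F n in sequentially. mobius (K n) \<and> K n x1 = \<phi> n x1 \<and> K n x3 = x3 \<and> K n x2 = \<phi> n x2"
      using mobius_move[OF x3(1)[symmetric] x3(2) x12(3) bspec[OF \<phi> x12(1)] sconv_const bspec[OF \<phi> x12(2)]] .
    have "cconv (\<lambda>n. K n \<circ> g) (id \<circ> g)" by (intro cconv_comp K cconv_const sphere_cont_rat[OF rg])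
    then have "cconv (\<lambda>n. K n \<circ> g) g" by simp
    moreover have "\<forall>\<^sub>F n in sequentially. rat_deg 2 (K n \<circ> g) \<and> critical_values (K n \<circ> g) = {\<phi> n x1, \<phi> n x2} \<and> (K n \<circ> g) (Some 0) = \<phi> n x1"
      using ev
    proof eventually_elim
      case (elim n)
      then have m: "mobius (K n)" by blast
      have "rat_deg 2 (K n \<circ> g)" using rat_deg_comp[OF mobius_rat_deg[OF m] rg] by simp
      moreover have "critical_values (K n \<circ> g) = {\<phi> n x1, \<phi> n x2}"
        unfolding critical_values_mobius_left[OF rg m] Vg using elim by simp
      ultimately show ?case using elim by (simp add: g0)
    qed
    ultimately show ?thesis by blast
  qed
  show ?case
  proof (cases "card X = 2")
    case True
    then have X: "X = {x1, x2}" using x12 less.prems(1) card_subset_eq[of X "{x1, x2}"] by simp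
    have "\<exists>H. cconv H g \<and> (\<forall>\<^sub>F n in sequentially. rat_deg 2 (H n) \<and> critical_values (H n) = \<phi> n ` X)"
      if \<phi>: "\<forall>x\<in>X. sconv (\<lambda>n. \<phi> n x) x sequentially" for \<phi>
    proof -
      obtain Gn where Gn: "cconv Gn g" "\<forall>\<^sub>F n in sequentially. rat_deg 2 (Gn n) \<and> critical_values (Gn n) = {\<phi> n x1, \<phi> n x2}
      \<and> Gn n (Some 0) = \<phi> n x1" using near[OF \<phi>] by blast
      from Gn(2) have "\<forall>\<^sub>F n in sequentially. rat_deg 2 (Gn n) \<and> critical_values (Gn n) = \<phi> n ` X"
        by eventually_elim (simp add: X)
      with Gn(1) show ?thesis by blast
    qed
    then show ?thesis using rg Vg X by (intro exI[of _ g] exI[of _ 2]) simp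
  next
    case False
    define Z where "Z = X - {x1, x2}"
    have XZ: "X = {x1, x2} \<union> Z" "x1 \<notin> Z" "x2 \<notin> Z" "finite Z" using x12 less.prems(1) by (auto simp: Z_def)
    have cZ: "card X = card Z + 2" using XZ x12 by (simp add: card_Un_disjoint)
    have "\<exists>w. g w = x" for x using rat_deg_surj[OF rg] by (metis one_le_numeral)
    then obtain w where w: "\<And>x. g (w x) = x" by metis
    define Y where "Y = insert (Some 0) (w ` Z)"
    have w0: "Some 0 \<notin> w ` Z" using w g0 XZ(2) by (metis imageE)
    have "card (w ` Z) = card Z" by (rule card_image) (metis inj_onI w)
    then have cY: "card Y = card Z + 1" "finite Y" using w0 XZ(4) by (simp_all add: Y_def)
    have "card Y < card X" "card Y \<ge> 2" using cY(1) cZ False less.prems(2) by auto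
    from less.hyps[OF this(1) cY(2) this(2)] obtain h e where h: "e \<ge> 2" "rat_deg e h" "critical_values h = Y"
      and H: "\<And>\<psi>. \<forall>y\<in>Y. sconv (\<lambda>n. \<psi> n y) y sequentially \<Longrightarrow>
        \<exists>H. cconv H h \<and> (\<forall>\<^sub>F n in sequentially. rat_deg e (H n) \<and> critical_values (H n) = \<psi> n ` Y)" by blast
    have e1: "e \<ge> 1" using h(1) by simp
    have r: "rat_deg (2 * e) (g \<circ> h)" by (rule rat_deg_comp[OF rg h(2)])
    have V: "critical_values (g \<circ> h) = X"
      unfolding critical_values_comp[OF rg h(2) e1] Vg h(3) Y_def XZ(1) by (auto simp: g0 w image_image)
    have "\<exists>H. cconv H (g \<circ> h) \<and> (\<forall>\<^sub>F n in sequentially. rat_deg (2 * e) (H n) \<and> critical_values (H n) = \<phi> n ` X)"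
      if \<phi>: "\<forall>x\<in>X. sconv (\<lambda>n. \<phi> n x) x sequentially" for \<phi>
    proof -
      obtain Gn where Gn: "cconv Gn g" and evG: "\<forall>\<^sub>F n in sequentially. rat_deg 2 (Gn n) \<and> critical_values (Gn n) = {\<phi> n x1, \<phi> n x2}
      \<and> Gn n (Some 0) = \<phi> n x1" using near[OF \<phi>] by blast
      have rGn: "\<forall>\<^sub>F n in sequentially. \<exists>e. rat_deg e (Gn n)" using evG by eventually_elim blast
      have "\<exists>u. sconv u (w x) sequentially \<and> (\<forall>\<^sub>F n in sequentially. Gn n (u n) = \<phi> n x)" if x: "x \<in> Z" for x
      proof -
        have "sconv (\<lambda>n. \<phi> n x) (g (w x)) sequentially" using bspec[OF \<phi>, of x] x XZ(1) by (simp add: w)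
        from preimage_persists[OF rg _ Gn rGn this] show ?thesis by (metis one_le_numeral)
      qed
      then obtain u where u: "\<And>x. x \<in> Z \<Longrightarrow> sconv (u x) (w x) sequentially"
        "\<And>x. x \<in> Z \<Longrightarrow> \<forall>\<^sub>F n in sequentially. Gn n (u x n) = \<phi> n x" by metis
      \<comment> \<open>The perturbation of \<open>Y\<close>: the critical point \<open>0\<close> of \<open>Gn n\<close> stays, the other points follow the preimages of \<open>\<phi> n x\<close>.\<close>
      define \<psi> where "\<psi> n y = (if y = Some 0 then Some 0 else u (g y) n)" for n y
      have \<psi>w: "\<psi> n (w x) = u x n" if "x \<in> Z" for n x
      proof -
        have "w x \<noteq> Some 0" using w0 that by (metis imageI)
        then show ?thesis by (simp add: \<psi>_def w)
      qed
      have \<psi>0: "\<psi> n (Some 0) = Some 0" for n by (simp add: \<psi>_def)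
      have "\<forall>y\<in>Y. sconv (\<lambda>n. \<psi> n y) y sequentially"
        unfolding Y_def
      proof
        fix y assume "y \<in> insert (Some 0) (w ` Z)"
        then consider "y = Some 0" | x where "x \<in> Z" "y = w x" by blast
        then show "sconv (\<lambda>n. \<psi> n y) y sequentially"
          by cases (simp_all add: \<psi>0 \<psi>w sconv_const u(1))
      qed
      from H[OF this] obtain Hn where Hn: "cconv Hn h"
        and evH: "\<forall>\<^sub>F n in sequentially. rat_deg e (Hn n) \<and> critical_values (Hn n) = \<psi> n ` Y" by blast
      have "cconv (\<lambda>n. Gn n \<circ> Hn n) (g \<circ> h)" by (rule cconv_comp[OF Gn Hn])
      moreover have "\<forall>\<^sub>F n in sequentially. \<forall>x\<in>Z. Gn n (u x n) = \<phi> n x"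
        by (rule eventually_ball_finiteI[OF XZ(4) u(2)])
      with evG evH have "\<forall>\<^sub>F n in sequentially. rat_deg (2 * e) (Gn n \<circ> Hn n) \<and> critical_values (Gn n \<circ> Hn n) = \<phi> n ` X"
      proof eventually_elim
        case (elim n)
        have rr: "rat_deg 2 (Gn n)" "rat_deg e (Hn n)" using elim by blast+
        have "\<psi> n ` Y = insert (Some 0) ((\<lambda>x. u x n) ` Z)"
        proof -
          have "(\<lambda>x. \<psi> n (w x)) ` Z = (\<lambda>x. u x n) ` Z" by (rule image_cong) (simp_all add: \<psi>w)
          then show ?thesis by (simp add: Y_def image_image \<psi>0)
        qed
        then have "Gn n ` \<psi> n ` Y = insert (\<phi> n x1) (\<phi> n ` Z)"
          using elim by (simp add: image_image)
        then have "critical_values (Gn n \<circ> Hn n) = \<phi> n ` X"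
          unfolding critical_values_comp[OF rr e1] using elim XZ(1) by auto
        then show ?case using rat_deg_comp[OF rr] by blast
      qed
      ultimately show ?thesis by blast
    qed
    then show ?thesis using r V h(1) by (intro exI[of _ "g \<circ> h"] exI[of _ "2 * e"]) simp
  qed
qed

section \<open>Belyi polynomials\<close>

definition of_rat_poly :: "rat poly \<Rightarrow> complex poly" where
  "of_rat_poly = map_poly of_rat"

lemma coeff_of_rat_poly: "coeff (of_rat_poly p) n = of_rat (coeff p n)"
  by (simp add: of_rat_poly_def coeff_map_poly)

lemma of_rat_poly_add: "of_rat_poly (p + q) = of_rat_poly p + of_rat_poly q"
  by (rule poly_eqI) (simp add: coeff_of_rat_poly of_rat_add)

lemma of_rat_poly_smult: "of_rat_poly (smult c p) = smult (of_rat c) (of_rat_poly p)"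
  by (rule poly_eqI) (simp add: coeff_of_rat_poly of_rat_mult)

lemma of_rat_poly_pCons: "of_rat_poly (pCons c p) = pCons (of_rat c) (of_rat_poly p)"
  by (rule poly_eqI) (simp add: coeff_of_rat_poly coeff_pCons split: nat.splits)

lemma of_rat_poly_0: "of_rat_poly 0 = 0" by (simp add: of_rat_poly_def)

lemma of_rat_poly_mult: "of_rat_poly (p * q) = of_rat_poly p * of_rat_poly q"
  by (induction p) (simp_all add: of_rat_poly_0 of_rat_poly_add of_rat_poly_smult of_rat_poly_pCons)

lemma of_rat_poly_1: "of_rat_poly 1 = 1" by (simp add: of_rat_poly_def)

lemma of_rat_poly_power: "of_rat_poly (p ^ n) = of_rat_poly p ^ n"
  by (induction n) (simp_all add: of_rat_poly_mult of_rat_poly_1)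

lemma of_rat_poly_prod: "of_rat_poly (\<Prod>i\<in>A. f i) = (\<Prod>i\<in>A. of_rat_poly (f i))"
  by (induction A rule: infinite_finite_induct) (simp_all add: of_rat_poly_mult of_rat_poly_1)

lemma of_rat_poly_pderiv: "of_rat_poly (pderiv p) = pderiv (of_rat_poly p)"
  by (rule poly_eqI) (simp add: coeff_of_rat_poly coeff_pderiv of_rat_mult of_rat_add)

lemma of_rat_poly_pcompose: "of_rat_poly (pcompose p q) = pcompose (of_rat_poly p) (of_rat_poly q)"
  by (induction p) (simp_all add: of_rat_poly_0 of_rat_poly_add of_rat_poly_mult of_rat_poly_pCons pcompose_pCons)

lemma degree_of_rat_poly: "degree (of_rat_poly p) = degree p"
  unfolding of_rat_poly_def by (rule degree_map_poly) simp

lemma poly_of_rat_poly: "poly (of_rat_poly p) (of_rat x) = of_rat (poly p x)"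
  by (induction p) (simp_all add: of_rat_poly_0 of_rat_poly_pCons of_rat_add of_rat_mult)

lemma of_rat_poly_dvd_root: "p dvd q \<Longrightarrow> poly (of_rat_poly p) z = 0 \<Longrightarrow> poly (of_rat_poly q) z = 0"
  by (auto simp: dvd_def of_rat_poly_mult)

text \<open>The powers \<open>1, r, ..., r ^ m\<close> are linearly dependent in the \<open>m\<close>-dimensional quotient by \<open>p\<close>, where \<open>m = deg p\<close>.
It takes the place of the minimal polynomials of the values of \<open>r\<close> at the roots of \<open>p\<close>.\<close>

lemma annihilating_polynomial:
  fixes p r :: "rat poly"
  assumes "degree p \<ge> 1"
  obtains s where "s \<noteq> 0" "degree s \<le> degree p" "p dvd pcompose s r"
proof -
  interpret V: vector_space "smult :: rat \<Rightarrow> rat poly \<Rightarrow> rat poly"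
    by unfold_locales (simp_all add: smult_add_right smult_add_left)
  define m where "m = degree p"
  define f where "f k = r ^ k mod p" for k
  have pdvd: "p dvd r ^ k - f k" for k unfolding f_def by (rule dvd_minus_mod)
  have p0: "p \<noteq> 0" using assms by auto
  have dm: "degree (f k) < m" for k
    using degree_mod_less[OF p0, of "r ^ k"] assms by (auto simp: f_def m_def)
  have comp: "pcompose (monom c k) r = smult c (r ^ k)" for c k
    by (induction k) (simp_all add: monom_0 monom_Suc pcompose_pCons)
  have psum: "pcompose (\<Sum>i\<in>A. g i) r = (\<Sum>i\<in>A. pcompose (g i) r)" for A :: "nat set" and g
    by (induction A rule: infinite_finite_induct) (simp_all add: pcompose_add)
  show ?thesis
  \<comment> \<open>If two of the remainders coincide, they give the relation directly; dependence of a set would not see it.\<close>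
  proof (cases "inj_on f {..m}")
    case False
    then obtain i j where ij: "i \<le> m" "j \<le> m" "i \<noteq> j" "f i = f j" by (auto simp: inj_on_def)
    define s where "s = monom (1::rat) i - monom 1 j"
    have "coeff s i = 1" using ij(3) by (simp add: s_def)
    then have "s \<noteq> 0" by auto
    moreover have "degree s \<le> m" unfolding s_def
      using ij degree_monom_le[of "1::rat"] by (intro degree_diff_le) (auto intro: order.trans)
    moreover have "p dvd pcompose s r"
    proof -
      have "pcompose s r = (r ^ i - f i) - (r ^ j - f j)" using ij(4) by (simp add: s_def pcompose_diff comp)
      then show ?thesis using pdvd[of i] pdvd[of j] by (simp only: dvd_diff)
    qed
    ultimately show ?thesis using that by (simp add: m_def)
  next
    case True
    let ?M = "(\<lambda>i. monom (1::rat) i) ` {..<m}"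
    have "f ` {..m} \<subseteq> V.span ?M"
    proof
      fix g assume "g \<in> f ` {..m}"
      then have dg: "degree g < m" using dm by auto
      have "g = (\<Sum>i<m. smult (coeff g i) (monom 1 i))"
        using poly_as_sum_of_monoms'[of g "m - 1"] dg
        by (simp add: smult_monom lessThan_Suc_atMost[symmetric])
      also have "\<dots> \<in> V.span ?M" by (intro V.span_sum V.span_scale V.span_base) auto
      finally show "g \<in> V.span ?M" .
    qed
    moreover have "card ?M \<le> m" using card_image_le[of "{..<m}" "\<lambda>i. monom (1::rat) i"] by simp
    moreover have "card (f ` {..m}) = m + 1" using card_image[OF True] by simp
    ultimately have "V.dependent (f ` {..m})" using V.independent_span_bound[of ?M "f ` {..m}"] by auto
    then obtain u where u: "\<exists>v\<in>f ` {..m}. u v \<noteq> 0" "(\<Sum>v\<in>f ` {..m}. smult (u v) v) = 0"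
      using V.dependent_finite[of "f ` {..m}"] by auto
    define s where "s = (\<Sum>k\<le>m. monom (u (f k)) k)"
    have cs: "coeff s k = (if k \<le> m then u (f k) else 0)" for k by (simp add: s_def coeff_sum)
    have "s \<noteq> 0" using u(1) cs by (metis (no_types, lifting) atMost_iff coeff_0 imageE)
    moreover have "degree s \<le> m" by (rule degree_le) (simp add: cs)
    moreover have "p dvd pcompose s r"
    proof -
      have "pcompose s r = (\<Sum>k\<le>m. smult (u (f k)) (r ^ k))"
        by (simp add: s_def psum comp)
      moreover have "(\<Sum>k\<le>m. smult (u (f k)) (f k)) = 0" using u(2) by (simp add: sum.reindex[OF True])
      ultimately have "pcompose s r = (\<Sum>k\<le>m. smult (u (f k)) (r ^ k - f k))"
        by (simp add: smult_diff_right sum_subtractf)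
      also have "p dvd \<dots>" by (intro dvd_sum dvd_smult pdvd)
      finally show ?thesis .
    qed
    ultimately show ?thesis using that by (simp add: m_def)
  qed
qed

lemma pderiv_pcompose_root:
  "poly (pderiv (pcompose p q)) z = 0 \<longleftrightarrow> poly (pderiv p) (poly q z) = 0 \<or> poly (pderiv q) z = (0 :: complex)"
  by (simp add: pderiv_pcompose poly_pcompose)

text \<open>The first half of Belyi's argument. The polynomial \<open>r\<close> itself makes its roots rational, at the cost of new critical
values; these are roots of a rational polynomial of degree less than \<open>deg r\<close>, to which induction applies.\<close>

lemma algebraic_to_rational:
  fixes r :: "rat poly"
  assumes "degree r \<ge> 1"
  shows "\<exists>B. degree B \<ge> 1 \<and> (\<forall>z. poly (of_rat_poly r) z = 0 \<longrightarrow> poly (of_rat_poly B) z \<in> \<rat>)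
    \<and> (\<forall>z. poly (pderiv (of_rat_poly B)) z = 0 \<longrightarrow> poly (of_rat_poly B) z \<in> \<rat>)"
  using assms
proof (induction "degree r" arbitrary: r rule: less_induct)
  case less
  show ?case
  proof (cases "degree r = 1")
    case True
    obtain b r1 where r1: "r = pCons b r1" by (cases r)
    with True have "r1 \<noteq> 0" "degree r1 = 0" by (auto simp: degree_pCons_eq_if split: if_splits)
    then obtain a where r: "r = [:b, a:]" "a \<noteq> 0" using r1 by (metis degree_eq_zeroE pCons_0_0)
    have "z \<in> \<rat>" if "poly (of_rat_poly r) z = 0" for z
    proof -
      have "of_rat b + z * of_rat a = 0" using that by (simp add: r of_rat_poly_pCons of_rat_poly_0)
      then have "z * of_rat a = of_rat (- b)" by (simp add: of_rat_minus eq_neg_iff_add_eq_0 add.commute)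
      then have "z = of_rat (- b) / of_rat a" using r(2) by (subst eq_divide_eq) simp
      then have "z = of_rat (- b / a)" by (simp only: of_rat_divide)
      then show ?thesis by simp
    qed
    moreover have "of_rat_poly [:0, 1:] = [:0, 1:]" by (simp add: of_rat_poly_pCons of_rat_poly_0)
    ultimately show ?thesis by (intro exI[of _ "[:0, 1:]"]) (simp add: pderiv_pCons)
  next
    case False
    then have dr: "degree (pderiv r) \<ge> 1" "degree (pderiv r) < degree r"
      using less.prems by (simp_all add: degree_pderiv)
    \<comment> \<open>All values of \<open>r\<close> at its critical points are roots of \<open>s\<close>.\<close>
    obtain s where s: "s \<noteq> 0" "degree s \<le> degree (pderiv r)" "pderiv r dvd pcompose s r"
      using annihilating_polynomial[OF dr(1)] .
    have "degree s \<ge> 1"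
    proof (rule ccontr)
      assume "\<not> degree s \<ge> 1"
      then obtain c where "s = [:c:]" by (metis degree_eq_zeroE not_one_le_zero less_one linorder_not_less)
      with s have "pderiv r dvd [:c:]" "c \<noteq> 0" by (auto simp: pcompose_const)
      then have "degree (pderiv r) \<le> degree [:c:]" by (intro dvd_imp_degree_le) auto
      with dr show False by simp
    qed
    from less.hyps[OF _ this] s(2) dr(2) obtain B where B: "degree B \<ge> 1"
      "\<And>z. poly (of_rat_poly s) z = 0 \<Longrightarrow> poly (of_rat_poly B) z \<in> \<rat>" "\<And>z. poly (pderiv (of_rat_poly B)) z = 0 \<Longrightarrow> poly (of_rat_poly B) z \<in> \<rat>"
      by (metis le_less_trans)
    have crB: "poly (of_rat_poly (pcompose B r)) z = poly (of_rat_poly B) (poly (of_rat_poly r) z)" for z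
      by (simp add: of_rat_poly_pcompose poly_pcompose)
    have "poly (of_rat_poly B) 0 \<in> \<rat>" using poly_of_rat_poly[of B 0] by simp
    then have 1: "poly (of_rat_poly (pcompose B r)) z \<in> \<rat>" if "poly (of_rat_poly r) z = 0" for z using that by (simp add: crB)
    have 2: "poly (of_rat_poly (pcompose B r)) z \<in> \<rat>" if z: "poly (pderiv (of_rat_poly (pcompose B r))) z = 0" for z
    proof -
      from z have "poly (pderiv (of_rat_poly B)) (poly (of_rat_poly r) z) = 0 \<or> poly (pderiv (of_rat_poly r)) z = 0"
        unfolding of_rat_poly_pcompose pderiv_pcompose_root .
      then show ?thesis
      proof
        assume "poly (pderiv (of_rat_poly B)) (poly (of_rat_poly r) z) = 0"
        then show ?thesis unfolding crB by (rule B(3))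
      next
        assume "poly (pderiv (of_rat_poly r)) z = 0"
        then have "poly (of_rat_poly (pcompose s r)) z = 0" using of_rat_poly_dvd_root[OF s(3)] by (simp add: of_rat_poly_pderiv)
        then have "poly (of_rat_poly s) (poly (of_rat_poly r) z) = 0" by (simp add: of_rat_poly_pcompose poly_pcompose)
        then show ?thesis unfolding crB by (rule B(2))
      qed
    qed
    have "degree (pcompose B r) \<ge> 1" using B(1) less.prems by (simp add: degree_pcompose)
    with 1 2 show ?thesis by (intro exI[of _ "pcompose B r"]) blast
  qed
qed

text \<open>Belyi's polynomial \<open>x ^ i (1 - x) ^ (j - i)\<close>, transported from \<open>[0, 1]\<close> to \<open>[a, b]\<close> and scaled to take the value \<open>1\<close> at
\<open>c\<close>, where \<open>i / j\<close> is the position of \<open>c\<close> in the interval.\<close>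

lemma belyi_step:
  fixes a b c :: rat
  assumes "a < c" "c < b"
  obtains T where "degree T \<ge> 1" "poly T a = 0" "poly T b = 0" "poly T c = 1"
    "\<And>z. poly (pderiv (of_rat_poly T)) z = 0 \<Longrightarrow> poly (of_rat_poly T) z \<in> {0, 1}"
proof -
  define t where "t = (c - a) / (b - a)"
  have ba: "b - a > 0" using assms by simp
  have t: "0 < t" "t < 1" using assms ba by (simp_all add: t_def)
  obtain i j where q: "quotient_of t = (i, j)" by force
  have ij: "j > 0" "t = of_int i / of_int j"
    using quotient_of_denom_pos[OF q] quotient_of_div[OF q] by auto
  have ij2: "0 < i" "i < j" using t ij by (simp_all add: zero_less_divide_iff divide_less_eq_1)
  \<comment> \<open>The exponents of the derivative: \<open>x ^ m (1 - x) ^ k (i - j x)\<close>, whose last factor vanishes at \<open>t\<close>.\<close>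
  define m k where "m = nat i - 1" and "k = nat (j - i) - 1"
  have mk: "of_nat (Suc m) = (of_int i :: rat)" "of_nat (Suc k) = (of_int (j - i) :: rat)"
    using ij2 by (simp_all add: m_def k_def of_nat_diff)
  define L1 L2 where "L1 = [:- a / (b - a), 1 / (b - a):]" and "L2 = [:b / (b - a), - 1 / (b - a):]"
  have L12: "poly L1 x = (x - a) / (b - a)" "poly L2 x = (b - x) / (b - a)" for x
    by (simp_all add: L1_def L2_def diff_divide_distrib)
  define F where "F = L1 ^ Suc m * L2 ^ Suc k"
  have Fc: "poly F c \<noteq> 0" using assms ba by (simp add: F_def L12)
  define T where "T = smult (1 / poly F c) F"
  have T: "poly T a = 0" "poly T b = 0" "poly T c = 1" using Fc by (simp_all add: T_def) (simp_all add: F_def L12)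
  have dT: "degree T \<ge> 1"
  proof (rule ccontr)
    assume "\<not> degree T \<ge> 1"
    then obtain e where "T = [:e:]" by (metis degree_eq_zeroE less_one linorder_not_less)
    with T show False by simp
  qed
  have cT: "poly (of_rat_poly T) (of_rat x) \<in> {0, 1}" if "x \<in> {a, b, c}" for x
    using that T by (auto simp: poly_of_rat_poly)
  have "poly (of_rat_poly T) z \<in> {0, 1}" if z: "poly (pderiv (of_rat_poly T)) z = 0" for z
  proof -
    have pF: "pderiv F = L1 ^ m * L2 ^ k * (smult (of_nat (Suc m)) L2 * pderiv L1 + smult (of_nat (Suc k)) L1 * pderiv L2)"
      unfolding F_def pderiv_mult pderiv_power_Suc by (simp add: algebra_simps)
    have dL: "pderiv L1 = [:1 / (b - a):]" "pderiv L2 = [:- 1 / (b - a):]"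
      by (simp_all add: L1_def L2_def pderiv_pCons)
    define E where "E = smult (of_nat (Suc m)) L2 * pderiv L1 + smult (of_nat (Suc k)) L1 * pderiv L2"
    have pFE: "pderiv F = L1 ^ m * L2 ^ k * E" unfolding pF E_def by (rule refl)
    have "poly (of_rat_poly (pderiv T)) z = 0" using z by (simp add: of_rat_poly_pderiv)
    then have LE: "poly (of_rat_poly L1) z = 0 \<or> poly (of_rat_poly L2) z = 0 \<or> poly (of_rat_poly E) z = 0"
      using Fc by (auto simp: T_def pderiv_smult of_rat_poly_smult pFE of_rat_poly_mult of_rat_poly_power poly_power)
    have E1: "E = smult (1 / (b - a)) (smult (of_int i) L2 - smult (of_int (j - i)) L1)"
      unfolding E_def dL mk by (simp add: smult_diff_right)
    have E2: "smult (of_int i) L2 - smult (of_int (j - i)) L1 = smult (of_int j / (b - a)) [:c, - 1:]"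
    proof -
      have "of_int i = t * of_int j" using ij by simp
      then have e: "of_int i * (b - a) = (c - a) * of_int j" using ba by (simp add: t_def field_simps)
      have "of_int i * b + (of_int j - of_int i) * a = of_int j * c"
        using e by (simp add: algebra_simps)
      then have "of_int i * (b / (b - a)) - (of_int j - of_int i) * (- a / (b - a)) = of_int j / (b - a) * c"
        by (simp add: add_divide_distrib[symmetric])
      moreover have "of_int i * (- 1 / (b - a)) - (of_int j - of_int i) * (1 / (b - a)) = of_int j / (b - a) * - 1"
        by (simp add: diff_divide_distrib)
      ultimately show ?thesis by (simp add: L1_def L2_def)
    qed
    have "poly (of_rat_poly E) z = 0 \<longleftrightarrow> poly (of_rat_poly [:c, - 1:]) z = 0"
      unfolding E1 E2 of_rat_poly_smult poly_smult using ba ij(1) by simp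
    with LE have "poly (of_rat_poly L1) z = 0 \<or> poly (of_rat_poly L2) z = 0 \<or> poly (of_rat_poly [:c, - 1:]) z = 0" by blast
    moreover have "poly (of_rat_poly L1) z = of_rat (1 / (b - a)) * (z - of_rat a)" "poly (of_rat_poly L2) z = of_rat (- 1 / (b - a)) * (z - of_rat b)"
    proof -
      have "L1 = smult (1 / (b - a)) [:- a, 1:]" "L2 = smult (- 1 / (b - a)) [:- b, 1:]"
        by (simp_all add: L1_def L2_def)
      moreover have "of_rat_poly [:- x, 1:] = [:- of_rat x, 1:]" for x by (simp add: of_rat_poly_pCons of_rat_poly_0 of_rat_minus)
      ultimately show "poly (of_rat_poly L1) z = of_rat (1 / (b - a)) * (z - of_rat a)" "poly (of_rat_poly L2) z = of_rat (- 1 / (b - a)) * (z - of_rat b)"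
        by (simp_all only: of_rat_poly_smult poly_smult) simp_all
    qed
    moreover have "of_rat (1 / (b - a)) \<noteq> (0 :: complex)" "of_rat (- 1 / (b - a)) \<noteq> (0 :: complex)" using ba by simp_all
    moreover have "poly (of_rat_poly [:c, - 1:]) z = of_rat c - z" by (simp add: of_rat_poly_pCons of_rat_poly_0 of_rat_minus)
    ultimately have "z = of_rat a \<or> z = of_rat b \<or> z = of_rat c" by auto
    then show ?thesis using cT by blast
  qed
  with dT T show ?thesis by (rule that)
qed

text \<open>The second half of Belyi's argument: a step identifies \<open>a\<close> with \<open>b\<close> and so decreases the number of points. The new
critical values \<open>0\<close> and \<open>1\<close> are images of \<open>a\<close> and \<open>c\<close>, so they add nothing.\<close>

lemma rational_to_01:
  fixes S :: "rat set"
  assumes "finite S" "card S \<ge> 2"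
  shows "\<exists>B. degree B \<ge> 1 \<and> (\<forall>s\<in>S. poly B s \<in> {0, 1}) \<and> (\<forall>z. poly (pderiv (of_rat_poly B)) z = 0 \<longrightarrow> poly (of_rat_poly B) z \<in> {0, 1})"
  using assms
proof (induction "card S" arbitrary: S rule: less_induct)
  case less
  have ne: "S \<noteq> {}" using less.prems by auto
  define a b where "a = Min S" and "b = Max S"
  have ab: "a \<in> S" "b \<in> S" "\<And>s. s \<in> S \<Longrightarrow> a \<le> s \<and> s \<le> b"
    using less.prems(1) ne by (simp_all add: a_def b_def)
  have "a \<noteq> b"
  proof
    assume "a = b"
    then have "S \<subseteq> {a}" using ab(3) by force
    then have "card S \<le> 1" using card_mono[of "{a}" S] by simp
    with less.prems show False by simp
  qed
  then have lt: "a < b" using ab by force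
  show ?case
  proof (cases "S = {a, b}")
    case True
    define B where "B = [:- a / (b - a), 1 / (b - a):]"
    have pB: "poly B x = (x - a) / (b - a)" for x by (simp add: B_def diff_divide_distrib)
    have "poly B a = 0" "poly B b = 1" using lt by (simp_all add: pB)
    moreover have "degree B \<ge> 1" using lt by (simp add: B_def)
    moreover have "poly (pderiv (of_rat_poly B)) z \<noteq> 0" for z
      using lt by (simp add: B_def of_rat_poly_pCons of_rat_poly_0 pderiv_pCons)
    ultimately show ?thesis using True by (intro exI[of _ B]) auto
  next
    case False
    then obtain c where "c \<in> S" "c \<noteq> a" "c \<noteq> b" using ab by blast
    then have c: "c \<in> S" "a < c" "c < b" using ab(3)[of c] by auto
    obtain T where T: "degree T \<ge> 1" "poly T a = 0" "poly T b = 0" "poly T c = 1"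
      "\<And>z. poly (pderiv (of_rat_poly T)) z = 0 \<Longrightarrow> poly (of_rat_poly T) z \<in> {0, 1}"
      using belyi_step[OF c(2,3)] by blast
    let ?S = "poly T ` S"
    have "\<not> inj_on (poly T) S"
    proof
      assume "inj_on (poly T) S"
      from inj_onD[OF this, of a b] T(2,3) ab(1,2) lt show False by simp
    qed
    then have "card ?S \<noteq> card S" using eq_card_imp_inj_on[OF less.prems(1), of "poly T"] by blast
    then have "card ?S < card S" using card_image_le[OF less.prems(1), of "poly T"] by linarith
    moreover have S01: "{0, 1} \<subseteq> ?S" using T(2,4) ab(1) c(1) by (metis empty_subsetI imageI insert_subset)
    then have "card ?S \<ge> 2" using card_mono[OF finite_imageI[OF less.prems(1)] S01] by simp
    ultimately obtain B where B: "degree B \<ge> 1" "\<forall>s\<in>?S. poly B s \<in> {0, 1}" "\<And>z. poly (pderiv (of_rat_poly B)) z = 0 \<Longrightarrow> poly (of_rat_poly B) z \<in> {0, 1}"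
      using less.hyps[of ?S] less.prems(1) by blast
    have crB: "poly (of_rat_poly (pcompose B T)) z = poly (of_rat_poly B) (poly (of_rat_poly T) z)" for z
      by (simp add: of_rat_poly_pcompose poly_pcompose)
    have "poly B 0 \<in> {0, 1}" "poly B 1 \<in> {0, 1}" using B(2) S01 by blast+
    then have B01: "poly (of_rat_poly B) 0 \<in> {0, 1}" "poly (of_rat_poly B) 1 \<in> {0, 1}" using poly_of_rat_poly[of B 0] poly_of_rat_poly[of B 1] by auto
    have "poly (of_rat_poly (pcompose B T)) z \<in> {0, 1}" if z: "poly (pderiv (of_rat_poly (pcompose B T))) z = 0" for z
    proof -
      from z have "poly (pderiv (of_rat_poly B)) (poly (of_rat_poly T) z) = 0 \<or> poly (pderiv (of_rat_poly T)) z = 0"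
        unfolding of_rat_poly_pcompose pderiv_pcompose_root .
      then show ?thesis
      proof
        assume "poly (pderiv (of_rat_poly B)) (poly (of_rat_poly T) z) = 0"
        then show ?thesis unfolding crB by (rule B(3))
      next
        assume "poly (pderiv (of_rat_poly T)) z = 0"
        from T(5)[OF this] show ?thesis unfolding crB using B01 by auto
      qed
    qed
    moreover have "\<forall>s\<in>S. poly (pcompose B T) s \<in> {0, 1}" using B(2) by (simp add: poly_pcompose)
    moreover have "degree (pcompose B T) \<ge> 1" using B(1) T(1) by (simp add: degree_pcompose)
    ultimately show ?thesis by (intro exI[of _ "pcompose B T"]) blast
  qed
qed

text \<open>Apply \<open>algebraic_to_rational\<close> to a common rational annihilator of \<open>S\<close>, and \<open>rational_to_01\<close> to the resulting set of
rational values.\<close>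

theorem belyi:
  fixes S :: "complex set"
  assumes "finite S" "\<And>z. z \<in> S \<Longrightarrow> algebraic z"
  obtains B :: "complex poly" where "degree B \<ge> 1" "\<And>z. z \<in> S \<Longrightarrow> poly B z \<in> {0, 1}"
    "\<And>z. poly (pderiv B) z = 0 \<Longrightarrow> poly B z \<in> {0, 1}"
proof -
  have "\<exists>p. p \<noteq> 0 \<and> poly (of_rat_poly p) z = 0" if z: "z \<in> S" for z
  proof -
    obtain p :: "int poly" where p: "poly (map_poly of_int p) z = 0" "p \<noteq> 0" using algebraicE'[OF assms(2)[OF z]] by blast
    have "of_rat_poly (map_poly of_int p) = map_poly of_int p" by (rule poly_eqI) (simp add: coeff_of_rat_poly coeff_map_poly)
    moreover have "map_poly of_int p \<noteq> (0 :: rat poly)" using p(2) by (subst map_poly_eq_0_iff) auto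
    ultimately show ?thesis using p(1) by metis
  qed
  then obtain p where p: "\<And>z. z \<in> S \<Longrightarrow> p z \<noteq> 0 \<and> poly (of_rat_poly (p z)) z = 0" by metis
  \<comment> \<open>The factor \<open>z\<close> makes \<open>r\<close> nonconstant also when \<open>S\<close> is empty.\<close>
  define r where "r = [:0, 1:] * (\<Prod>z\<in>S. p z)"
  have nz: "(\<Prod>z\<in>S. p z) \<noteq> 0" using p assms(1) by simp
  have "degree r \<ge> 1" unfolding r_def by (subst degree_mult_eq) (use nz in simp_all)
  from algebraic_to_rational[OF this] obtain B1 where B1: "degree B1 \<ge> 1"
    "\<And>z. poly (of_rat_poly r) z = 0 \<Longrightarrow> poly (of_rat_poly B1) z \<in> \<rat>" "\<And>z. poly (pderiv (of_rat_poly B1)) z = 0 \<Longrightarrow> poly (of_rat_poly B1) z \<in> \<rat>" by blast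
  have S_rat: "poly (of_rat_poly B1) z \<in> \<rat>" if "z \<in> S" for z
  proof (rule B1(2))
    have "of_rat_poly r = of_rat_poly [:0, 1:] * (\<Prod>z\<in>S. of_rat_poly (p z))" by (simp only: r_def of_rat_poly_mult of_rat_poly_prod)
    then show "poly (of_rat_poly r) z = 0" using that p assms(1) by (auto simp: poly_prod)
  qed
  define C where "C = poly (of_rat_poly B1) ` (S \<union> {z. poly (pderiv (of_rat_poly B1)) z = 0})"
  have dz: "pderiv (of_rat_poly B1) \<noteq> 0" using B1(1) by (simp add: pderiv_eq_0_iff degree_of_rat_poly)
  have finC: "finite C" unfolding C_def using assms(1) poly_roots_finite[OF dz] by simp
  have Crat: "C \<subseteq> \<rat>" unfolding C_def using S_rat B1(3) by auto
  \<comment> \<open>The points \<open>0\<close> and \<open>1\<close> only ensure that there are at least two.\<close>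
  define R where "R = {x. of_rat x \<in> C} \<union> {0, 1}"
  have finR: "finite R"
  proof -
    have "inj_on (of_rat :: rat \<Rightarrow> complex) {x. of_rat x \<in> C}" by (rule inj_onI) simp
    then have "finite {x :: rat. of_rat x \<in> C}" by (rule finite_imageD[rotated]) (rule finite_subset[OF _ finC], auto)
    then show ?thesis by (simp add: R_def)
  qed
  have "card R \<ge> 2" using card_mono[OF finR, of "{0, 1}"] by (simp add: R_def)
  from rational_to_01[OF finR this] obtain B2 where B2: "degree B2 \<ge> 1" "\<forall>s\<in>R. poly B2 s \<in> {0, 1}"
    "\<And>z. poly (pderiv (of_rat_poly B2)) z = 0 \<Longrightarrow> poly (of_rat_poly B2) z \<in> {0, 1}" by blast
  have C01: "poly (of_rat_poly B2) y \<in> {0, 1}" if y: "y \<in> C" for y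
  proof -
    obtain x where x: "y = of_rat x" using y Crat by (auto elim: Rats_cases)
    then have "poly B2 x \<in> {0, 1}" using B2(2) y by (simp add: R_def)
    then show ?thesis unfolding x poly_of_rat_poly by auto
  qed
  show ?thesis
  proof
    show "degree (pcompose (of_rat_poly B2) (of_rat_poly B1)) \<ge> 1" using B1(1) B2(1) by (simp add: degree_pcompose degree_of_rat_poly)
    show "poly (pcompose (of_rat_poly B2) (of_rat_poly B1)) z \<in> {0, 1}" if "z \<in> S" for z
      unfolding poly_pcompose using that by (intro C01) (auto simp: C_def)
    show "poly (pcompose (of_rat_poly B2) (of_rat_poly B1)) z \<in> {0, 1}" if "poly (pderiv (pcompose (of_rat_poly B2) (of_rat_poly B1))) z = 0" for z
      using that unfolding pderiv_pcompose_root poly_pcompose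
    proof
      assume "poly (pderiv (of_rat_poly B2)) (poly (of_rat_poly B1) z) = 0"
      then show "poly (of_rat_poly B2) (poly (of_rat_poly B1) z) \<in> {0, 1}" by (rule B2(3))
    next
      assume "poly (pderiv (of_rat_poly B1)) z = 0"
      then show "poly (of_rat_poly B2) (poly (of_rat_poly B1) z) \<in> {0, 1}" by (intro C01) (auto simp: C_def)
    qed
  qed
qed

lemma belyi_map:
  assumes "finite X" "X \<subseteq> P1_Qbar"
  obtains b e where "e \<ge> 1" "rat_deg e b" "critical_values b \<subseteq> {Some 0, Some 1, None}" "b ` X \<subseteq> {Some 0, Some 1, None}"
proof -
  have "finite (the ` (X - {None}))" using assms(1) by simp
  moreover have "algebraic z" if "z \<in> the ` (X - {None})" for z
    using that assms(2) by (auto simp: P1_Qbar_def)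
  ultimately obtain B :: "complex poly" where B: "degree B \<ge> 1" "\<And>z. z \<in> the ` (X - {None}) \<Longrightarrow> poly B z \<in> {0, 1}"
    "\<And>z. poly (pderiv B) z = 0 \<Longrightarrow> poly B z \<in> {0, 1}"
    using belyi by blast
  have n: "nondeg (degree B) B 1" by (simp add: nondeg_iff)
  have b: "rat_map B 1 (Some z) = Some (poly B z)" "rat_map B 1 None = None" for z
    using B(1) by (simp_all add: rat_map_def Let_def)
  have "rat_map B 1 x \<in> {Some 0, Some 1, None}" if "x \<in> critical_points (rat_map B 1)" for x
  proof (cases x)
    case (Some z)
    then have "poly (pderiv B) z = 0" using that critical_Some_iff[OF n] by (simp add: wronskian_def)
    then show ?thesis using B(3)[of z] by (auto simp: Some b)
  qed (simp add: b)
  then have V: "critical_values (rat_map B 1) \<subseteq> {Some 0, Some 1, None}" by (auto simp: critical_values_def)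
  have "rat_map B 1 x \<in> {Some 0, Some 1, None}" if "x \<in> X" for x
  proof (cases x)
    case (Some z)
    then have "z \<in> the ` (X - {None})" using that by force
    then show ?thesis using B(2)[of z] by (auto simp: Some b)
  qed (simp add: b)
  then have im: "rat_map B 1 ` X \<subseteq> {Some 0, Some 1, None}" by (rule image_subsetI)
  have r: "rat_deg (degree B) (rat_map B 1)" using n unfolding rat_deg_def by blast
  show ?thesis by (rule that[OF B(1) r V im])
qed

section \<open>Rigid maps with a given postcritical set\<close>

lemma postcritical_set_eq:
  assumes "critical_values f = X" "f ` X \<subseteq> X"
  shows "postcritical_set f = X"
proof -
  have "(f ^^ n) x \<in> X" if "x \<in> X" for n x
    using that by (induction n) (use assms(2) in auto)
  moreover have "X = (f ^^ 0) ` X" by simp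
  ultimately show ?thesis unfolding postcritical_set_def assms(1) by blast
qed

lemma postcritical_set_invariant: "x \<in> postcritical_set g \<Longrightarrow> g x \<in> postcritical_set g"
proof -
  assume "x \<in> postcritical_set g"
  then obtain n v where v: "v \<in> critical_values g" "x = (g ^^ n) v" by (auto simp: postcritical_set_def)
  then have "g x = (g ^^ Suc n) v" by simp
  then show ?thesis using v(1) unfolding postcritical_set_def by blast
qed

lemma critical_values_subset_postcritical: "critical_values g \<subseteq> postcritical_set g"
proof
  fix x assume "x \<in> critical_values g"
  then have "x \<in> (g ^^ 0) ` critical_values g" by simp
  then show "x \<in> postcritical_set g" unfolding postcritical_set_def by blast
qed

text \<open>If rigidity failed, counterexamples at distances \<open>1 / (n + 1)\<close> would form a sequence converging to \<open>f\<close>.\<close>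

lemma rigidI:
  assumes f: "rat_deg d f"
    and conj: "\<And>g. cconv g f \<Longrightarrow> (\<And>n. rational_map (g n) \<and> finite (postcritical_set (g n)) \<and> card (postcritical_set (g n)) = card (postcritical_set f))
      \<Longrightarrow> \<forall>\<^sub>F n in sequentially. conformally_conjugate f (g n)"
  shows "rigid f"
proof (rule ccontr)
  assume nr: "\<not> rigid f"
  have "\<exists>g. (rational_map g \<and> finite (postcritical_set g) \<and> card (postcritical_set g) = card (postcritical_set f))
      \<and> (\<forall>x. chordal_dist (f x) (g x) < 1 / real (Suc n)) \<and> \<not> conformally_conjugate f g" for n
  proof -
    have "1 / real (Suc n) > 0" by simp
    then show ?thesis using nr unfolding rigid_def postcritically_finite_def by blast
  qed
  then obtain g where g: "\<And>n. rational_map (g n) \<and> finite (postcritical_set (g n)) \<and> card (postcritical_set (g n)) = card (postcritical_set f)"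
    "\<And>n x. chordal_dist (f x) (g n x) < 1 / real (Suc n)" "\<And>n. \<not> conformally_conjugate f (g n)" by metis
  have "cconv g f" by (rule cconv_of_chordal[OF sphere_cont_rat[OF f] g(2)])
  from conj[OF this g(1)] have "\<forall>\<^sub>F n in sequentially. False" by eventually_elim (use g(3) in blast)
  then show False by simp
qed

text \<open>Every point of \<open>X\<close> is a critical value and persists as one. The \<open>|X|\<close> points so found exhaust the postcritical set of
\<open>g n\<close>. As this is mapped into itself, \<open>g n (\<phi> n x)\<close> is some \<open>\<phi> n y\<close>, and continuity leaves only \<open>y = f x\<close>.\<close>

lemma perturbed_postcritical_set:
  assumes f: "rat_deg d f" "d \<ge> 1" and X: "finite X" "critical_values f = X" "f ` X \<subseteq> X"
    and cc: "cconv g f"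
    and g: "\<And>n. rational_map (g n) \<and> finite (postcritical_set (g n)) \<and> card (postcritical_set (g n)) = card (postcritical_set f)"
  obtains \<phi> where "\<And>x. x \<in> X \<Longrightarrow> sconv (\<lambda>n. \<phi> n x) x sequentially"
    "\<forall>\<^sub>F n in sequentially. critical_values (g n) = \<phi> n ` X \<and> (\<forall>x\<in>X. g n (\<phi> n x) = \<phi> n (f x))"
proof -
  have PX: "postcritical_set f = X" by (rule postcritical_set_eq[OF X(2,3)])
  have rg: "\<forall>\<^sub>F n in sequentially. \<exists>e. rat_deg e (g n)" using g rational_map_iff by (intro always_eventually) blast
  have "\<exists>v. sconv v x sequentially \<and> (\<forall>\<^sub>F n in sequentially. v n \<in> critical_values (g n))" if x: "x \<in> X" for x
    using critical_value_persists[OF f cc rg, of x] x X(2) by metis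
  then obtain v where v: "\<And>x. x \<in> X \<Longrightarrow> sconv (v x) x sequentially"
    "\<And>x. x \<in> X \<Longrightarrow> \<forall>\<^sub>F n in sequentially. v x n \<in> critical_values (g n)" by metis
  define \<phi> where "\<phi> n x = v x n" for n x
  have \<phi>: "sconv (\<lambda>n. \<phi> n x) x sequentially" if "x \<in> X" for x using v(1)[OF that] by (simp add: \<phi>_def)
  have in_V: "\<forall>\<^sub>F n in sequentially. \<forall>x\<in>X. \<phi> n x \<in> critical_values (g n)"
    by (rule eventually_ball_finiteI[OF X(1)]) (simp add: \<phi>_def v(2))
  have inj: "\<forall>\<^sub>F n in sequentially. \<forall>x\<in>X. \<forall>y\<in>X. x \<noteq> y \<longrightarrow> \<phi> n x \<noteq> \<phi> n y"
  proof (intro eventually_ball_finiteI[OF X(1)])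
    fix x y assume xy: "x \<in> X" "y \<in> X"
    show "\<forall>\<^sub>F n in sequentially. x \<noteq> y \<longrightarrow> \<phi> n x \<noteq> \<phi> n y"
      using sconv_eventually_neq[OF \<phi>[OF xy(1)] \<phi>[OF xy(2)]] by (cases "x = y") (auto elim: eventually_mono)
  qed
  have img: "\<forall>\<^sub>F n in sequentially. \<forall>x\<in>X. \<forall>y\<in>X. y \<noteq> f x \<longrightarrow> g n (\<phi> n x) \<noteq> \<phi> n y"
  proof (intro eventually_ball_finiteI[OF X(1)])
    fix x y assume xy: "x \<in> X" "y \<in> X"
    show "\<forall>\<^sub>F n in sequentially. y \<noteq> f x \<longrightarrow> g n (\<phi> n x) \<noteq> \<phi> n y"
      using sconv_eventually_neq[OF cconv_seq[OF cc \<phi>[OF xy(1)]] \<phi>[OF xy(2)]] by (cases "y = f x") (auto elim: eventually_mono)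
  qed
  have "\<forall>\<^sub>F n in sequentially. critical_values (g n) = \<phi> n ` X \<and> (\<forall>x\<in>X. g n (\<phi> n x) = \<phi> n (f x))"
    using in_V inj img
  proof eventually_elim
    case (elim n)
    have sub: "\<phi> n ` X \<subseteq> critical_values (g n)" using elim(1) by blast
    have "inj_on (\<phi> n) X" using elim(2) by (auto simp: inj_on_def)
    then have "card (\<phi> n ` X) = card (postcritical_set (g n))" using g[of n] PX by (simp add: card_image)
    then have P: "\<phi> n ` X = postcritical_set (g n)"
      using sub critical_values_subset_postcritical[of "g n"] g[of n] by (intro card_subset_eq) auto
    then have V: "critical_values (g n) = \<phi> n ` X" using sub critical_values_subset_postcritical[of "g n"] by blast
    have "g n (\<phi> n x) = \<phi> n (f x)" if x: "x \<in> X" for x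
    proof -
      have "\<phi> n x \<in> postcritical_set (g n)" using x P by blast
      then have "g n (\<phi> n x) \<in> \<phi> n ` X" unfolding P by (rule postcritical_set_invariant)
      then obtain y where "y \<in> X" "g n (\<phi> n x) = \<phi> n y" by blast
      with elim(3) x show ?thesis by metis
    qed
    with V show ?case by blast
  qed
  with \<phi> show ?thesis by (rule that)
qed

lemma critical_values_mobius_right: "rat_deg d f \<Longrightarrow> mobius C \<Longrightarrow> critical_values (f \<circ> C) = critical_values f"
  using critical_values_mobius_comp[of d f id C] mobius_id by simp

lemma conformally_conjugateI: "mobius M \<Longrightarrow> g = M \<circ> f \<circ> inv M \<Longrightarrow> conformally_conjugate f g"
  unfolding conformally_conjugate_def by blast

lemma three_elements:
  assumes "card X \<ge> 3"
  obtains x1 x2 x3 where "x1 \<in> X" "x2 \<in> X" "x3 \<in> X" "x1 \<noteq> x2" "x2 \<noteq> x3" "x1 \<noteq> x3"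
proof -
  obtain Y where "Y \<subseteq> X" "card Y = 3" using obtain_subset_with_card_n[OF assms] by blast
  then show ?thesis using that by (auto simp: card_3_iff)
qed

text \<open>The names follow the outline at the beginning: \<open>Hn\<close>, \<open>K\<close>, \<open>F\<close> and \<open>M\<close> are the sequences \<open>H\<^sub>n\<close>, \<open>K\<^sub>n\<close>, \<open>F\<^sub>n\<close> and \<open>M\<^sub>n\<close>.\<close>

theorem exists_rigid_many_points:
  assumes X: "finite X" "X \<subseteq> P1_Qbar" "card X \<ge> 3"
  shows "\<exists>f. rational_map f \<and> postcritically_finite f \<and> rigid f \<and> postcritical_set f = X"
proof -
  obtain x1 x2 x3 where x: "x1 \<in> X" "x2 \<in> X" "x3 \<in> X" and ne: "x1 \<noteq> x2" "x2 \<noteq> x3" "x1 \<noteq> x3"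
    using three_elements[OF X(3)] .
  have "card X \<ge> 2" using X(3) by simp
  from prescribed_critical_values[OF X(1) this]
  obtain h dh where h: "dh \<ge> 2" "rat_deg dh h" "critical_values h = X"
    and H: "\<forall>\<phi>. (\<forall>x\<in>X. sconv (\<lambda>n. \<phi> n x) x sequentially) \<longrightarrow>
      (\<exists>H. cconv H h \<and> (\<forall>\<^sub>F n in sequentially. rat_deg dh (H n) \<and> critical_values (H n) = \<phi> n ` X))"
    by (elim exE conjE)
  have h1: "dh \<ge> 1" using h(1) by simp
  obtain t1 where t1: "h t1 = x1" using rat_deg_surj[OF h(2) h1] .
  obtain t2 where t2: "h t2 = x2" using rat_deg_surj[OF h(2) h1] .
  obtain t3 where t3: "h t3 = x3" using rat_deg_surj[OF h(2) h1] .
  have tne: "t1 \<noteq> t2" "t2 \<noteq> t3" "t1 \<noteq> t3" using ne t1 t2 t3 by auto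
  obtain T where T: "mobius T" "T (Some 0) = t1" "T (Some 1) = t2" "T None = t3" using mobius_through[OF tne] .
  obtain b e where b: "e \<ge> 1" "rat_deg e b" "critical_values b \<subseteq> {Some 0, Some 1, None}" "b ` X \<subseteq> {Some 0, Some 1, None}"
    using belyi_map[OF X(1,2)] .
  define B where "B = T \<circ> b"
  have B: "rat_deg e B" using rat_deg_comp[OF mobius_rat_deg[OF T(1)] b(2)] by (simp add: B_def)
  have VB: "critical_values B \<subseteq> {t1, t2, t3}"
    unfolding B_def critical_values_mobius_left[OF b(2) T(1)] using b(3) T(2-4) by auto
  have BX: "B x \<in> {t1, t2, t3}" if "x \<in> X" for x using b(4) that T(2-4) by (auto simp: B_def)
  define f where "f = h \<circ> B"
  define d where "d = dh * e"
  have f: "rat_deg d f" unfolding f_def d_def by (rule rat_deg_comp[OF h(2) B])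
  have d2: "d \<ge> 2" using h(1) b(1) mult_le_mono[of 2 dh 1 e] by (simp add: d_def)
  then have d1: "d \<ge> 1" by simp
  have Vf: "critical_values f = X"
    unfolding f_def critical_values_comp[OF h(2) B b(1)] h(3) using VB t1 t2 t3 x by auto
  have fX: "f ` X \<subseteq> X" using BX t1 t2 t3 x by (force simp: f_def)
  have PX: "postcritical_set f = X" by (rule postcritical_set_eq[OF Vf fX])
  have "rigid f"
  proof (rule rigidI[OF f])
    fix g assume cc: "cconv g f"
      and g: "\<And>n. rational_map (g n) \<and> finite (postcritical_set (g n)) \<and> card (postcritical_set (g n)) = card (postcritical_set f)"
    obtain \<phi> where \<phi>: "\<And>x. x \<in> X \<Longrightarrow> sconv (\<lambda>n. \<phi> n x) x sequentially"
      and evg: "\<forall>\<^sub>F n in sequentially. critical_values (g n) = \<phi> n ` X \<and> (\<forall>x\<in>X. g n (\<phi> n x) = \<phi> n (f x))"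
      using perturbed_postcritical_set[OF f d1 X(1) Vf fX cc g] by blast
    have rg: "\<forall>\<^sub>F n in sequentially. \<exists>e. rat_deg e (g n)" using g rational_map_iff by (intro always_eventually) blast
    obtain Hn where Hn: "cconv Hn h" and evH: "\<forall>\<^sub>F n in sequentially. rat_deg dh (Hn n) \<and> critical_values (Hn n) = \<phi> n ` X"
      using mp[OF spec[OF H] ballI[OF \<phi>]] by blast
    have rH: "\<forall>\<^sub>F n in sequentially. \<exists>e. rat_deg e (Hn n)" using evH by eventually_elim blast
    obtain s1 where s1: "sconv s1 t1 sequentially" "\<forall>\<^sub>F n in sequentially. Hn n (s1 n) = \<phi> n x1"
      using preimage_persists[OF h(2) h1 Hn rH, of "\<lambda>n. \<phi> n x1" t1] \<phi>[OF x(1)] t1 by metis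
    obtain s2 where s2: "sconv s2 t2 sequentially" "\<forall>\<^sub>F n in sequentially. Hn n (s2 n) = \<phi> n x2"
      using preimage_persists[OF h(2) h1 Hn rH, of "\<lambda>n. \<phi> n x2" t2] \<phi>[OF x(2)] t2 by metis
    obtain s3 where s3: "sconv s3 t3 sequentially" "\<forall>\<^sub>F n in sequentially. Hn n (s3 n) = \<phi> n x3"
      using preimage_persists[OF h(2) h1 Hn rH, of "\<lambda>n. \<phi> n x3" t3] \<phi>[OF x(3)] t3 by metis
    obtain K where K: "cconv K id" "cconv (\<lambda>n. inv (K n)) id"
      and evK: "\<forall>\<^sub>F n in sequentially. mobius (K n) \<and> K n t1 = s1 n \<and> K n t2 = s2 n \<and> K n t3 = s3 n"
      using mobius_move[OF tne s1(1) s2(1) s3(1)] .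
    define F where "F n = Hn n \<circ> (K n \<circ> B)" for n
    have "cconv F (h \<circ> (id \<circ> B))" unfolding F_def[abs_def] by (intro cconv_comp Hn K cconv_const sphere_cont_rat[OF B])
    then have F: "cconv F f" by (simp add: f_def)
    \<comment> \<open>For \<open>x \<in> X\<close> the value \<open>B x\<close> is one of the \<open>t\<^sub>i\<close>, which \<open>K n\<close> moves to \<open>s\<^sub>i n\<close> and \<open>Hn n\<close> then maps to \<open>\<phi> n (h t\<^sub>i)\<close>.\<close>
    have evF: "\<forall>\<^sub>F n in sequentially. (\<exists>e. rat_deg e (F n)) \<and> critical_values (F n) \<subseteq> \<phi> n ` X \<and> (\<forall>x\<in>X. F n x = \<phi> n (f x))"
      using evH evK s1(2) s2(2) s3(2)
    proof eventually_elim
      case (elim n)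
      then have r: "rat_deg dh (Hn n)" "mobius (K n)" by blast+
      have KB: "rat_deg e (K n \<circ> B)" using rat_deg_comp[OF mobius_rat_deg[OF r(2)] B] by simp
      have HK: "Hn n (K n t1) = \<phi> n x1" "Hn n (K n t2) = \<phi> n x2" "Hn n (K n t3) = \<phi> n x3" using elim by simp_all
      have "Hn n ` (K n ` critical_values B) \<subseteq> \<phi> n ` X" using VB HK x by auto
      then have "critical_values (F n) \<subseteq> \<phi> n ` X"
        unfolding F_def critical_values_comp[OF r(1) KB b(1)] critical_values_mobius_left[OF B r(2)] using elim(1) by blast
      moreover have "F n x = \<phi> n (f x)" if "x \<in> X" for x
        using BX[OF that] HK t1 t2 t3 by (auto simp: F_def f_def)
      ultimately show ?case using rat_deg_comp[OF r(1) KB] unfolding F_def by blast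
    qed
    have rF: "\<forall>\<^sub>F n in sequentially. (\<exists>e. rat_deg e (F n)) \<and> critical_values (F n) \<subseteq> \<phi> n ` X" using evF by eventually_elim blast
    have FX: "\<forall>\<^sub>F n in sequentially. \<forall>x\<in>X. F n x = \<phi> n (f x)" using evF by eventually_elim blast
    obtain M where M: "cconv M id" "cconv (\<lambda>n. inv (M n)) id"
      and evM: "\<forall>\<^sub>F n in sequentially. mobius (M n) \<and> M n x1 = \<phi> n x1 \<and> M n x2 = \<phi> n x2 \<and> M n x3 = \<phi> n x3"
      using mobius_move[OF ne \<phi>[OF x(1)] \<phi>[OF x(2)] \<phi>[OF x(3)]] .
    define J where "J = {x1, x2, x3}"
    have J: "card J = 3" "J \<subseteq> X" using ne x by (auto simp: J_def)
    have MJ: "\<forall>\<^sub>F n in sequentially. mobius (M n) \<and> (\<forall>a\<in>J. M n a = \<phi> n a)"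
      using evM by eventually_elim (simp add: J_def)
    have fJ: "f a \<in> X" if "a \<in> J" for a using that J fX by blast
    have XV: "critical_values f \<subseteq> X" using Vf by simp
    have "cconv (\<lambda>n. F n \<circ> inv (M n)) (f \<circ> id)" by (intro cconv_comp F M)
    then have FM: "cconv (\<lambda>n. F n \<circ> inv (M n)) f" by simp
    have 1: "\<forall>\<^sub>F n in sequentially. g n = F n \<circ> inv (M n)"
    proof (rule local_uniqueness[OF f d1 X(1) XV \<phi> cc _ FM _ J(1) fJ])
      show "\<forall>\<^sub>F n in sequentially. (\<exists>e. rat_deg e (g n)) \<and> critical_values (g n) \<subseteq> \<phi> n ` X"
        using rg evg by eventually_elim simp
      show "\<forall>\<^sub>F n in sequentially. (\<exists>e. rat_deg e (F n \<circ> inv (M n))) \<and> critical_values (F n \<circ> inv (M n)) \<subseteq> \<phi> n ` X"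
        using rF MJ
      proof eventually_elim
        case (elim n)
        then obtain k where k: "rat_deg k (F n)" by blast
        have m: "mobius (inv (M n))" using elim(2) mobius_inverse(2) by blast
        show ?case using rat_deg_comp[OF k mobius_rat_deg[OF m]] critical_values_mobius_right[OF k m] elim(1) by auto
      qed
      fix a assume a: "a \<in> J"
      have "\<forall>\<^sub>F n in sequentially. g n (\<phi> n a) = \<phi> n (f a) \<and> (F n \<circ> inv (M n)) (\<phi> n a) = \<phi> n (f a)"
        using evg FX MJ
      proof eventually_elim
        case (elim n)
        have "inv (M n) (\<phi> n a) = a" using elim(3) a mobius_inv_apply(1) by metis
        then show ?case using elim(1,2) a J(2) by auto
      qed
      then show "\<exists>c. sconv c a sequentially \<and> (\<forall>\<^sub>F n in sequentially. g n (c n) = \<phi> n (f a) \<and> (F n \<circ> inv (M n)) (c n) = \<phi> n (f a))"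
        using \<phi>[of a] a J(2) by blast
    qed
    \<comment> \<open>Both \<open>inv (M n) (\<phi> n x)\<close> and \<open>x\<close> tend to \<open>x\<close> and are mapped by \<open>F n\<close> to \<open>\<phi> n (f x)\<close>.\<close>
    have "\<forall>\<^sub>F n in sequentially. \<forall>x\<in>X. inv (M n) (\<phi> n x) = x"
    proof (rule eventually_ball_finiteI[OF X(1)])
      fix x assume x: "x \<in> X"
      show "\<forall>\<^sub>F n in sequentially. inv (M n) (\<phi> n x) = x"
      proof (rule preimage_unique[OF f d1 X(1) XV \<phi> F rF])
        show "f x \<in> X" using x fX by blast
        show "sconv (\<lambda>n. inv (M n) (\<phi> n x)) x sequentially" using cconv_seq[OF M(2) \<phi>[OF x]] by simp
        show "\<forall>\<^sub>F n in sequentially. F n (inv (M n) (\<phi> n x)) = \<phi> n (f x)"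
          using 1 evg by eventually_elim (use x in auto)
        show "\<forall>\<^sub>F n in sequentially. F n x = \<phi> n (f x)" using FX by eventually_elim (use x in blast)
      qed (simp_all add: sconv_const)
    qed
    then have MX: "\<forall>\<^sub>F n in sequentially. \<forall>x\<in>X. M n x = \<phi> n x"
      using MJ by eventually_elim (metis mobius_inv_apply(2))
    have "cconv (\<lambda>n. M n \<circ> f) (id \<circ> f)" by (intro cconv_comp M cconv_const sphere_cont_rat[OF f])
    then have Mf: "cconv (\<lambda>n. M n \<circ> f) f" by simp
    have 2: "\<forall>\<^sub>F n in sequentially. F n = M n \<circ> f"
    proof (rule local_uniqueness[OF f d1 X(1) XV \<phi> F rF Mf _ J(1) fJ])
      show "\<forall>\<^sub>F n in sequentially. (\<exists>e. rat_deg e (M n \<circ> f)) \<and> critical_values (M n \<circ> f) \<subseteq> \<phi> n ` X"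
        using MJ MX
      proof eventually_elim
        case (elim n)
        then have m: "mobius (M n)" by blast
        show ?case using rat_deg_comp[OF mobius_rat_deg[OF m] f] critical_values_mobius_left[OF f m] elim(2) by (auto simp: Vf)
      qed
      fix a assume a: "a \<in> J"
      have "\<forall>\<^sub>F n in sequentially. F n a = \<phi> n (f a) \<and> (M n \<circ> f) a = \<phi> n (f a)"
        using FX MX by eventually_elim (use a J(2) fJ in auto)
      then show "\<exists>c. sconv c a sequentially \<and> (\<forall>\<^sub>F n in sequentially. F n (c n) = \<phi> n (f a) \<and> (M n \<circ> f) (c n) = \<phi> n (f a))"
        using sconv_const by blast
    qed
    show "\<forall>\<^sub>F n in sequentially. conformally_conjugate f (g n)"
      using 1 2 MJ
    proof eventually_elim
      case (elim n)
      have "g n = M n \<circ> f \<circ> inv (M n)" using elim(1,2) by simp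
      then show ?case using elim(3) conformally_conjugateI by blast
    qed
  qed
  moreover have "rational_map f" using f d2 rational_map_iff by blast
  moreover have "postcritically_finite f" using PX X(1) by (simp add: postcritically_finite_def)
  ultimately show ?thesis using PX by blast
qed

lemma scale_simps:
  assumes "k \<noteq> 0"
  shows "mobius (lin k 0 0 1)" "lin k 0 0 1 (Some z) = Some (k * z)" "lin k 0 0 1 None = None"
proof -
  have nz: "k * 1 - 0 * 0 \<noteq> (0::complex)" using assms by simp
  show "mobius (lin k 0 0 1)" unfolding mobius_lin using nz by (intro exI conjI) (rule refl | assumption)+
  have r: "Some z = proj z 1" "None = proj 1 0" by (simp_all add: proj_def)
  show "lin k 0 0 1 (Some z) = Some (k * z)"
    unfolding r(1) using lin_proj(1)[OF nz, of z 1] by (simp add: proj_1)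
  show "lin k 0 0 1 None = None"
    unfolding r(2) using lin_proj(1)[OF nz, of 1 0] assms by (simp add: proj_def)
qed

text \<open>With \<open>|X| = 2\<close> the points of \<open>X\<close> determine a Moebius map only up to scaling. The fixed point \<open>x3\<close> of \<open>f\<close>, which
corresponds to \<open>1\<close> under \<open>f = T z\<^sup>2 T\<^sup>-\<^sup>1\<close>, serves as third value; its nearby preimage \<open>b n\<close> under \<open>g n\<close> corresponds to
\<open>\<kappa> n \<rightarrow> 1\<close>. Uniqueness gives \<open>g\<^sub>n(\<kappa>\<^sub>n z) = z\<^sup>2\<close> in the coordinate \<open>Tn n\<close>, that is, \<open>g\<^sub>n(z) = z\<^sup>2 / \<kappa>\<^sub>n\<^sup>2\<close>, and this is
conjugate to \<open>z\<^sup>2\<close> by the scaling with \<open>\<kappa>\<^sub>n\<^sup>2\<close>.\<close>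

theorem exists_rigid_two_points:
  assumes "x1 \<noteq> x2"
  shows "\<exists>f. rational_map f \<and> postcritically_finite f \<and> rigid f \<and> postcritical_set f = {x1, x2}"
proof -
  obtain x3 where x3: "x3 \<noteq> x1" "x3 \<noteq> x2" using third_point by blast
  obtain T where T: "mobius T" "T (Some 0) = x1" "T (Some 1) = x3" "T None = x2"
    using mobius_through[OF x3(1)[symmetric] x3(2) assms] .
  have Ti: "inv T x1 = Some 0" "inv T x3 = Some 1" "inv T x2 = None"
    using mobius_inv_apply(1)[OF T(1)] T(2-4) by metis+
  define f where "f = T \<circ> square_map \<circ> inv T"
  have f: "rat_deg 2 f" unfolding f_def by (rule rat_deg_mobius[OF rat_deg_square_map T(1) mobius_inverse(2)[OF T(1)]])
  have fx: "f x1 = x1" "f x2 = x2" "f x3 = x3" by (simp_all add: f_def Ti T square_map_simps)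
  define X where "X = {x1, x2}"
  have Vf: "critical_values f = X"
    unfolding f_def X_def critical_values_mobius_comp[OF rat_deg_square_map T(1) mobius_inverse(2)[OF T(1)]] critical_values_square_map
    by (simp add: T)
  have fX: "f ` X \<subseteq> X" by (simp add: X_def fx)
  have PX: "postcritical_set f = X" by (rule postcritical_set_eq[OF Vf fX])
  have finX: "finite X" by (simp add: X_def)
  have d1: "(2::nat) \<ge> 1" by simp
  have "rigid f"
  proof (rule rigidI[OF f])
    fix g assume cc: "cconv g f"
      and g: "\<And>n. rational_map (g n) \<and> finite (postcritical_set (g n)) \<and> card (postcritical_set (g n)) = card (postcritical_set f)"
    obtain \<phi> where \<phi>: "\<And>x. x \<in> X \<Longrightarrow> sconv (\<lambda>n. \<phi> n x) x sequentially"
      and evg: "\<forall>\<^sub>F n in sequentially. critical_values (g n) = \<phi> n ` X \<and> (\<forall>x\<in>X. g n (\<phi> n x) = \<phi> n (f x))"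
      using perturbed_postcritical_set[OF f d1 finX Vf fX cc g] by blast
    have rg: "\<forall>\<^sub>F n in sequentially. \<exists>e. rat_deg e (g n)" using g rational_map_iff by (intro always_eventually) blast
    have \<phi>12: "sconv (\<lambda>n. \<phi> n x1) x1 sequentially" "sconv (\<lambda>n. \<phi> n x2) x2 sequentially" by (simp_all add: \<phi> X_def)
    obtain M where M: "cconv M id" "cconv (\<lambda>n. inv (M n)) id"
      and evM: "\<forall>\<^sub>F n in sequentially. mobius (M n) \<and> M n x1 = \<phi> n x1 \<and> M n x3 = x3 \<and> M n x2 = \<phi> n x2"
      using mobius_move[OF x3(1)[symmetric] x3(2) assms \<phi>12(1) sconv_const \<phi>12(2)] .
    obtain b where b: "sconv b x3 sequentially" "\<forall>\<^sub>F n in sequentially. g n (b n) = x3"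
      using preimage_persists[OF f d1 cc rg, of "\<lambda>_. x3" x3] sconv_const[of x3] fx(3) by metis
    define Tn where "Tn n = M n \<circ> T" for n
    define Ti' where "Ti' n = inv T \<circ> inv (M n)" for n
    have Tn_inv: "\<forall>\<^sub>F n in sequentially. mobius (Tn n) \<and> (\<forall>x. Ti' n (Tn n x) = x) \<and> (\<forall>x. Tn n (Ti' n x) = x) \<and> mobius (Ti' n)
        \<and> Tn n (Some 0) = \<phi> n x1 \<and> Tn n (Some 1) = x3 \<and> Tn n None = \<phi> n x2"
      using evM
    proof eventually_elim
      case (elim n)
      then have m: "mobius (M n)" by blast
      show ?case using elim T
        by (simp add: Tn_def Ti'_def mobius_inv_apply[OF m] mobius_inv_apply[OF T(1)] mobius_comp m mobius_inverse(2)[OF m] mobius_inverse(2)[OF T(1)])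
    qed
    have "sconv (\<lambda>n. inv T (inv (M n) (b n))) (Some 1) sequentially"
      using sphere_contD[OF mobius_sphere_cont[OF mobius_inverse(2)[OF T(1)]] cconv_seq[OF M(2) b(1)]] by (simp add: Ti)
    note kap = sconv_SomeD[OF this]
    define \<kappa> where "\<kappa> n = the (inv T (inv (M n) (b n)))" for n
    have \<kappa>: "\<kappa> \<longlonglongrightarrow> 1" "\<forall>\<^sub>F n in sequentially. Ti' n (b n) = Some (\<kappa> n)" "\<forall>\<^sub>F n in sequentially. \<kappa> n \<noteq> 0"
      using kap tendsto_imp_eventually_ne[OF kap(2)] by (simp_all add: \<kappa>_def[abs_def] Ti'_def)
    define S where "S n = lin (\<kappa> n) 0 0 1" for n
    have S1: "cconv S (lin 1 0 0 1)" unfolding S_def[abs_def] by (rule cconv_lin(1)) (simp_all add: \<kappa>)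
    have l1: "lin 1 0 0 1 = id"
    proof
      fix x show "lin 1 0 0 1 x = id x" using scale_simps[of 1] by (cases x) simp_all
    qed
    define N where "N n = Tn n \<circ> (S n \<circ> Ti' n)" for n
    have "cconv N ((id \<circ> T) \<circ> (id \<circ> (inv T \<circ> id)))"
      unfolding N_def[abs_def] Tn_def[abs_def] Ti'_def[abs_def]
      by (intro cconv_comp M S1[unfolded l1] cconv_const mobius_sphere_cont T(1) mobius_inverse(2)[OF T(1)])
    then have N: "cconv N id" using mobius_inverse(4)[OF T(1)] by simp
    define k where "k n = Tn n \<circ> (square_map \<circ> Ti' n)" for n
    have "cconv k ((id \<circ> T) \<circ> (square_map \<circ> (inv T \<circ> id)))"
      unfolding k_def[abs_def] Tn_def[abs_def] Ti'_def[abs_def]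
      by (intro cconv_comp M cconv_const mobius_sphere_cont sphere_cont_rat[OF rat_deg_square_map] T(1) mobius_inverse(2)[OF T(1)])
    then have k: "cconv k f" by (simp add: f_def o_assoc)
    have "cconv (\<lambda>n. g n \<circ> N n) (f \<circ> id)" by (intro cconv_comp cc N)
    then have gN: "cconv (\<lambda>n. g n \<circ> N n) f" by simp
    define Y where "Y = {x1, x2, x3}"
    define \<psi> where "\<psi> n x = (if x = x3 then x3 else \<phi> n x)" for n x
    have \<psi>: "\<psi> n x1 = \<phi> n x1" "\<psi> n x2 = \<phi> n x2" "\<psi> n x3 = x3" for n using x3 by (simp_all add: \<psi>_def)
    have \<psi>c: "sconv (\<lambda>n. \<psi> n x) x sequentially" if "x \<in> Y" for x
      using that by (auto simp: Y_def \<psi> \<phi>12 sconv_const)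
    have Y: "finite Y" "critical_values f \<subseteq> Y" "card Y = 3" using x3 assms by (auto simp: Y_def Vf X_def)
    have fY: "f a \<in> Y" if "a \<in> Y" for a using that by (auto simp: Y_def fx)
    have eq: "\<forall>\<^sub>F n in sequentially. k n = g n \<circ> N n"
    proof (rule local_uniqueness[OF f d1 Y(1,2) \<psi>c k _ gN _ Y(3) fY])
      show "\<forall>\<^sub>F n in sequentially. (\<exists>e. rat_deg e (k n)) \<and> critical_values (k n) \<subseteq> \<psi> n ` Y"
        using Tn_inv
      proof eventually_elim
        case (elim n)
        then have m: "mobius (Tn n)" "mobius (Ti' n)" by blast+
        have "rat_deg 2 (k n)" using rat_deg_mobius[OF rat_deg_square_map m] by (simp add: k_def o_assoc)
        moreover have "critical_values (k n) = {\<phi> n x1, \<phi> n x2}"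
          using critical_values_mobius_comp[OF rat_deg_square_map m] elim by (simp add: k_def o_assoc critical_values_square_map)
        ultimately show ?case by (auto simp: Y_def \<psi>)
      qed
      show "\<forall>\<^sub>F n in sequentially. (\<exists>e. rat_deg e (g n \<circ> N n)) \<and> critical_values (g n \<circ> N n) \<subseteq> \<psi> n ` Y"
        using rg evg Tn_inv \<kappa>(3)
      proof eventually_elim
        case (elim n)
        obtain e where e: "rat_deg e (g n)" using elim(1) by blast
        have m: "mobius (N n)"
          unfolding N_def S_def using elim(3,4) scale_simps(1) mobius_comp by blast
        show ?case using rat_deg_comp[OF e mobius_rat_deg[OF m]] critical_values_mobius_right[OF e m] elim(2)
          by (auto simp: Y_def X_def \<psi>)
      qed
      fix a assume "a \<in> Y"
      have "\<forall>\<^sub>F n in sequentially. k n (\<psi> n a) = \<psi> n (f a) \<and> (g n \<circ> N n) (\<psi> n a) = \<psi> n (f a)"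
        using Tn_inv \<kappa>(2,3) evg b(2)
      proof eventually_elim
        case (elim n)
        have ti: "Ti' n (\<phi> n x1) = Some 0" "Ti' n x3 = Some 1" "Ti' n (\<phi> n x2) = None" using elim(1) by metis+
        have kb: "Tn n (Some (\<kappa> n)) = b n" using elim(1,2) by metis
        have gx: "g n (\<phi> n x1) = \<phi> n x1" "g n (\<phi> n x2) = \<phi> n x2" using elim(4) by (simp_all add: X_def fx)
        have Sx: "S n (Some z) = Some (\<kappa> n * z)" "S n None = None" for z using scale_simps[OF elim(3)] by (simp_all add: S_def)
        have tx: "Tn n (Some 0) = \<phi> n x1" "Tn n (Some 1) = x3" "Tn n None = \<phi> n x2" using elim(1) by blast+
        show ?case using \<open>a \<in> Y\<close>
          by (auto simp: Y_def k_def N_def \<psi> fx ti Sx square_map_simps tx kb gx elim(5))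
      qed
      then show "\<exists>c. sconv c a sequentially \<and> (\<forall>\<^sub>F n in sequentially. k n (c n) = \<psi> n (f a) \<and> (g n \<circ> N n) (c n) = \<psi> n (f a))"
        using \<psi>c[OF \<open>a \<in> Y\<close>] by blast
    qed
    show "\<forall>\<^sub>F n in sequentially. conformally_conjugate f (g n)"
      using eq Tn_inv \<kappa>(3)
    proof eventually_elim
      case (elim n)
      have k2: "(\<kappa> n)\<^sup>2 \<noteq> 0" using elim(3) by simp
      \<comment> \<open>\<open>S n\<close> composed with the scaling by \<open>\<kappa> n\<close> is the scaling by \<open>(\<kappa> n)\<^sup>2\<close>.\<close>
      define \<alpha> where "\<alpha> = Tn n \<circ> (lin ((\<kappa> n)\<^sup>2) 0 0 1 \<circ> inv T)"
      have \<alpha>: "mobius \<alpha>" unfolding \<alpha>_def using elim(2) scale_simps(1)[OF k2] mobius_inverse(2)[OF T(1)] mobius_comp by blast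
      have Sx: "S n (Some z) = Some (\<kappa> n * z)" "S n None = None" for z using scale_simps[OF elim(3)] by (simp_all add: S_def)
      have gT: "g n (Tn n (S n x)) = Tn n (square_map x)" for x
        using fun_cong[OF elim(1), of "Tn n x"] elim(2) by (simp add: k_def N_def)
      have "g n (\<alpha> y) = \<alpha> (f y)" for y
      proof -
        obtain x where y: "y = T x" using mobius_inv_apply(2)[OF T(1)] by metis
        have "lin ((\<kappa> n)\<^sup>2) 0 0 1 x = S n (lin (\<kappa> n) 0 0 1 x)"
        proof (cases x)
          case (Some z)
          have "(\<kappa> n)\<^sup>2 * z = \<kappa> n * (\<kappa> n * z)" by (simp add: power2_eq_square)
          then show ?thesis by (simp only: Some scale_simps[OF k2] scale_simps[OF elim(3)] Sx)
        qed (simp only: scale_simps[OF k2] scale_simps[OF elim(3)] Sx)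
        then have "\<alpha> y = Tn n (S n (lin (\<kappa> n) 0 0 1 x))"
          by (simp add: \<alpha>_def y mobius_inv_apply[OF T(1)])
        then have "g n (\<alpha> y) = Tn n (square_map (lin (\<kappa> n) 0 0 1 x))" by (simp add: gT)
        also have "\<dots> = \<alpha> (f y)"
          by (cases x) (simp_all add: \<alpha>_def f_def y mobius_inv_apply[OF T(1)] scale_simps[OF k2] scale_simps[OF elim(3)] square_map_simps power_mult_distrib)
        finally show ?thesis .
      qed
      then have "g n = \<alpha> \<circ> f \<circ> inv \<alpha>"
        by (intro ext) (metis comp_apply mobius_inv_apply(2)[OF \<alpha>])
      then show ?case by (rule conformally_conjugateI[OF \<alpha>])
    qed
  qed
  moreover have "rational_map f" using f rational_map_iff by blast
  moreover have "postcritically_finite f" using PX finX by (simp add: postcritically_finite_def)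
  ultimately show ?thesis using PX unfolding X_def by blast
qed

theorem theorem1p1:
  fixes X :: "sphere set"
  assumes "finite X" and "X \<subseteq> P1_Qbar" and "card X \<ge> 2"
  shows "\<exists>f. rational_map f \<and> postcritically_finite f \<and> rigid f \<and> postcritical_set f = X"
proof (cases "card X = 2")
  case True
  then obtain x1 x2 where "X = {x1, x2}" "x1 \<noteq> x2" by (auto simp: card_2_iff)
  then show ?thesis using exists_rigid_two_points by blast
next
  case False
  then show ?thesis using exists_rigid_many_points[OF assms(1,2)] assms(3) by simp
qed

end
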